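(* Let $p$ be an odd prime. The following conditions are equivalent: (1) $p$ is a Fermat prime; (2) the topological group $\mathrm{SL}(p-1,(\mathbb{Q},\tau_p))$ is minimal, where $(\mathbb{Q},\tau_p)$ is the field of rationals equipped with the $p$-adic topology; (3) the topological group $\mathrm{SL}(p-1,\mathbb{Q}(i))$ is minimal, where $\mathbb{Q}(i)=\{a+bi : a,b\in\mathbb{Q}\}\subset\mathbb{C}$ is the Gaussian rational field with the topology inherited from $\mathbb{C}$.
   Context: A Fermat prime is a prime of the form $2^{2^m}+1$ with $m\ge 0$ an integer. All topological groups are Hausdorff. For a topological field $\mathbb{F}$, $\mathrm{SL}(n,\mathbb{F})$ is the group of $n\times n$ matrices over $\mathbb{F}$ of determinant $1$, with the pointwise topology inherited from $\mathbb{F}^{n^2}$. A topological group $G$ is minimal if every continuous group isomorphism $f\colon G\to H$ onto a (Hausdorff) topological group $H$ is a topological isomorphism; equivalently, $G$ admits no strictly coarser Hausdorff group topology. The $p$-adic topology on $\mathbb{Q}$ is the one inherited from the field $\mathbb{Q}_p$ of $p$-adic numbers. *)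

theory Defs
  imports
    "HOL-Analysis.Function_Topology"
    "HOL-Analysis.Abstract_Metric_Spaces"
    "HOL-Analysis.T1_Spaces"
    "HOL-Computational_Algebra.Primes"
    "HOL-Computational_Algebra.Squarefree"
    "Jordan_Normal_Form.Determinant"
begin

definition fermat_prime :: "nat \<Rightarrow> bool" where
  "fermat_prime p \<longleftrightarrow> Factorial_Ring.prime p \<and> (\<exists>m::nat. p = 2 ^ (2 ^ m) + 1)"


section \<open>Hausdorff topological groups and minimality\<close>

definition topological_group :: "('a, 'm) monoid_scheme \<Rightarrow> 'a topology \<Rightarrow> bool" where
  "topological_group G T \<longleftrightarrow>
     Group.group G \<and> topspace T = carrier G \<and> Hausdorff_space T \<and>
     continuous_map (prod_topology T T) T (\<lambda>(x, y). x \<otimes>\<^bsub>G\<^esub> y) \<and>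
     continuous_map T T (\<lambda>x. inv\<^bsub>G\<^esub> x)"

text \<open>
  HOL cannot quantify over types inside a definition, so the codomain \<open>H\<close> ranges over the
  topological groups whose carrier is a set of the same type as that of \<open>G\<close>. This loses nothing,
  since the codomain of an isomorphism from \<open>G\<close> can be transported to \<open>carrier G\<close>: see
  \<open>minimal_topological_group_any_type\<close>.
\<close>

definition minimal_topological_group :: "('a, 'm) monoid_scheme \<Rightarrow> 'a topology \<Rightarrow> bool" where
  "minimal_topological_group G T \<longleftrightarrow>
     topological_group G T \<and>
     (\<forall>(H :: 'a monoid) S f.
        topological_group H S \<and> f \<in> iso G H \<and> continuous_map T S f \<longrightarrow> homeomorphic_map T S f)"

lemma topological_group_pullback:
  assumes G: "Group.group G" and H: "topological_group H S" and f: "f \<in> iso G H"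
  shows "topological_group G (pullback_topology (carrier G) f S)" (is "topological_group G ?T")
proof -
  interpret G: Group.group G by fact
  interpret H: Group.group H using H by (simp add: topological_group_def)
  have hom: "f \<in> hom G H" and bij: "bij_betw f (carrier G) (carrier H)"
    using f by (auto simp: iso_def)
  interpret group_hom G H f by unfold_locales (rule hom)
  have tS: "topspace S = carrier H" and haus: "Hausdorff_space S"
    and mul: "continuous_map (prod_topology S S) S (\<lambda>(x, y). x \<otimes>\<^bsub>H\<^esub> y)"
    and inv: "continuous_map S S (\<lambda>x. inv\<^bsub>H\<^esub> x)"
    using H by (auto simp: topological_group_def)
  have tT: "topspace ?T = carrier G"
    by (auto simp: topspace_pullback_topology tS)
  have cf: "continuous_map ?T S f"
    using continuous_map_pullback[OF continuous_map_id[of S], where A = "carrier G" and f = f]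
    by simp
  have "Hausdorff_space ?T"
    by (rule Hausdorff_space_injective_preimage[OF haus cf]) (use bij in \<open>simp add: tT bij_betw_def\<close>)
  moreover have "continuous_map (prod_topology ?T ?T) ?T (\<lambda>(x, y). x \<otimes>\<^bsub>G\<^esub> y)"
  proof (rule continuous_map_pullback')
    have "continuous_map (prod_topology ?T ?T) (prod_topology S S) (\<lambda>z. (f (fst z), f (snd z)))"
      using cf continuous_map_fst[of ?T ?T] continuous_map_snd[of ?T ?T]
      by (intro continuous_map_pairedI) (auto intro: continuous_map_compose[unfolded o_def])
    from continuous_map_compose[OF this mul]
    show "continuous_map (prod_topology ?T ?T) S (f \<circ> (\<lambda>(x, y). x \<otimes>\<^bsub>G\<^esub> y))"
      by (rule continuous_map_eq) (auto simp: tT)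
  qed (auto simp: tT)
  moreover have "continuous_map ?T ?T (\<lambda>x. inv\<^bsub>G\<^esub> x)"
  proof (rule continuous_map_pullback')
    from continuous_map_compose[OF cf inv]
    show "continuous_map ?T S (f \<circ> (\<lambda>x. inv\<^bsub>G\<^esub> x))"
      by (rule continuous_map_eq) (auto simp: tT)
  qed (auto simp: tT)
  ultimately show ?thesis
    using G tT by (simp add: topological_group_def)
qed

lemma minimal_topological_group_coarser:
  assumes min: "minimal_topological_group G T" and T': "topological_group G T'"
    and coarser: "\<And>U. openin T' U \<Longrightarrow> openin T U"
  shows "T' = T"
proof -
  define K :: "'a monoid" where
    "K = \<lparr>carrier = carrier G, mult = mult G, one = one G\<rparr>"
  have G: "Group.group G" and tT: "topspace T = carrier G" and tT': "topspace T' = carrier G"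
    using min T' by (auto simp: minimal_topological_group_def topological_group_def)
  interpret G: Group.group G by fact
  have K: "Group.group K"
    by (rule groupI) (auto simp: K_def G.m_assoc intro: G.l_inv_ex)
  have "m_inv K = m_inv G"
    by (auto simp: m_inv_def K_def fun_eq_iff)
  then have "topological_group K T'"
    using T' K by (simp add: topological_group_def) (simp add: K_def)
  moreover have "(\<lambda>x. x) \<in> iso G K"
    by (auto simp: iso_def hom_def K_def bij_betw_def)
  moreover have "continuous_map T T' (\<lambda>x. x)"
  proof -
    have "{x \<in> topspace T. x \<in> U} = U" if "openin T' U" for U
      using openin_subset[OF that] tT tT' by auto
    then show ?thesis
      using coarser tT tT' by (simp add: continuous_map)
  qed
  ultimately have "homeomorphic_map T T' (\<lambda>x. x)"
    using min by (auto simp: minimal_topological_group_def)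
  then have "openin T U \<longleftrightarrow> openin T' U" for U
    using homeomorphic_map_openness_eq[of T T' "\<lambda>x. x" U] tT tT' openin_subset[of T' U]
    by auto
  then show ?thesis
    by (simp add: topology_eq)
qed

lemma minimal_topological_group_any_type:
  fixes H :: "('b, 'n) monoid_scheme"
  assumes min: "minimal_topological_group G T" and H: "topological_group H S"
    and f: "f \<in> iso G H" and cont: "continuous_map T S f"
  shows "homeomorphic_map T S f"
proof -
  let ?T = "pullback_topology (carrier G) f S"
  have G: "Group.group G" and tT: "topspace T = carrier G"
    using min by (auto simp: minimal_topological_group_def topological_group_def)
  have tS: "topspace S = carrier H"
    using H by (simp add: topological_group_def)
  have bij: "bij_betw f (carrier G) (carrier H)"
    using f by (auto simp: iso_def)
  have "?T = T"
  proof (rule minimal_topological_group_coarser[OF min topological_group_pullback[OF G H f]])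
    fix U assume "openin ?T U"
    then obtain V where "openin S V" "U = f -` V \<inter> topspace T"
      by (auto simp: openin_pullback_topology tT)
    then show "openin T U"
      using cont by (auto simp: continuous_map_alt)
  qed
  then have "openin T U \<longleftrightarrow> (\<exists>V. openin S V \<and> U = f -` V \<inter> carrier G)" for U
    by (metis openin_pullback_topology)
  moreover have "f ` (f -` V \<inter> carrier G) = V" if "openin S V" for V
  proof -
    have "V \<subseteq> f ` carrier G"
      using openin_subset[OF that] bij by (simp add: tS bij_betw_def)
    then show ?thesis by blast
  qed
  ultimately have "open_map T S f"
    unfolding open_map_def by metis
  then show ?thesis
    using cont bij tS tT bijective_open_imp_homeomorphic_map[of T S f]
    by (simp add: bij_betw_def)
qed


section \<open>The special linear group over a topological field\<close>

text \<open>
  A topological field is given by a topology \<open>T\<close> whose underlying set is a subfield of the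
  type \<open>'a\<close>.
\<close>

definition SL :: "nat \<Rightarrow> 'a::field topology \<Rightarrow> 'a mat monoid" where
  "SL n T =
     \<lparr>carrier = {A \<in> carrier_mat n n. (\<forall>i<n. \<forall>j<n. A $$ (i, j) \<in> topspace T) \<and> det A = 1},
      mult = (*), one = 1\<^sub>m n\<rparr>"

definition SL_topology :: "nat \<Rightarrow> 'a::field topology \<Rightarrow> 'a mat topology" where
  "SL_topology n T =
     pullback_topology (carrier (SL n T))
       (\<lambda>A. \<lambda>ij\<in>{..<n} \<times> {..<n}. A $$ ij)
       (product_topology (\<lambda>_. T) ({..<n} \<times> {..<n}))"


section \<open>The two topological fields\<close>

definition padic_val :: "nat \<Rightarrow> rat \<Rightarrow> int" where
  "padic_val p x =
     (case quotient_of x of (a, b) \<Rightarrow> int (multiplicity (int p) a) - int (multiplicity (int p) b))"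

definition padic_abs :: "nat \<Rightarrow> rat \<Rightarrow> real" where
  "padic_abs p x = (if x = 0 then 0 else real p powi (- padic_val p x))"

text \<open>
  The field of \<open>p\<close>-adic numbers is the completion of the rationals with respect to the metric
  below, so the topology the rationals inherit from it is the one of this metric.
\<close>

definition padic_topology :: "nat \<Rightarrow> rat topology" where
  "padic_topology p = Metric_space.mtopology UNIV (\<lambda>x y. padic_abs p (x - y))"

lemma padic_val_of_int_divide:
  assumes p: "Factorial_Ring.prime p" and "a \<noteq> 0" "b \<noteq> 0"
  shows "padic_val p (of_int a / of_int b) =
    int (multiplicity (int p) a) - int (multiplicity (int p) b)"
proof -
  obtain c d where cd: "quotient_of (of_int a / of_int b) = (c, d)"
    by fastforce
  have d: "d \<noteq> 0" and eq: "(of_int a / of_int b :: rat) = of_int c / of_int d"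
    using quotient_of_denom_pos[OF cd] quotient_of_div[OF cd] by auto
  have c: "c \<noteq> 0" using eq assms by auto
  have "(of_int (a * d) :: rat) = of_int (c * b)"
    using eq d assms by (simp add: field_simps)
  then have e: "a * d = c * b" by (simp only: of_int_eq_iff)
  have pe: "prime_elem (int p)" using p by simp
  have "multiplicity (int p) a + multiplicity (int p) d
      = multiplicity (int p) c + multiplicity (int p) b"
    using e pe assms c d by (metis prime_elem_multiplicity_mult_distrib)
  then show ?thesis by (simp add: padic_val_def cd)
qed

lemma padic_val_add_ge:
  assumes p: "Factorial_Ring.prime p" and "x \<noteq> 0" "y \<noteq> 0" "x + y \<noteq> 0"
  shows "padic_val p (x + y) \<ge> min (padic_val p x) (padic_val p y)"
proof -
  obtain a b c d where q: "quotient_of x = (a, b)" "quotient_of y = (c, d)"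
    by (meson surj_pair)
  have b: "b \<noteq> 0" and d: "d \<noteq> 0" and x: "x = of_int a / of_int b" and y: "y = of_int c / of_int d"
    using quotient_of_denom_pos[OF q(1)] quotient_of_denom_pos[OF q(2)]
      quotient_of_div[OF q(1)] quotient_of_div[OF q(2)] by auto
  have pe: "prime_elem (int p)" using p by simp
  let ?v = "\<lambda>z. multiplicity (int p) z"
  have xy: "x = of_int (a * d) / of_int (b * d)" "y = of_int (c * b) / of_int (b * d)"
      "x + y = of_int (a * d + c * b) / of_int (b * d)"
    using b d by (simp_all add: x y field_simps)
  have nz: "a * d \<noteq> 0" "c * b \<noteq> 0" "b * d \<noteq> 0" "a * d + c * b \<noteq> 0"
  proof -
    show "b * d \<noteq> 0" using b d by simp
    show "a * d \<noteq> 0" using xy(1) \<open>x \<noteq> 0\<close> by (metis div_0 of_int_0)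
    show "c * b \<noteq> 0" using xy(2) \<open>y \<noteq> 0\<close> by (metis div_0 of_int_0)
    show "a * d + c * b \<noteq> 0" using xy(3) \<open>x + y \<noteq> 0\<close> by (metis div_0 of_int_0)
  qed
  have "int p ^ min (?v (a * d)) (?v (c * b)) dvd a * d + c * b"
    by (intro dvd_add multiplicity_dvd') auto
  then have "min (?v (a * d)) (?v (c * b)) \<le> ?v (a * d + c * b)"
    using pe nz by (intro multiplicity_geI) (auto simp: prime_elem_def)
  then show ?thesis
    unfolding xy(3) unfolding xy(1,2) using nz
    by (simp only: padic_val_of_int_divide[OF p] if_False not_False_eq_True)
qed

lemma padic_abs_nonneg: "padic_abs p x \<ge> 0"
  by (simp add: padic_abs_def)

lemma Metric_space_padic:
  assumes p: "Factorial_Ring.prime p"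
  shows "Metric_space UNIV (\<lambda>x y. padic_abs p (x - y))"
proof
  have p1: "real p > 1" using prime_gt_1_nat[OF p] by simp
  have neg: "padic_abs p (- x) = padic_abs p x" for x
    by (cases "quotient_of x") (simp add: padic_abs_def padic_val_def rat_uminus_code)
  show "padic_abs p (x - y) = padic_abs p (y - x)" for x y
    using neg[of "x - y"] by simp
  show "padic_abs p (x - y) = 0 \<longleftrightarrow> x = y" for x y
    using p1 by (simp add: padic_abs_def)
  have add: "padic_abs p (x + y) \<le> padic_abs p x + padic_abs p y" for x y
  proof (cases "x = 0 \<or> y = 0 \<or> x + y = 0")
    case True
    then show ?thesis
      using padic_abs_nonneg[of p x] padic_abs_nonneg[of p y] by (auto simp: padic_abs_def)
  next
    case False
    then have "- padic_val p (x + y) \<le> - padic_val p x \<or> - padic_val p (x + y) \<le> - padic_val p y"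
      using padic_val_add_ge[OF p, of x y] by linarith
    then have "padic_abs p (x + y) \<le> padic_abs p x \<or> padic_abs p (x + y) \<le> padic_abs p y"
      using False p1 unfolding padic_abs_def by (auto intro: power_int_increasing)
    then show ?thesis
      using padic_abs_nonneg[of p x] padic_abs_nonneg[of p y] by linarith
  qed
  show "padic_abs p (x - z) \<le> padic_abs p (x - y) + padic_abs p (y - z)" for x y z
    using add[of "x - y" "y - z"] by simp
qed (rule padic_abs_nonneg)

definition gauss_rat :: "complex set" where
  "gauss_rat = {of_rat a + of_rat b * \<i> | a b :: rat. True}"

definition gauss_rat_topology :: "complex topology" where
  "gauss_rat_topology = subtopology euclidean gauss_rat"

end

theory Submission
  imports Defs "HOL-Number_Theory.Residue_Primitive_Roots"
begin

text \<open>
  Put \<open>n = p - 1\<close>; then \<open>p\<close> is a Fermat prime iff \<open>n\<close> is a power of \<open>2\<close>.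

  If an odd prime \<open>q\<close> divides \<open>n\<close>, the \<open>q\<close>-th tensor power representation is
  injective on \<open>SL(n, K)\<close>, because \<open>K\<close> contains no \<open>q\<close>-th root of unity except
  \<open>1\<close>. The topology that it induces is strictly coarser: if \<open>c\<close> tends to a primitive
  \<open>q\<close>-th root of unity of the completion, then \<open>diag(c, ..., c, c^(1-n))\<close> tends to the
  identity in it.

  Let \<open>n\<close> be a power of \<open>2\<close> and \<open>T'\<close> a coarser group topology. Bounded sets are
  precompact, so conjugation by bounded matrices is equicontinuous at the identity, and products of
  boundedly many bounded conjugates of \<open>b\<close> and its inverse are \<open>T'\<close>-close to the
  identity whenever \<open>b\<close> is. From any bounded matrix that stays away from the scalars, such
  products reach a fixed elementary transvection, so this matrix is not \<open>T'\<close>-close to the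
  identity. If \<open>A\<close> is \<open>T'\<close>-close to the identity and large, then it conjugates some
  elementary transvection that is close to the identity into a bounded matrix
  \<open>1 + s (column of A) (row of A^-1)\<close> that stays away from the scalars, which is impossible.
  Hence small \<open>T'\<close>-neighbourhoods of the identity consist of bounded and nearly scalar
  matrices. For such a matrix with diagonal entries close to \<open>x\<close> the determinant shows that
  \<open>x ^ n\<close> is close to \<open>1\<close>; taking square roots repeatedly, and using that
  \<open>- 1\<close> is separated from the identity, \<open>x\<close> is close to \<open>1\<close>. No completion of
  \<open>K\<close> is needed.
\<close>

section \<open>Subfields with an absolute value\<close>

text \<open>The centre decides everything: matrices close to the identity in a coarser group
  topology are nearly scalar, and the scalar is nearly an \<open>n\<close>-th root of unity of the
  completion. The \<open>p\<close>-adic numbers contain all \<open>(p - 1)\<close>-th roots of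
  unity, whence \<open>n = p - 1\<close>, and the complex numbers contain all roots, whereas
  \<open>K\<close> has no nontrivial ones of odd order. If \<open>n\<close> is a power of 2, every
  nontrivial group of such scalars contains \<open>- 1\<close>, which lies in \<open>K\<close>, so
  the Hausdorff axiom can exclude it. If an odd prime \<open>q\<close> divides \<open>n\<close>, the
  \<open>q\<close>-th roots can be approached from \<open>K\<close> but not reached, and the axiom
  does not see them.

  The obstacle in the minimality half is that conjugation is equicontinuous only over bounded sets,
  so every auxiliary matrix needs a radius that does not depend on the matrix treated; this explains
  the explicit constants. Only the triangle inequality is assumed of \<open>nv\<close>, which treats
  the \<open>p\<close>-adic and the complex case at once and leaves values such as
  \<open>nv 2\<close> and \<open>nv (of_nat n)\<close> in the bounds. Characteristic 0 provides
  halves and keeps \<open>n\<close> from being 0 and \<open>4 ^ n\<close> from being 1.\<close>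

locale valued_subfield =
  fixes K :: "'a::field_char_0 set" and nv :: "'a \<Rightarrow> real"
  assumes nv_nonneg [simp]: "nv x \<ge> 0"
    and nv_eq_0_iff [simp]: "nv x = 0 \<longleftrightarrow> x = 0"
    and nv_mult: "nv (x * y) = nv x * nv y"
    and nv_triangle: "nv (x + y) \<le> nv x + nv y"
    and K_1 [simp]: "1 \<in> K"
    and K_diff [simp]: "x \<in> K \<Longrightarrow> y \<in> K \<Longrightarrow> x - y \<in> K"
    and K_mult [simp]: "x \<in> K \<Longrightarrow> y \<in> K \<Longrightarrow> x * y \<in> K"
    and K_inverse [simp]: "x \<in> K \<Longrightarrow> inverse x \<in> K"
begin

lemma K_0 [simp]: "0 \<in> K"
  using K_diff[OF K_1 K_1] by simp

lemma K_uminus [simp]: "x \<in> K \<Longrightarrow> - x \<in> K"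
  using K_diff[OF K_0, of x] by simp

lemma K_add [simp]: "x \<in> K \<Longrightarrow> y \<in> K \<Longrightarrow> x + y \<in> K"
  using K_diff[of x "- y"] by simp

lemma K_divide [simp]: "x \<in> K \<Longrightarrow> y \<in> K \<Longrightarrow> x / y \<in> K"
  by (simp add: divide_inverse)

lemma K_sum [simp]: "(\<And>i. i \<in> A \<Longrightarrow> f i \<in> K) \<Longrightarrow> sum f A \<in> K"
  by (induction A rule: infinite_finite_induct) auto

lemma K_prod [simp]: "(\<And>i. i \<in> A \<Longrightarrow> f i \<in> K) \<Longrightarrow> prod f A \<in> K"
  by (induction A rule: infinite_finite_induct) auto

lemma K_power [simp]: "x \<in> K \<Longrightarrow> x ^ m \<in> K"
  by (induction m) auto

lemma K_of_nat [simp]: "of_nat m \<in> K"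
  by (induction m) auto

lemma K_numeral [simp]: "numeral m \<in> K"
  using K_of_nat[of "numeral m"] by simp

lemma nv_0 [simp]: "nv 0 = 0"
  by simp

lemma nv_pos [simp]: "0 < nv x \<longleftrightarrow> x \<noteq> 0"
  by (metis less_le nv_nonneg nv_eq_0_iff)

lemma nv_1 [simp]: "nv 1 = 1"
  using nv_mult[of 1 1] by simp

lemma nv_minus [simp]: "nv (- x) = nv x"
proof -
  have "(nv (- 1))\<^sup>2 = 1"
    using nv_mult[of "- 1" "- 1"] by (simp add: power2_eq_square)
  then have "nv (- 1) = 1"
    using nv_nonneg[of "- 1"] by (auto simp: power2_eq_1_iff)
  then show ?thesis
    using nv_mult[of "- 1" x] by simp
qed

lemma nv_diff_commute: "nv (x - y) = nv (y - x)"
  using nv_minus[of "x - y"] by simp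

lemma nv_power: "nv (x ^ m) = nv x ^ m"
  by (induction m) (auto simp: nv_mult)

lemma nv_inverse: "nv (inverse x) = inverse (nv x)"
proof (cases "x = 0")
  case False
  then have "nv x * nv (inverse x) = 1"
    by (simp flip: nv_mult)
  then show ?thesis
    by (metis inverse_unique)
qed simp

lemma nv_divide: "nv (x / y) = nv x / nv y"
  by (simp add: divide_inverse nv_mult nv_inverse)

lemma nv_triangle_diff: "nv (x - y) \<le> nv x + nv y"
  using nv_triangle[of x "- y"] by simp

lemma nv_triangle_sub: "nv x \<le> nv y + nv (x - y)"
  using nv_triangle[of y "x - y"] by simp

lemma nv_sum: "nv (sum f A) \<le> (\<Sum>i\<in>A. nv (f i))"
  proof (induction A rule: infinite_finite_induct)
  case (insert i A)
  then show ?case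
    using nv_triangle[of "f i" "sum f A"] by simp
qed auto

lemma nv_prod: "nv (prod f A) = (\<Prod>i\<in>A. nv (f i))"
  by (induction A rule: infinite_finite_induct) (auto simp: nv_mult)

lemma nv_sum_bound: "(\<And>i. i \<in> A \<Longrightarrow> nv (f i) \<le> c) \<Longrightarrow> nv (sum f A) \<le> real (card A) * c"
  using order_trans[OF nv_sum sum_bounded_above[of A "\<lambda>i. nv (f i)" c]] by simp

section \<open>Boundedness and asymptotic closeness along a filter\<close>

definition bounded_along :: "'b filter \<Rightarrow> ('b \<Rightarrow> 'a) \<Rightarrow> bool" where
  "bounded_along F f \<longleftrightarrow> (\<exists>C. \<forall>\<^sub>F x in F. nv (f x) \<le> C)"

text \<open>One calculus serves three filters: point neighbourhoods for continuity into
  \<open>T\<close>, \<open>sequentially\<close> for limits, and the \<open>T'\<close>-neighbourhoods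
  of the identity. Both arguments may move, since a limit need not exist in the incomplete field
  \<open>K\<close>.\<close>

definition close_along :: "'b filter \<Rightarrow> ('b \<Rightarrow> 'a) \<Rightarrow> ('b \<Rightarrow> 'a) \<Rightarrow> bool" where
  "close_along F f g \<longleftrightarrow> ((\<lambda>x. nv (f x - g x)) \<longlongrightarrow> 0) F"

lemma close_along_iff: "close_along F f g \<longleftrightarrow> (\<forall>e>0. \<forall>\<^sub>F x in F. nv (f x - g x) < e)"
  by (simp add: close_along_def tendsto_iff)

lemma close_alongI: "((\<lambda>x. h x) \<longlongrightarrow> 0) F \<Longrightarrow> (\<forall>\<^sub>F x in F. nv (f x - g x) \<le> h x) \<Longrightarrow> close_along F f g"
  unfolding close_along_def by (rule tendsto_sandwich[of "\<lambda>_. 0"]) auto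

lemma close_along_refl [simp]: "close_along F f f"
  by (simp add: close_along_def)

lemma close_along_sym: "close_along F f g \<Longrightarrow> close_along F g f"
  unfolding close_along_def by (subst nv_diff_commute)

lemma close_along_add: "close_along F f f' \<Longrightarrow> close_along F g g' \<Longrightarrow> close_along F (\<lambda>x. f x + g x) (\<lambda>x. f' x + g' x)"
proof -
  assume "close_along F f f'" "close_along F g g'"
  then have "((\<lambda>x. nv (f x - f' x) + nv (g x - g' x)) \<longlongrightarrow> 0) F"
    unfolding close_along_def using tendsto_add by fastforce
  moreover have "nv (f x + g x - (f' x + g' x)) \<le> nv (f x - f' x) + nv (g x - g' x)" for x
    using nv_triangle[of "f x - f' x" "g x - g' x"] by (simp add: algebra_simps)
  ultimately show ?thesis by (intro close_alongI) auto
qed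

lemma close_along_trans: "close_along F f g \<Longrightarrow> close_along F g h \<Longrightarrow> close_along F f h"
proof -
  assume "close_along F f g" "close_along F g h"
  from close_along_add[OF this] show "close_along F f h"
    by (simp add: close_along_def algebra_simps)
qed

lemma close_along_sum: "(\<And>i. i \<in> A \<Longrightarrow> close_along F (f i) (g i)) \<Longrightarrow> close_along F (\<lambda>x. \<Sum>i\<in>A. f i x) (\<lambda>x. \<Sum>i\<in>A. g i x)"
  by (induction A rule: infinite_finite_induct) (auto intro: close_along_add)

lemma bounded_along_const [simp]: "bounded_along F (\<lambda>_. c)"
  unfolding bounded_along_def by (auto intro: exI[of _ "nv c"])

lemma bounded_along_close: "close_along F f g \<Longrightarrow> bounded_along F g \<Longrightarrow> bounded_along F f"
proof -
  assume *: "close_along F f g" "bounded_along F g"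
  then obtain C where C: "\<forall>\<^sub>F x in F. nv (g x) \<le> C"
    by (auto simp: bounded_along_def)
  have "\<forall>\<^sub>F x in F. nv (f x - g x) < 1"
    using * by (simp add: close_along_iff)
  with C have "\<forall>\<^sub>F x in F. nv (f x) \<le> C + 1"
  proof eventually_elim
    case (elim x)
    then show ?case using nv_triangle_sub[of "f x" "g x"] by linarith
  qed
  then show ?thesis by (auto simp: bounded_along_def)
qed

lemma bounded_along_mult: "bounded_along F f \<Longrightarrow> bounded_along F g \<Longrightarrow> bounded_along F (\<lambda>x. f x * g x)"
proof -
  assume "bounded_along F f" "bounded_along F g"
  then obtain C D where C: "\<forall>\<^sub>F x in F. nv (f x) \<le> C" and D: "\<forall>\<^sub>F x in F. nv (g x) \<le> D"
    by (auto simp: bounded_along_def)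
  from C D have "\<forall>\<^sub>F x in F. nv (f x * g x) \<le> \<bar>C\<bar> * \<bar>D\<bar>"
    by eventually_elim (auto simp: nv_mult intro!: mult_mono)
  then show ?thesis by (auto simp: bounded_along_def)
qed

lemma bounded_along_prod: "(\<And>i. i \<in> A \<Longrightarrow> bounded_along F (f i)) \<Longrightarrow> bounded_along F (\<lambda>x. \<Prod>i\<in>A. f i x)"
  by (induction A rule: infinite_finite_induct) (auto intro: bounded_along_mult)

lemma bounded_along_power: "bounded_along F f \<Longrightarrow> bounded_along F (\<lambda>x. f x ^ m)"
  by (induction m) (auto intro: bounded_along_mult)

lemma close_along_0_mult: "close_along F f (\<lambda>_. 0) \<Longrightarrow> bounded_along F g \<Longrightarrow> close_along F (\<lambda>x. f x * g x) (\<lambda>_. 0)"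
proof -
  assume *: "close_along F f (\<lambda>_. 0)" "bounded_along F g"
  then obtain C where C: "\<forall>\<^sub>F x in F. nv (g x) \<le> C"
    by (auto simp: bounded_along_def)
  have "((\<lambda>x. nv (f x) * C) \<longlongrightarrow> 0) F"
    using * by (auto simp: close_along_def intro: tendsto_mult_left_zero)
  moreover from C have "\<forall>\<^sub>F x in F. nv (f x * g x - 0) \<le> nv (f x) * C"
    by eventually_elim (auto simp: nv_mult intro: mult_left_mono)
  ultimately show ?thesis by (rule close_alongI)
qed

lemma close_along_diff_0_iff: "close_along F (\<lambda>x. f x - g x) (\<lambda>_. 0) \<longleftrightarrow> close_along F f g"
  by (simp add: close_along_def)

lemma close_along_mult:
  assumes "close_along F f f'" "close_along F g g'" "bounded_along F f'" "bounded_along F g'"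
  shows "close_along F (\<lambda>x. f x * g x) (\<lambda>x. f' x * g' x)"
proof -
  have "close_along F (\<lambda>x. (f x - f' x) * g x) (\<lambda>_. 0)" "close_along F (\<lambda>x. (g x - g' x) * f' x) (\<lambda>_. 0)"
    using assms by (auto intro!: close_along_0_mult intro: bounded_along_close simp: close_along_diff_0_iff)
  from close_along_add[OF this] have "close_along F (\<lambda>x. f x * g x - f' x * g' x) (\<lambda>_. 0)"
    by (simp add: algebra_simps)
  then show ?thesis by (simp add: close_along_diff_0_iff)
qed

lemma close_along_prod:
  assumes "\<And>i. i \<in> A \<Longrightarrow> close_along F (f i) (g i)" "\<And>i. i \<in> A \<Longrightarrow> bounded_along F (g i)"
  shows "close_along F (\<lambda>x. \<Prod>i\<in>A. f i x) (\<lambda>x. \<Prod>i\<in>A. g i x)"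
  using assms by (induction A rule: infinite_finite_induct) (auto intro!: close_along_mult bounded_along_prod)

lemma close_along_power: "close_along F f g \<Longrightarrow> bounded_along F g \<Longrightarrow> close_along F (\<lambda>x. f x ^ m) (\<lambda>x. g x ^ m)"
  by (induction m) (auto intro!: close_along_mult bounded_along_power)

lemma close_along_inverse_1:
  assumes "close_along F f (\<lambda>_. 1)"
  shows "close_along F (\<lambda>x. inverse (f x)) (\<lambda>_. 1)"
proof (rule close_alongI)
  show "((\<lambda>x. 2 * nv (f x - 1)) \<longlongrightarrow> 0) F"
    using assms by (auto simp: close_along_def intro: tendsto_mult_right_zero)
  have "\<forall>\<^sub>F x in F. nv (f x - 1) < 1/2"
    by (rule assms[unfolded close_along_iff, rule_format]) simp
  then show "\<forall>\<^sub>F x in F. nv (inverse (f x) - 1) \<le> 2 * nv (f x - 1)"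
  proof eventually_elim
    case (elim x)
    have "1 \<le> nv (f x) + nv (1 - f x)"
      using nv_triangle_sub[of 1 "f x"] by simp
    then have h: "nv (f x) > 1/2"
      using elim nv_diff_commute[of 1 "f x"] by simp
    then have "f x \<noteq> 0" by auto
    then have "inverse (f x) - 1 = (1 - f x) / f x"
      by (simp add: field_simps)
    then have "nv (inverse (f x) - 1) = nv (f x - 1) / nv (f x)"
      by (simp add: nv_divide nv_diff_commute)
    also have "\<dots> \<le> nv (f x - 1) / (1/2)"
      using h by (intro divide_left_mono) auto
    finally show ?case by simp
  qed
qed

lemma close_along_const_imp_eq: "close_along F (\<lambda>_. a) (\<lambda>_. b) \<Longrightarrow> F \<noteq> bot \<Longrightarrow> a = b"
  unfolding close_along_def by (simp add: tendsto_const_iff)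

section \<open>The metric topology on K\<close>

sublocale M: Metric_space UNIV "\<lambda>x y. nv (x - y)"
proof
  show "nv (x - z) \<le> nv (x - y) + nv (y - z)" for x y z
    using nv_triangle[of "x - y" "y - z"] by simp
  show "nv (x - y) = nv (y - x)" for x y
    by (rule nv_diff_commute)
qed simp_all

definition T :: "'a topology" where
  "T = subtopology M.mtopology K"

lemma topspace_T [simp]: "topspace T = K"
  by (simp add: T_def)

lemma Hausdorff_T: "Hausdorff_space T"
  by (simp add: T_def Hausdorff_space_subtopology M.Hausdorff_space_mtopology)

lemma openin_T_ball: "openin T {y \<in> K. nv (y - x) < e}"
  unfolding T_def openin_subtopology
proof (intro exI conjI)
  show "openin M.mtopology (M.mball x e)"
    by (rule M.openin_mball)
  show "{y \<in> K. nv (y - x) < e} = M.mball x e \<inter> K"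
    by (auto simp: M.mball_def nv_diff_commute)
qed

lemma openin_T_imp:
  assumes "openin T U" "x \<in> U"
  shows "\<exists>e>0. \<forall>y\<in>K. nv (y - x) < e \<longrightarrow> y \<in> U"
proof -
  obtain V where V: "openin M.mtopology V" "U = V \<inter> K"
    using assms by (auto simp: T_def openin_subtopology)
  then obtain r where "r > 0" "M.mball x r \<subseteq> V"
    using assms by (auto simp: M.openin_mtopology)
  then show ?thesis
    using V by (auto simp: nv_diff_commute M.mball_def subset_iff)
qed

text \<open>Hands continuity over to the calculus of \<open>close_along\<close>, so that matrix
  products, determinants and tensor entries are continuous simply as sums and products.\<close>

lemma continuous_map_T_iff:
  "continuous_map X T f \<longleftrightarrow>
    (\<forall>x\<in>topspace X. f x \<in> K) \<and> (\<forall>x\<in>topspace X. close_along (nhdsin X x) f (\<lambda>_. f x))"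
proof safe
  assume c: "continuous_map X T f"
  show K: "f x \<in> K" if "x \<in> topspace X" for x
    using c that by (auto simp: continuous_map_def)
  show "close_along (nhdsin X x) f (\<lambda>_. f x)" if x: "x \<in> topspace X" for x
    unfolding close_along_iff
  proof safe
    fix e :: real assume "e > 0"
    have "openin X {y \<in> topspace X. f y \<in> {z \<in> K. nv (z - f x) < e}}"
      using c openin_T_ball unfolding continuous_map_def by blast
    then show "\<forall>\<^sub>F y in nhdsin X x. nv (f y - f x) < e"
      unfolding eventually_nhdsin
      by (intro disjI2 exI[of _ "{y \<in> topspace X. f y \<in> {z \<in> K. nv (z - f x) < e}}"] conjI)
         (use x K[OF x] \<open>e > 0\<close> in auto)
  qed
next
  assume K: "\<forall>x\<in>topspace X. f x \<in> K" and c: "\<forall>x\<in>topspace X. close_along (nhdsin X x) f (\<lambda>_. f x)"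
  show "continuous_map X T f"
    unfolding continuous_map_def
  proof safe
    fix U assume U: "openin T U"
    show "openin X {x \<in> topspace X. f x \<in> U}"
    proof (subst openin_subopen, safe)
      fix x assume x: "x \<in> topspace X" "f x \<in> U"
      obtain e where e: "e > 0" "\<And>y. y \<in> K \<Longrightarrow> nv (y - f x) < e \<Longrightarrow> y \<in> U"
        using openin_T_imp[OF U x(2)] by metis
      have "\<forall>\<^sub>F y in nhdsin X x. nv (f y - f x) < e"
        using c x(1) e(1) unfolding close_along_iff by blast
      then obtain S where S: "openin X S" "x \<in> S" "\<And>y. y \<in> S \<Longrightarrow> nv (f y - f x) < e"
        using x(1) unfolding eventually_nhdsin by blast
      have "S \<subseteq> {x \<in> topspace X. f x \<in> U}"
        using S e K openin_subset[OF S(1)] by blast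
      then show "\<exists>Ta. openin X Ta \<and> x \<in> Ta \<and> Ta \<subseteq> {x \<in> topspace X. f x \<in> U}"
        using S by blast
    qed
  qed (simp add: K)
qed

lemma continuous_map_T_sum:
  "(\<And>i. i \<in> A \<Longrightarrow> continuous_map X T (f i)) \<Longrightarrow> continuous_map X T (\<lambda>x. \<Sum>i\<in>A. f i x)"
  by (auto simp: continuous_map_T_iff intro: close_along_sum)

lemma continuous_map_T_prod:
  "(\<And>i. i \<in> A \<Longrightarrow> continuous_map X T (f i)) \<Longrightarrow> continuous_map X T (\<lambda>x. \<Prod>i\<in>A. f i x)"
  by (auto simp: continuous_map_T_iff intro: close_along_prod)

lemma continuous_map_T_mult:
  "continuous_map X T f \<Longrightarrow> continuous_map X T g \<Longrightarrow> continuous_map X T (\<lambda>x. f x * g x)"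
  by (auto simp: continuous_map_T_iff intro: close_along_mult)

lemma continuous_map_T_const: "c \<in> K \<Longrightarrow> continuous_map X T (\<lambda>x. c)"
  by (auto simp: continuous_map_T_iff)

end

section \<open>The topological group SL(n, K)\<close>

lemma index_mat_mult_sum:
  assumes "A \<in> carrier_mat n n" "B \<in> carrier_mat n n" "i < n" "j < n"
  shows "(A * B) $$ (i, j) = (\<Sum>k<n. A $$ (i, k) * B $$ (k, j))"
  using assms by (auto simp: scalar_prod_def lessThan_atLeast0 intro!: sum.cong)

context valued_subfield
begin

lemma K_signof [simp]: "signof \<pi> \<in> K"
  by (simp add: sign_def)

lemma K_det:
  assumes "A \<in> carrier_mat m m" "\<And>i j. i < m \<Longrightarrow> j < m \<Longrightarrow> A $$ (i, j) \<in> K"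
  shows "det A \<in> K"
  unfolding det_def'[OF assms(1)]
  by (intro K_sum K_mult K_prod) (auto intro!: assms(2) dest: permutes_in_image)

text \<open>By the Leibniz formula. Bounds are asked of \<open>B\<close> alone, because closeness
  passes them on to \<open>A\<close>.\<close>

lemma close_along_det:
  assumes "\<And>x. A x \<in> carrier_mat m m" "\<And>x. B x \<in> carrier_mat m m"
    and "\<And>i j. i < m \<Longrightarrow> j < m \<Longrightarrow> close_along F (\<lambda>x. A x $$ (i, j)) (\<lambda>x. B x $$ (i, j))"
    and "\<And>i j. i < m \<Longrightarrow> j < m \<Longrightarrow> bounded_along F (\<lambda>x. B x $$ (i, j))"
  shows "close_along F (\<lambda>x. det (A x)) (\<lambda>x. det (B x))"
  unfolding det_def'[OF assms(1)] det_def'[OF assms(2)]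
  by (intro close_along_sum close_along_mult close_along_prod bounded_along_prod) (auto intro!: assms(3,4) dest: permutes_in_image)

lemma continuous_map_T_det:
  assumes "\<And>x. x \<in> topspace X \<Longrightarrow> A x \<in> carrier_mat m m"
    and "\<And>i j. i < m \<Longrightarrow> j < m \<Longrightarrow> continuous_map X T (\<lambda>x. A x $$ (i, j))"
  shows "continuous_map X T (\<lambda>x. det (A x))"
proof -
  have "continuous_map X T (\<lambda>x. \<Sum>\<pi> \<in> {\<pi>. \<pi> permutes {0..<m}}. signof \<pi> * (\<Prod>i = 0..<m. A x $$ (i, \<pi> i)))"
    by (intro continuous_map_T_sum continuous_map_T_mult continuous_map_T_prod continuous_map_T_const)
       (auto intro!: assms(2) dest: permutes_in_image)
  then show ?thesis
    by (rule continuous_map_eq) (simp add: det_def'[OF assms(1)])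
qed

end

locale valued_SL = valued_subfield +
  fixes n :: nat
  assumes n_ge_2: "n \<ge> 2"
begin

lemma n_pos [simp]: "0 < n"
  using n_ge_2 by simp

abbreviation G where "G \<equiv> SL n T"
abbreviation TG where "TG \<equiv> SL_topology n T"

lemma G_iff: "A \<in> carrier G \<longleftrightarrow> A \<in> carrier_mat n n \<and> (\<forall>i<n. \<forall>j<n. A $$ (i, j) \<in> K) \<and> det A = 1"
  by (simp add: SL_def)

lemma G_mult [simp]: "A \<otimes>\<^bsub>G\<^esub> B = A * B"
  and G_one [simp]: "\<one>\<^bsub>G\<^esub> = 1\<^sub>m n"
  by (simp_all add: SL_def)

lemma G_dim: "A \<in> carrier G \<Longrightarrow> A \<in> carrier_mat n n"
  and G_K: "A \<in> carrier G \<Longrightarrow> i < n \<Longrightarrow> j < n \<Longrightarrow> A $$ (i, j) \<in> K"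
  and G_det: "A \<in> carrier G \<Longrightarrow> det A = 1"
  by (auto simp: G_iff)

lemma one_in_G: "1\<^sub>m n \<in> carrier G"
  by (simp add: G_iff)

lemma mult_in_G: "A \<in> carrier G \<Longrightarrow> B \<in> carrier G \<Longrightarrow> A * B \<in> carrier G"
  by (auto simp: G_iff det_mult[of _ n] index_mat_mult_sum[of _ n] simp del: index_mult_mat(1)
      intro!: K_sum)

lemma adj_mat_in_G:
  assumes A: "A \<in> carrier G"
  shows "adj_mat A \<in> carrier G" "A * adj_mat A = 1\<^sub>m n" "adj_mat A * A = 1\<^sub>m n"
proof -
  note dim = G_dim[OF A] adj_mat(1)[OF G_dim[OF A]]
  show AA: "A * adj_mat A = 1\<^sub>m n" and "adj_mat A * A = 1\<^sub>m n"
    using adj_mat(2,3)[OF G_dim[OF A]] G_det[OF A] by auto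
  have "det (A * adj_mat A) = 1"
    by (simp add: AA)
  then have "det (adj_mat A) = 1"
    using det_mult[OF dim] G_det[OF A] by simp
  moreover have "cofactor A j i \<in> K" if "i < n" "j < n" for i j
    unfolding cofactor_def
    by (intro K_mult K_det[of _ "n - 1"] mat_delete_carrier dim K_power)
       (use that A in \<open>auto simp: mat_delete_def G_iff\<close>)
  ultimately show "adj_mat A \<in> carrier G"
    using dim by (auto simp: G_iff) (simp add: adj_mat_def)
qed

lemma group_G: "Group.group G"
proof (rule groupI)
  show "\<exists>B\<in>carrier G. B \<otimes>\<^bsub>G\<^esub> A = \<one>\<^bsub>G\<^esub>" if "A \<in> carrier G" for A
    using adj_mat_in_G[OF that] by auto
  show "A \<otimes>\<^bsub>G\<^esub> B \<otimes>\<^bsub>G\<^esub> C = A \<otimes>\<^bsub>G\<^esub> (B \<otimes>\<^bsub>G\<^esub> C)"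
    if "A \<in> carrier G" "B \<in> carrier G" "C \<in> carrier G" for A B C
    using that by (simp add: assoc_mult_mat[of _ n n _ n _ n] G_dim)
qed (auto simp: mult_in_G one_in_G left_mult_one_mat[OF G_dim])

sublocale G: Group.group G
  by (rule group_G)

abbreviation iv where "iv A \<equiv> inv\<^bsub>G\<^esub> A"

lemma iv_eq_adj: "A \<in> carrier G \<Longrightarrow> iv A = adj_mat A"
  using adj_mat_in_G by (intro G.inv_equality) auto

lemma iv_in_G: "A \<in> carrier G \<Longrightarrow> iv A \<in> carrier G"
  by simp

lemma iv_left: "A \<in> carrier G \<Longrightarrow> iv A * A = 1\<^sub>m n"
  and iv_right: "A \<in> carrier G \<Longrightarrow> A * iv A = 1\<^sub>m n"
  using G.l_inv G.r_inv by auto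

lemma iv_eqI:
  assumes "A \<in> carrier G" "B \<in> carrier G" "A * B = 1\<^sub>m n"
  shows "iv A = B"
  using G.inv_equality[of B A] assms mat_mult_left_right_inverse[OF G_dim[OF assms(1)] G_dim[OF assms(2)]]
  by auto

lemma iv_left_sum:
  assumes "A \<in> carrier G" "i < n" "j < n"
  shows "(\<Sum>k<n. iv A $$ (i, k) * A $$ (k, j)) = (if i = j then 1 else 0)"
  using assms index_mat_mult_sum[OF G_dim[OF iv_in_G] G_dim, of A A i j] iv_left by simp

lemma iv_right_sum:
  assumes "A \<in> carrier G" "i < n" "j < n"
  shows "(\<Sum>k<n. A $$ (i, k) * iv A $$ (k, j)) = (if i = j then 1 else 0)"
  using assms index_mat_mult_sum[OF G_dim G_dim[OF iv_in_G], of A A i j] iv_right by simp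

lemma topspace_TG [simp]: "topspace TG = carrier G"
  by (auto simp: SL_topology_def topspace_pullback_topology G_iff)

lemma continuous_map_TG_iff:
  "continuous_map X TG f \<longleftrightarrow>
    (\<forall>x\<in>topspace X. f x \<in> carrier G) \<and> (\<forall>i<n. \<forall>j<n. continuous_map X T (\<lambda>x. f x $$ (i, j)))"
  (is "?L \<longleftrightarrow> ?R")
proof
  let ?P = "product_topology (\<lambda>_. T) ({..<n} \<times> {..<n})"
  let ?e = "\<lambda>A. \<lambda>ij\<in>{..<n} \<times> {..<n}. A $$ ij"
  assume L: ?L
  have 1: "continuous_map TG ?P ?e"
    using continuous_map_pullback[OF continuous_map_id[of ?P], where A = "carrier G" and f = ?e]
    by (simp add: SL_topology_def)
  have "continuous_map X T (\<lambda>x. f x $$ (i, j))" if "i < n" "j < n" for i j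
    using continuous_map_compose[OF continuous_map_compose[OF L 1]
        continuous_map_product_projection[of "(i, j)" "{..<n} \<times> {..<n}" "\<lambda>_. T"]] that
    by (simp add: o_def)
  then show ?R
    using L by (auto simp: continuous_map_def)
next
  assume R: ?R
  show ?L
    unfolding SL_topology_def
    by (rule continuous_map_pullback')
       (use R in \<open>auto simp: continuous_map_componentwise o_def\<close>)
qed

lemma continuous_map_entry: "i < n \<Longrightarrow> j < n \<Longrightarrow> continuous_map TG T (\<lambda>A. A $$ (i, j))"
  using continuous_map_TG_iff[of TG "\<lambda>A. A"] by simp

lemma Hausdorff_TG: "Hausdorff_space TG"
proof (rule Hausdorff_space_injective_preimage)
  let ?P = "product_topology (\<lambda>_. T) ({..<n} \<times> {..<n})"
  let ?e = "\<lambda>A. \<lambda>ij\<in>{..<n} \<times> {..<n}. A $$ ij"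
  show "Hausdorff_space ?P"
    by (simp add: Hausdorff_space_product_topology Hausdorff_T)
  show "continuous_map TG ?P ?e"
    using continuous_map_pullback[OF continuous_map_id[of ?P], where A = "carrier G" and f = ?e]
    by (simp add: SL_topology_def)
  show "inj_on ?e (topspace TG)"
  proof (rule inj_onI)
    fix A B assume AB: "A \<in> topspace TG" "B \<in> topspace TG" "?e A = ?e B"
    have "A $$ (i, j) = B $$ (i, j)" if "i < n" "j < n" for i j
      using fun_cong[OF AB(3), of "(i, j)"] that by simp
    then show "A = B"
      using AB by (intro eq_matI) (auto simp: G_iff)
  qed
qed

lemma topological_group_TG: "topological_group G TG"
  unfolding topological_group_def
proof (intro conjI)
  have mem: "continuous_map (prod_topology TG TG) T (\<lambda>x. fst x $$ (i, j))"
       "continuous_map (prod_topology TG TG) T (\<lambda>x. snd x $$ (i, j))" if "i < n" "j < n" for i j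
    using continuous_map_compose[OF _ continuous_map_entry[OF that], of "prod_topology TG TG" fst]
      continuous_map_compose[OF _ continuous_map_entry[OF that], of "prod_topology TG TG" snd]
    by (simp_all add: o_def continuous_map_fst continuous_map_snd)
  show "continuous_map (prod_topology TG TG) TG (\<lambda>(x, y). x \<otimes>\<^bsub>G\<^esub> y)"
    unfolding continuous_map_TG_iff
  proof (intro conjI allI impI)
    fix i j assume ij: "i < n" "j < n"
    have "continuous_map (prod_topology TG TG) T (\<lambda>x. \<Sum>k<n. fst x $$ (i, k) * snd x $$ (k, j))"
      using ij by (intro continuous_map_T_sum continuous_map_T_mult mem) auto
    then show "continuous_map (prod_topology TG TG) T (\<lambda>x. (case x of (x, y) \<Rightarrow> x \<otimes>\<^bsub>G\<^esub> y) $$ (i, j))"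
      by (rule continuous_map_eq)
         (use ij in \<open>auto simp: index_mat_mult_sum[of _ n] G_dim simp del: index_mult_mat(1)\<close>)
  qed (auto simp: mult_in_G)
  show "continuous_map TG TG (m_inv G)"
    unfolding continuous_map_TG_iff
  proof (intro conjI allI impI)
    fix i j assume ij: "i < n" "j < n"
    \<comment> \<open>The determinant is 1, so the inverse is the adjugate and its entries are
      signed minors; \<open>i\<close> and \<open>j\<close> are swapped because the adjugate is the
      transposed cofactor matrix.\<close>
    have "continuous_map TG T (\<lambda>A. (- 1) ^ (j + i) * det (mat_delete A j i))"
    proof (intro continuous_map_T_mult continuous_map_T_const continuous_map_T_det)
      fix i' j' assume "i' < n - 1" "j' < n - 1"
      then have "continuous_map TG T (\<lambda>A. A $$ (if i' < j then i' else Suc i', if j' < i then j' else Suc j'))"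
        using ij by (intro continuous_map_entry) auto
      then show "continuous_map TG T (\<lambda>A. mat_delete A j i $$ (i', j'))"
        by (rule continuous_map_eq)
          (use \<open>i' < n - 1\<close> \<open>j' < n - 1\<close> in \<open>auto simp: mat_delete_def G_iff\<close>)
    qed (use mat_delete_carrier[OF G_dim] in auto)
    then show "continuous_map TG T (\<lambda>A. iv A $$ (i, j))"
      by (rule continuous_map_eq)
         (use ij in \<open>auto simp: iv_eq_adj adj_mat_def cofactor_def G_iff\<close>)
  qed auto
qed (auto simp: group_G Hausdorff_TG)

lemma entries_nonempty: "{..<n} \<times> {..<n} \<noteq> {}"
  using n_pos by blast

lemma openin_TG_ball:
  assumes "A \<in> carrier G"
  shows "openin TG {B \<in> carrier G. \<forall>i<n. \<forall>j<n. nv (B $$ (i, j) - A $$ (i, j)) < e}"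
proof -
  have "openin TG {B \<in> topspace TG. B $$ (i, j) \<in> {y \<in> K. nv (y - A $$ (i, j)) < e}}"
    if "i < n" "j < n" for i j
    using continuous_map_entry[OF that] openin_T_ball unfolding continuous_map_def by blast
  then have "openin TG (\<Inter>ij\<in>{..<n} \<times> {..<n}. {B \<in> topspace TG. B $$ ij \<in> {y \<in> K. nv (y - A $$ ij) < e}})"
    by (intro openin_INT2 entries_nonempty) auto
  also have "\<dots> = {B \<in> carrier G. \<forall>i<n. \<forall>j<n. nv (B $$ (i, j) - A $$ (i, j)) < e}"
    (is "?L = ?R")
  proof (intro equalityI subsetI)
    fix B assume B: "B \<in> ?L"
    then have "B \<in> {B \<in> topspace TG. B $$ (0, 0) \<in> {y \<in> K. nv (y - A $$ (0, 0)) < e}}"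
      using n_pos by blast
    then have "B \<in> carrier G" by simp
    with B show "B \<in> ?R" by auto
  qed (auto simp: G_K)
  finally show ?thesis .
qed

lemma openin_TG_imp:
  assumes U: "openin TG U" "A \<in> U"
  shows "\<exists>e>0. \<forall>B\<in>carrier G. (\<forall>i<n. \<forall>j<n. nv (B $$ (i, j) - A $$ (i, j)) < e) \<longrightarrow> B \<in> U"
proof -
  let ?I = "{..<n} \<times> {..<n}"
  let ?e = "\<lambda>A. \<lambda>ij\<in>?I. A $$ ij"
  obtain V where V: "openin (product_topology (\<lambda>_. T) ?I) V" "U = ?e -` V \<inter> carrier G"
    using U by (auto simp: SL_topology_def openin_pullback_topology)
  then have "?e A \<in> V" using U by auto
  have "\<exists>W. finite {i \<in> ?I. W i \<noteq> topspace T} \<and> (\<forall>i\<in>?I. openin T (W i)) \<and> ?e A \<in> Pi\<^sub>E ?I W \<and> Pi\<^sub>E ?I W \<subseteq> V"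
    by (rule V(1)[unfolded openin_product_topology_alt, rule_format]) fact
  then obtain W where W: "\<And>ij. ij \<in> ?I \<Longrightarrow> openin T (W ij)" "?e A \<in> Pi\<^sub>E ?I W" "Pi\<^sub>E ?I W \<subseteq> V"
    by (elim exE conjE) (rule that, auto)
  have "\<exists>e>0. \<forall>y\<in>K. nv (y - A $$ ij) < e \<longrightarrow> y \<in> W ij" if "ij \<in> ?I" for ij
  proof (rule openin_T_imp[OF W(1)[OF that]])
    show "A $$ ij \<in> W ij"
      using PiE_mem[OF W(2) that] that by simp
  qed
  then obtain e where e: "\<And>ij. ij \<in> ?I \<Longrightarrow> e ij > 0"
      "\<And>ij y. ij \<in> ?I \<Longrightarrow> y \<in> K \<Longrightarrow> nv (y - A $$ ij) < e ij \<Longrightarrow> y \<in> W ij"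
    by metis
  have ne: "finite ?I" "?I \<noteq> {}"
    by (rule finite_cartesian_product[OF finite_lessThan finite_lessThan], rule entries_nonempty)
  let ?m = "Min (e ` ?I)"
  have "?m > 0" using e(1) ne by (subst Min_gr_iff) auto
  moreover have "B \<in> U" if B: "B \<in> carrier G" "\<forall>i<n. \<forall>j<n. nv (B $$ (i, j) - A $$ (i, j)) < ?m" for B
  proof -
    have "?e B \<in> Pi\<^sub>E ?I W"
    proof (rule PiE_I)
      fix ij assume ij: "ij \<in> ?I"
      then have "nv (B $$ ij - A $$ ij) < ?m" using B by auto
      also have "?m \<le> e ij" using ij ne by simp
      finally show "?e B ij \<in> W ij"
        using e(2)[OF ij, of "B $$ ij"] ij B(1) by (auto simp: G_K)
    qed auto
    then have "?e B \<in> V" using W(3) by (rule subsetD[rotated])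
    then show ?thesis using V(2) B(1) by simp
  qed
  ultimately show ?thesis by blast
qed

end

section \<open>Transvections, diagonal matrices and bounded sets\<close>

context valued_SL
begin

text \<open>Also used with one argument: \<open>delta i\<close> is the standard basis vector e_i, as
  a column or as a row.\<close>

definition delta :: "nat \<Rightarrow> nat \<Rightarrow> 'a" where
  "delta i = (\<lambda>r. if r = i then 1 else 0)"

lemma delta_same [simp]: "delta i i = 1" and delta_other: "r \<noteq> i \<Longrightarrow> delta i r = 0"
  by (simp_all add: delta_def)

lemma delta_K [simp]: "delta i r \<in> K"
  by (simp add: delta_def)

lemma sum_delta [simp]:
  "i < n \<Longrightarrow> (\<Sum>k<n. f k * delta i k) = f i"
  "i < n \<Longrightarrow> (\<Sum>k<n. delta i k * f k) = f i"
  unfolding delta_def by (simp_all add: if_distrib[of "(*) _"] if_distrib[of "\<lambda>x. x * _"] cong: if_cong)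

lemma delta_commute: "delta i r = delta r i"
  by (simp add: delta_def)

lemma sum_delta' [simp]:
  "i < n \<Longrightarrow> (\<Sum>k<n. f k * delta k i) = f i"
  "i < n \<Longrightarrow> (\<Sum>k<n. delta k i * f k) = f i"
  by (simp_all add: delta_commute[of _ i])

text \<open>The rank-one perturbation 1 + u v of the identity, with \<open>u\<close> a column and
  \<open>v\<close> a row. It is a transvection in the strict sense when v u = 0.\<close>

definition transvection :: "(nat \<Rightarrow> 'a) \<Rightarrow> (nat \<Rightarrow> 'a) \<Rightarrow> 'a mat" where
  "transvection u v = mat n n (\<lambda>(r, s). delta r s + u r * v s)"

lemma transvection_carrier [simp]: "transvection u v \<in> carrier_mat n n"
  by (simp add: transvection_def)

lemma transvection_index [simp]: "r < n \<Longrightarrow> s < n \<Longrightarrow> transvection u v $$ (r, s) = delta r s + u r * v s"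
  by (simp add: transvection_def)

lemma transvection_cong:
  "(\<And>r s. r < n \<Longrightarrow> s < n \<Longrightarrow> u r * v s = u' r * v' s) \<Longrightarrow> transvection u v = transvection u' v'"
  by (rule eq_matI) (auto simp: transvection_def)

text \<open>The cross term of the product is u (v u) v', which the assumption removes; so
  transvections with a common column form an additive family.\<close>

lemma transvection_mult_same:
  assumes "(\<Sum>k<n. v k * u k) = 0"
  shows "transvection u v * transvection u v' = transvection u (\<lambda>s. v s + v' s)"
proof (rule eq_matI)
  fix r s assume "r < dim_row (transvection u (\<lambda>s. v s + v' s))" "s < dim_col (transvection u (\<lambda>s. v s + v' s))"
  then have rs: "r < n" "s < n" by (auto simp: transvection_def)
  have "(\<Sum>k<n. (delta r k + u r * v k) * (delta k s + u k * v' s)) =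
     (\<Sum>k<n. delta r k * (delta k s + u k * v' s)) + u r * (\<Sum>k<n. v k * delta k s) + u r * v' s * (\<Sum>k<n. v k * u k)"
    unfolding sum_distrib_left sum.distrib[symmetric] by (simp add: algebra_simps)
  also have "\<dots> = delta r s + u r * (v s + v' s)"
    using rs assms by (simp, simp add: distrib_left)
  finally show "(transvection u v * transvection u v') $$ (r, s) = transvection u (\<lambda>s. v s + v' s) $$ (r, s)"
    using rs by (simp add: index_mat_mult_sum[of _ n] del: index_mult_mat(1))
qed (auto simp: transvection_def)

lemma transvection_0 [simp]: "transvection u (\<lambda>_. 0) = 1\<^sub>m n"
  by (rule eq_matI) (auto simp: transvection_def delta_def)

text \<open>As \<open>w j = 0\<close>, column \<open>j\<close> is the basis vector e_j, and
  expanding along it leaves an identity matrix.\<close>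

lemma det_transvection_delta:
  assumes j: "j < n" and w: "w j = 0"
  shows "det (transvection (delta j) w) = 1"
proof -
  have "det (transvection (delta j) w) = (\<Sum>i<n. transvection (delta j) w $$ (i, j) * cofactor (transvection (delta j) w) i j)"
    by (rule laplace_expansion_column) (use j in auto)
  also have "\<dots> = (\<Sum>i<n. delta j i * cofactor (transvection (delta j) w) i j)"
    using j w by (intro sum.cong) (auto simp: delta_def)
  also have "\<dots> = det (mat_delete (transvection (delta j) w) j j)"
    using j by (simp add: cofactor_def)
  also have "mat_delete (transvection (delta j) w) j j = 1\<^sub>m (n - 1)"
    by (rule eq_matI) (use j in \<open>auto simp: mat_delete_def transvection_def delta_def\<close>)
  finally show ?thesis by simp
qed

lemma transvection_delta_left:
  assumes j: "j < n" and w: "w j = 0" and K: "\<And>s. s < n \<Longrightarrow> w s \<in> K"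
  shows "transvection (delta j) w \<in> carrier G" "iv (transvection (delta j) w) = transvection (delta j) (\<lambda>s. - w s)"
proof -
  have *: "transvection (delta j) w \<in> carrier G" if "w j = 0" "\<And>s. s < n \<Longrightarrow> w s \<in> K" for w
    using that det_transvection_delta[OF j] by (simp add: G_iff)
  show 1: "transvection (delta j) w \<in> carrier G" by (rule *) fact+
  have 2: "transvection (delta j) (\<lambda>s. - w s) \<in> carrier G" by (rule *) (use w K in auto)
  show "iv (transvection (delta j) w) = transvection (delta j) (\<lambda>s. - w s)"
    by (rule iv_eqI[OF 1 2], subst transvection_mult_same) (use j w in auto)
qed

lemma transvection_delta_right:
  assumes j: "j < n" and w: "w j = 0" and K: "\<And>s. s < n \<Longrightarrow> w s \<in> K"
  shows "transvection w (delta j) \<in> carrier G" "iv (transvection w (delta j)) = transvection (\<lambda>s. - w s) (delta j)"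
proof -
  have *: "transvection w (delta j) \<in> carrier G" if "w j = 0" "\<And>s. s < n \<Longrightarrow> w s \<in> K" for w
  proof -
    have "transvection w (delta j) = transpose_mat (transvection (delta j) w)"
      by (rule eq_matI) (auto simp: transvection_def delta_def)
    then have "det (transvection w (delta j)) = 1"
      using det_transvection_delta[OF j, of w] that det_transpose[OF transvection_carrier] by simp
    then show ?thesis
      using that by (simp add: G_iff)
  qed
  show 1: "transvection w (delta j) \<in> carrier G" by (rule *) fact+
  have 2: "transvection (\<lambda>s. - w s) (delta j) \<in> carrier G" by (rule *) (use w K in auto)
  \<comment> \<open>\<open>transvection_mult_same\<close> adds second arguments, so the sign is
    moved from the column to the row.\<close>
  have 3: "transvection (\<lambda>s. - w s) (delta j) = transvection w (\<lambda>s. - delta j s)"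
    by (rule transvection_cong) simp
  show "iv (transvection w (delta j)) = transvection (\<lambda>s. - w s) (delta j)"
    by (rule iv_eqI[OF 1 2], unfold 3, subst transvection_mult_same) (use j w in auto)
qed

text \<open>Conjugation sends u v to (A u)(v A^-1). All conjugations of transvections below, both
  those that clear entries and those by a large \<open>A\<close>, are read off from this
  formula.\<close>

lemma conj_transvection:
  assumes A: "A \<in> carrier G"
  shows "A * transvection u v * iv A = transvection (\<lambda>r. \<Sum>k<n. A $$ (r, k) * u k) (\<lambda>s. \<Sum>k<n. v k * iv A $$ (k, s))"
    (is "_ = transvection ?U ?V")
proof (rule eq_matI)
  note dims = G_dim[OF A] G_dim[OF iv_in_G[OF A]]
  have dim: "A * transvection u v \<in> carrier_mat n n"
    using dims by auto
  fix r s assume "r < dim_row (transvection ?U ?V)" "s < dim_col (transvection ?U ?V)"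
  then have rs: "r < n" "s < n" by (auto simp: transvection_def)
  have 1: "(A * transvection u v) $$ (r, k) = A $$ (r, k) + ?U r * v k" if "k < n" for k
  proof -
    have "(\<Sum>l<n. A $$ (r, l) * (delta l k + u l * v k)) = (\<Sum>l<n. A $$ (r, l) * delta l k) + ?U r * v k"
      unfolding sum_distrib_right sum.distrib[symmetric] by (simp add: algebra_simps)
    then show ?thesis
      using that rs dims by (simp add: index_mat_mult_sum[of _ n] del: index_mult_mat(1))
  qed
  have "(A * transvection u v * iv A) $$ (r, s) = (\<Sum>k<n. (A $$ (r, k) + ?U r * v k) * iv A $$ (k, s))"
    using rs dim dims 1 by (simp add: index_mat_mult_sum[of _ n] del: index_mult_mat(1))
  also have "\<dots> = (\<Sum>k<n. A $$ (r, k) * iv A $$ (k, s)) + ?U r * ?V s"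
    unfolding sum_distrib_left[of "?U r"] sum.distrib[symmetric] by (simp add: algebra_simps)
  also have "\<dots> = delta r s + ?U r * ?V s"
    using iv_right_sum[OF A rs] by (simp add: delta_def eq_commute)
  finally show "(A * transvection u v * iv A) $$ (r, s) = transvection ?U ?V $$ (r, s)"
    using rs by simp
qed (use G_dim[OF A] G_dim[OF iv_in_G[OF A]] in \<open>auto simp: transvection_def\<close>)

definition diagonal :: "(nat \<Rightarrow> 'a) \<Rightarrow> 'a mat" where
  "diagonal d = mat n n (\<lambda>(r, s). if r = s then d r else 0)"

lemma diagonal_carrier [simp]: "diagonal d \<in> carrier_mat n n"
  by (simp add: diagonal_def)

lemma diagonal_index: "r < n \<Longrightarrow> s < n \<Longrightarrow> diagonal d $$ (r, s) = d r * delta r s"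
  by (auto simp: diagonal_def delta_def)

lemma diagonal_in_G:
  assumes K: "\<And>r. r < n \<Longrightarrow> d r \<in> K" and det: "(\<Prod>r<n. d r) = 1"
  shows "diagonal d \<in> carrier G" "iv (diagonal d) = diagonal (\<lambda>r. inverse (d r))"
proof -
  have *: "diagonal d \<in> carrier G" if K: "\<And>r. r < n \<Longrightarrow> d r \<in> K" and det: "(\<Prod>r<n. d r) = 1" for d
  proof -
    have "det (diagonal d) = prod_list (diag_mat (diagonal d))"
      by (rule det_upper_triangular[of _ n]) (auto simp: diagonal_def)
    also have "diag_mat (diagonal d) = map d [0..<n]"
      by (auto simp: diag_mat_def diagonal_def)
    finally have "det (diagonal d) = 1"
      using det by (simp add: prod.distinct_set_conv_list[symmetric] lessThan_atLeast0)
    then show ?thesis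
      using K by (auto simp: G_iff diagonal_index)
  qed
  show 1: "diagonal d \<in> carrier G" by (rule *) fact+
  have 2: "diagonal (\<lambda>r. inverse (d r)) \<in> carrier G"
    using K det prod_inversef[of d "{..<n}"] by (intro *) (auto simp: o_def)
  have nz: "d r \<noteq> 0" if "r < n" for r
    using det that by (metis finite_lessThan lessThan_iff prod_zero_iff zero_neq_one)
  show "iv (diagonal d) = diagonal (\<lambda>r. inverse (d r))"
  proof (rule iv_eqI[OF 1 2], rule eq_matI)
    fix r s assume "r < dim_row (1\<^sub>m n)" "s < dim_col (1\<^sub>m n)"
    then have rs: "r < n" "s < n" by auto
    have "(diagonal d * diagonal (\<lambda>r. inverse (d r))) $$ (r, s) = (\<Sum>k<n. d r * delta r k * (inverse (d k) * delta k s))"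
      using rs by (simp add: index_mat_mult_sum[of _ n] diagonal_index del: index_mult_mat(1))
    also have "\<dots> = (\<Sum>k<n. delta r k * (d r * inverse (d k) * delta k s))"
      by (simp add: mult_ac)
    also have "\<dots> = delta r s"
      using rs nz by simp
    finally show "(diagonal d * diagonal (\<lambda>r. inverse (d r))) $$ (r, s) = 1\<^sub>m n $$ (r, s)"
      using rs by (simp add: delta_def)
  qed (auto simp: diagonal_def)
qed

lemma conj_diagonal_index:
  assumes "diagonal d \<in> carrier G" "iv (diagonal d) = diagonal (\<lambda>r. inverse (d r))" "B \<in> carrier G" "r < n" "s < n"
  shows "(diagonal d * B * iv (diagonal d)) $$ (r, s) = d r * B $$ (r, s) * inverse (d s)"
proof -
  have 1: "(diagonal d * B) $$ (r, k) = d r * B $$ (r, k)" if "k < n" for k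
  proof -
    have "(diagonal d * B) $$ (r, k) = (\<Sum>l<n. delta r l * (d r * B $$ (l, k)))"
      using that assms by (simp add: index_mat_mult_sum[of _ n] G_dim diagonal_index mult_ac del: index_mult_mat(1))
    then show ?thesis using assms by simp
  qed
  have "diagonal d * B \<in> carrier_mat n n"
    using G_dim[OF assms(3)] diagonal_carrier by (rule mult_carrier_mat[rotated])
  then have "(diagonal d * B * iv (diagonal d)) $$ (r, s) = (\<Sum>k<n. d r * B $$ (r, k) * (inverse (d k) * delta k s))"
    using assms(4,5) 1 unfolding assms(2)
    by (simp add: index_mat_mult_sum[of _ n] diagonal_index del: index_mult_mat(1))
  also have "\<dots> = (\<Sum>k<n. d r * B $$ (r, k) * inverse (d k) * delta s k)"
    by (simp add: delta_def eq_commute mult_ac)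
  finally show ?thesis using assms by simp
qed

text \<open>Conjugation involves both \<open>A\<close> and its inverse. Bounding both by one radius
  makes the set closed under inversion and gives products and conjugates explicit radii.\<close>

definition bounded_SL :: "real \<Rightarrow> 'a mat set" where
  "bounded_SL R = {A \<in> carrier G. \<forall>i<n. \<forall>j<n. nv (A $$ (i, j)) \<le> R \<and> nv (iv A $$ (i, j)) \<le> R}"

lemma bounded_SL_G: "A \<in> bounded_SL R \<Longrightarrow> A \<in> carrier G"
  by (simp add: bounded_SL_def)

lemma bounded_SL_inv: "A \<in> bounded_SL R \<Longrightarrow> iv A \<in> bounded_SL R"
  by (simp add: bounded_SL_def)

lemma one_in_bounded_SL: "1 \<le> R \<Longrightarrow> 1\<^sub>m n \<in> bounded_SL R"
  using G.inv_one by (auto simp: bounded_SL_def one_in_G)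

lemma nv_mat_mult_le:
  assumes "A \<in> carrier_mat n n" "B \<in> carrier_mat n n" "i < n" "j < n"
    and "\<And>k. k < n \<Longrightarrow> nv (A $$ (i, k)) \<le> a" "\<And>k. k < n \<Longrightarrow> nv (B $$ (k, j)) \<le> b"
  shows "nv ((A * B) $$ (i, j)) \<le> real n * (a * b)"
proof -
  have "nv (A $$ (i, k) * B $$ (k, j)) \<le> a * b" if "k < n" for k
    using assms(5,6)[OF that] by (auto simp: nv_mult intro!: mult_mono order_trans[OF nv_nonneg])
  then have "nv (\<Sum>k<n. A $$ (i, k) * B $$ (k, j)) \<le> real (card {..<n}) * (a * b)"
    by (intro nv_sum_bound) auto
  then show ?thesis
    using index_mat_mult_sum[OF assms(1-4)] by simp
qed

lemma bounded_SL_mult: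
  assumes "A \<in> bounded_SL R" "B \<in> bounded_SL R'"
  shows "A * B \<in> bounded_SL (real n * (R * R'))"
proof -
  note GA = bounded_SL_G[OF assms(1)] and GB = bounded_SL_G[OF assms(2)]
  have "iv (A * B) = iv B * iv A"
    using G.inv_mult_group[OF GA GB] by simp
  moreover have "nv ((A * B) $$ (i, j)) \<le> real n * (R * R')" if "i < n" "j < n" for i j
    using that assms by (intro nv_mat_mult_le) (auto simp: bounded_SL_def G_dim)
  moreover have "nv ((iv B * iv A) $$ (i, j)) \<le> real n * (R' * R)" if "i < n" "j < n" for i j
    using that assms by (intro nv_mat_mult_le G_dim iv_in_G GA GB) (auto simp: bounded_SL_def)
  ultimately show ?thesis
    using mult_in_G[OF GA GB] by (simp add: bounded_SL_def mult.commute)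
qed

lemma bounded_SL_conj:
  assumes "A \<in> bounded_SL R" "B \<in> bounded_SL R'"
  shows "A * B * iv A \<in> bounded_SL (real n * (real n * (R * R') * R))"
  using bounded_SL_mult[OF bounded_SL_mult[OF assms] bounded_SL_inv[OF assms(1)]] .

lemma transvection_delta_left_bounded:
  assumes j: "j < n" and w: "w j = 0" and K: "\<And>s. s < n \<Longrightarrow> w s \<in> K"
    and C: "\<And>s. s < n \<Longrightarrow> nv (w s) \<le> C"
  shows "transvection (delta j) w \<in> bounded_SL (1 + C)"
proof -
  have "C \<ge> 0" using C[OF j] w by simp
  moreover have "nv (delta r s + delta j r * x) \<le> 1 + C \<and> nv (delta r s - delta j r * x) \<le> 1 + C" if "nv x \<le> C" for r s x
  proof -
    have "nv (delta r s) \<le> 1" "nv (delta j r * x) \<le> C"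
      using that \<open>C \<ge> 0\<close> by (auto simp: delta_def)
    then show ?thesis using nv_triangle[of "delta r s" "delta j r * x"] nv_triangle_diff[of "delta r s" "delta j r * x"] by linarith
  qed
  ultimately show ?thesis
    using transvection_delta_left[of j w] assms by (simp add: bounded_SL_def)
qed

lemma transvection_delta_right_bounded:
  assumes j: "j < n" and w: "w j = 0" and K: "\<And>s. s < n \<Longrightarrow> w s \<in> K"
    and C: "\<And>s. s < n \<Longrightarrow> nv (w s) \<le> C"
  shows "transvection w (delta j) \<in> bounded_SL (1 + C)"
proof -
  have "C \<ge> 0" using C[OF j] w by simp
  moreover have "nv (delta r s + x * delta j s) \<le> 1 + C \<and> nv (delta r s - x * delta j s) \<le> 1 + C" if "nv x \<le> C" for r s x
  proof -
    have "nv (delta r s) \<le> 1" "nv (x * delta j s) \<le> C"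
      using that \<open>C \<ge> 0\<close> by (auto simp: delta_def)
    then show ?thesis using nv_triangle[of "delta r s" "x * delta j s"] nv_triangle_diff[of "delta r s" "x * delta j s"] by linarith
  qed
  ultimately show ?thesis
    using transvection_delta_right[of j w] assms by (simp add: bounded_SL_def)
qed

end

section \<open>Sets bounded away from the identity in a coarser group topology\<close>

text \<open>Total boundedness of the balls of \<open>K\<close> takes the place of local compactness
  of the completion. The element of value above 1 has powers of arbitrarily large value, with which
  transvections are rescaled.\<close>

locale coarser_SL = valued_SL +
  fixes T' :: "'a mat topology"
  assumes T'_group: "topological_group (SL n T) T'"
    and T'_coarser: "openin T' U \<Longrightarrow> openin (SL_topology n T) U"
    and totally_bounded: "e > 0 \<Longrightarrow> \<exists>S. finite S \<and> (\<forall>x\<in>K. nv x \<le> R \<longrightarrow> (\<exists>s\<in>S. nv (x - s) < e))"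
    and nontrivial: "\<exists>x\<in>K. nv x > 1"
begin

definition nbhd :: "'a mat set \<Rightarrow> bool" where
  "nbhd V \<longleftrightarrow> openin T' V \<and> 1\<^sub>m n \<in> V"

text \<open>The identity lies outside the \<open>T'\<close>-closure of \<open>S\<close>. The proofs
  pull this property back: from one fixed transvection to ever larger sets whose members can be
  moved into a set already known to be away.\<close>

definition away :: "'a mat set \<Rightarrow> bool" where
  "away S \<longleftrightarrow> (\<exists>V. nbhd V \<and> V \<inter> S = {})"

lemma topspace_T' [simp]: "topspace T' = carrier G"
  using T'_group by (simp add: topological_group_def)

lemma nbhd_G: "nbhd V \<Longrightarrow> V \<subseteq> carrier G"
  using openin_subset[of T' V] by (simp add: nbhd_def)

lemma nbhd_Int: "nbhd V \<Longrightarrow> nbhd W \<Longrightarrow> nbhd (V \<inter> W)"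
  by (simp add: nbhd_def openin_Int)

lemma nbhd_carrier: "nbhd (carrier G)"
  using openin_topspace[of T'] by (simp add: nbhd_def one_in_G)

lemma continuous_map_T'_mult:
  assumes "continuous_map X T' f" "continuous_map X T' g"
  shows "continuous_map X T' (\<lambda>x. f x * g x)"
proof -
  have "continuous_map (prod_topology T' T') T' (\<lambda>(x, y). x \<otimes>\<^bsub>G\<^esub> y)"
    using T'_group by (simp add: topological_group_def)
  from continuous_map_compose[OF continuous_map_pairedI[OF assms] this]
  show ?thesis by (simp add: o_def)
qed

lemma continuous_map_T'_iv:
  assumes "continuous_map X T' f"
  shows "continuous_map X T' (\<lambda>x. iv (f x))"
proof -
  have "continuous_map T' T' (\<lambda>x. iv x)"
    using T'_group by (simp add: topological_group_def)
  from continuous_map_compose[OF assms this]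
  show ?thesis by (simp add: o_def)
qed

lemma nbhd_preimage:
  assumes "continuous_map T' T' f" "f (1\<^sub>m n) = 1\<^sub>m n" "nbhd V"
  shows "nbhd {x \<in> carrier G. f x \<in> V}"
  using assms one_in_G by (auto simp: nbhd_def continuous_map_def)

lemma nbhd_preimage2:
  assumes "continuous_map (prod_topology T' T') T' f" "f (1\<^sub>m n, 1\<^sub>m n) = 1\<^sub>m n" "nbhd V"
  shows "\<exists>W. nbhd W \<and> (\<forall>x\<in>W. \<forall>y\<in>W. f (x, y) \<in> V)"
proof -
  define U where "U = {x \<in> topspace (prod_topology T' T'). f x \<in> V}"
  have "openin (prod_topology T' T') U"
    using assms unfolding U_def nbhd_def continuous_map_def by blast
  moreover have "(1\<^sub>m n, 1\<^sub>m n) \<in> U"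
    using assms one_in_G by (simp add: nbhd_def U_def)
  ultimately have "\<exists>A B. openin T' A \<and> openin T' B \<and> 1\<^sub>m n \<in> A \<and> 1\<^sub>m n \<in> B \<and> A \<times> B \<subseteq> U"
    unfolding openin_prod_topology_alt by blast
  then obtain A B where AB: "openin T' A" "openin T' B" "1\<^sub>m n \<in> A" "1\<^sub>m n \<in> B" "A \<times> B \<subseteq> U"
    by blast
  have "nbhd (A \<inter> B)"
    using AB by (simp add: nbhd_def openin_Int)
  moreover have "f (x, y) \<in> V" if "x \<in> A \<inter> B" "y \<in> A \<inter> B" for x y
  proof -
    have "(x, y) \<in> U" using AB(5) that by blast
    then show ?thesis by (simp add: U_def)
  qed
  ultimately show ?thesis by blast
qed

lemma nbhd_mult_iv:
  assumes "nbhd V"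
  shows "\<exists>W. nbhd W \<and> (\<forall>x\<in>W. \<forall>y\<in>W. x * iv y \<in> V)"
proof -
  have "\<exists>W. nbhd W \<and> (\<forall>x\<in>W. \<forall>y\<in>W. (\<lambda>z. fst z * iv (snd z)) (x, y) \<in> V)"
    by (rule nbhd_preimage2)
       (use assms G.inv_one one_in_G in \<open>auto intro!: continuous_map_T'_mult continuous_map_T'_iv
         continuous_map_fst continuous_map_snd\<close>)
  then show ?thesis by simp
qed

lemma nbhd_conj:
  assumes "nbhd V"
  shows "\<exists>W. nbhd W \<and> (\<forall>x\<in>W. \<forall>y\<in>W. x * y * iv x \<in> V)"
proof -
  have "\<exists>W. nbhd W \<and> (\<forall>x\<in>W. \<forall>y\<in>W. (\<lambda>z. fst z * snd z * iv (fst z)) (x, y) \<in> V)"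
    by (rule nbhd_preimage2)
       (use assms G.inv_one one_in_G in \<open>auto intro!: continuous_map_T'_mult continuous_map_T'_iv
         continuous_map_fst continuous_map_snd\<close>)
  then show ?thesis by simp
qed

lemma nbhd_conj_fixed:
  assumes "nbhd V" "g \<in> carrier G"
  shows "nbhd {x \<in> carrier G. g * x * iv g \<in> V}"
  by (rule nbhd_preimage[OF _ _ assms(1)])
     (use assms(2) iv_right in \<open>auto intro!: continuous_map_T'_mult continuous_map_T'_iv
         simp: G_dim right_mult_one_mat[OF G_dim]\<close>)

text \<open>Coarseness in usable form: entrywise estimates suffice to enter a
  \<open>T'\<close>-neighbourhood of the identity.\<close>

lemma nbhd_small:
  assumes "nbhd V"
  shows "\<exists>e>0. \<forall>B\<in>carrier G. (\<forall>i<n. \<forall>j<n. nv (B $$ (i, j) - delta i j) < e) \<longrightarrow> B \<in> V"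
proof -
  have "openin TG V" "1\<^sub>m n \<in> V"
    using assms T'_coarser by (auto simp: nbhd_def)
  from openin_TG_imp[OF this] show ?thesis
    by (simp add: delta_def eq_commute cong: if_cong)
qed

lemma away_subset: "away S \<Longrightarrow> S' \<subseteq> S \<Longrightarrow> away S'"
  unfolding away_def by blast

lemma away_Un: "away S \<Longrightarrow> away S' \<Longrightarrow> away (S \<union> S')"
proof -
  assume "away S" "away S'"
  then obtain V W where "nbhd V" "nbhd W" "V \<inter> S = {}" "W \<inter> S' = {}"
    unfolding away_def by blast
  then show ?thesis
    unfolding away_def by (intro exI[of _ "V \<inter> W"]) (auto simp: nbhd_Int)
qed

lemma away_empty: "away {}"
  unfolding away_def using nbhd_carrier by blast

lemma away_UN: "finite I \<Longrightarrow> (\<And>i. i \<in> I \<Longrightarrow> away (S i)) \<Longrightarrow> away (\<Union>i\<in>I. S i)"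
  by (induction I rule: finite_induct) (auto intro!: away_Un away_empty)

lemma nbhd_Inter: "finite I \<Longrightarrow> (\<And>i. i \<in> I \<Longrightarrow> nbhd (V i)) \<Longrightarrow> \<exists>W. nbhd W \<and> (\<forall>i\<in>I. W \<subseteq> V i)"
proof (induction I rule: finite_induct)
  case empty
  then show ?case using nbhd_carrier by blast
next
  case (insert i I)
  then obtain W where "nbhd W" "\<forall>i\<in>I. W \<subseteq> V i" by blast
  then show ?case
    using insert.prems by (intro exI[of _ "W \<inter> V i"]) (auto simp: nbhd_Int)
qed

lemma away_singleton:
  assumes "B \<in> carrier G" "B \<noteq> 1\<^sub>m n"
  shows "away {B}"
proof -
  have "Hausdorff_space T'"
    using T'_group by (simp add: topological_group_def)
  then obtain U V where "openin T' U" "1\<^sub>m n \<in> U" "B \<in> V" "disjnt U V"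
    using assms one_in_G unfolding Hausdorff_space_def by (metis topspace_T')
  then show ?thesis
    unfolding away_def nbhd_def by (intro exI[of _ U]) (auto simp: disjnt_def)
qed

section \<open>Finite nets and conjugation by bounded matrices\<close>

lemma bounded_SL_net:
  assumes "e > 0"
  shows "\<exists>L\<subseteq>bounded_SL R. finite L \<and> (\<forall>A\<in>bounded_SL R. \<exists>B\<in>L. \<forall>i<n. \<forall>j<n. nv (A $$ (i, j) - B $$ (i, j)) < e)"
proof -
  let ?I = "{..<n} \<times> {..<n}"
  obtain S where S: "finite S" "\<And>x. x \<in> K \<Longrightarrow> nv x \<le> R \<Longrightarrow> \<exists>s\<in>S. nv (x - s) < e / 2"
    using totally_bounded[of "e / 2" R] assms by auto
  have "\<exists>c. \<forall>x. x \<in> K \<longrightarrow> nv x \<le> R \<longrightarrow> c x \<in> S \<and> nv (x - c x) < e / 2"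
    using S(2) by metis
  then obtain c where c: "\<And>x. x \<in> K \<Longrightarrow> nv x \<le> R \<Longrightarrow> c x \<in> S" 
      "\<And>x. x \<in> K \<Longrightarrow> nv x \<le> R \<Longrightarrow> nv (x - c x) < e / 2"
    by blast
  \<comment> \<open>Rounding the entries need not give a matrix of determinant 1, so rounding only
    sorts the matrices into finitely many classes, and the net takes one member of each. Two members
    of a class differ entrywise by less than \<open>e / 2 + e / 2\<close>.\<close>
  define code where "code A = (\<lambda>ij\<in>?I. c (A $$ ij))" for A :: "'a mat"
  have bounded_SL: "A $$ ij \<in> K" "nv (A $$ ij) \<le> R" if "A \<in> bounded_SL R" "ij \<in> ?I" for A ij
    using that by (auto simp: bounded_SL_def G_K)
  have "code ` bounded_SL R \<subseteq> ?I \<rightarrow>\<^sub>E S"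
  proof (intro image_subsetI PiE_I)
    show "code A ij \<in> S" if "A \<in> bounded_SL R" "ij \<in> ?I" for A ij
      unfolding code_def restrict_apply'[OF that(2)] by (rule c(1)) (rule bounded_SL[OF that])+
  qed (simp add: code_def)
  moreover have "finite (?I \<rightarrow>\<^sub>E S)"
    using S(1) by (intro finite_PiE) auto
  ultimately have "finite (code ` bounded_SL R)"
    by (rule finite_subset)
  then obtain L where L: "L \<subseteq> bounded_SL R" "finite L" "code ` bounded_SL R = code ` L"
    by (metis finite_subset_image subset_refl)
  have "\<exists>B\<in>L. \<forall>i<n. \<forall>j<n. nv (A $$ (i, j) - B $$ (i, j)) < e" if A: "A \<in> bounded_SL R" for A
  proof -
    obtain B where B: "B \<in> L" "code A = code B"
      using A L(3) by (metis image_iff)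
    have "nv (A $$ (i, j) - B $$ (i, j)) < e" if ij: "i < n" "j < n" for i j
    proof -
      have ij': "(i, j) \<in> ?I" using ij by simp
      let ?c = "c (A $$ (i, j))"
      have "?c = c (B $$ (i, j))"
        using fun_cong[OF B(2), of "(i, j)"] ij by (simp add: code_def)
      then have "nv (A $$ (i, j) - ?c) < e / 2" "nv (B $$ (i, j) - ?c) < e / 2"
        using c(2)[OF bounded_SL[OF A ij']] c(2)[OF bounded_SL[OF subsetD[OF L(1) B(1)] ij']] by simp_all
      moreover have "nv (A $$ (i, j) - B $$ (i, j)) \<le> nv (A $$ (i, j) - ?c) + nv (?c - B $$ (i, j))"
        by (rule M.triangle) auto
      ultimately show ?thesis
        using nv_diff_commute[of ?c "B $$ (i, j)"] by linarith
    qed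
    then show ?thesis using B(1) by blast
  qed
  then show ?thesis using L by blast
qed

lemma l_inv_cancel:
  assumes "x \<in> carrier G" "y \<in> carrier G"
  shows "iv x \<otimes>\<^bsub>G\<^esub> (x \<otimes>\<^bsub>G\<^esub> y) = y"
  using assms by (simp only: G.m_assoc[symmetric] G.inv_closed G.l_inv G.l_one)

text \<open>Bounded sets are covered by finitely many translates of a neighbourhood of the identity, so
  conjugation by their elements is equicontinuous at the identity.\<close>

lemma equicontinuous_conj:
  assumes "nbhd V"
  shows "\<exists>U. nbhd U \<and> (\<forall>k\<in>bounded_SL R. \<forall>u\<in>U. k * u * iv k \<in> V)"
proof -
  obtain W where W: "nbhd W" "\<And>x y. x \<in> W \<Longrightarrow> y \<in> W \<Longrightarrow> x * y * iv x \<in> V"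
    using nbhd_conj[OF assms] by blast
  obtain d where d: "d > 0"
      "\<And>B. B \<in> carrier G \<Longrightarrow> (\<And>i j. i < n \<Longrightarrow> j < n \<Longrightarrow> nv (B $$ (i, j) - delta i j) < d) \<Longrightarrow> B \<in> W"
    using nbhd_small[OF W(1)] by blast
  \<comment> \<open>If \<open>k\<close> is within \<open>e\<close> of \<open>l\<close>, then
    \<open>k * iv l\<close> is within \<open>n * e * \<bar>R\<bar>\<close> of the identity, which
    this choice makes less than \<open>d\<close>.\<close>
  define e where "e = d / (n * (\<bar>R\<bar> + 1))"
  have "e > 0" using d by (auto simp: e_def)
  then obtain L where L: "L \<subseteq> bounded_SL R" "finite L"
      "\<And>A. A \<in> bounded_SL R \<Longrightarrow> \<exists>B\<in>L. \<forall>i<n. \<forall>j<n. nv (A $$ (i, j) - B $$ (i, j)) < e"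
    using bounded_SL_net by metis
  have "\<exists>U. nbhd U \<and> (\<forall>l\<in>L. U \<subseteq> {x \<in> carrier G. l * x * iv l \<in> W})"
    using L(1) bounded_SL_G by (intro nbhd_Inter L(2) nbhd_conj_fixed W(1)) auto
  then obtain U where U: "nbhd U" "\<And>l u. l \<in> L \<Longrightarrow> u \<in> U \<Longrightarrow> l * u * iv l \<in> W"
    by blast
  have "k * u * iv k \<in> V" if k: "k \<in> bounded_SL R" and u: "u \<in> U" for k u
  proof -
    obtain l where l: "l \<in> L" "\<And>i j. i < n \<Longrightarrow> j < n \<Longrightarrow> nv (k $$ (i, j) - l $$ (i, j)) < e"
      using L(3)[OF k] by blast
    have lK: "l \<in> bounded_SL R" using l L by auto
    note mem = bounded_SL_G[OF k] bounded_SL_G[OF lK] subsetD[OF nbhd_G[OF U(1)] u]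
    have w: "k * iv l \<in> W"
    proof (rule d(2))
      show "k * iv l \<in> carrier G"
        using mem by (intro mult_in_G iv_in_G)
      fix i j assume ij: "i < n" "j < n"
      have "(k * iv l) $$ (i, j) - delta i j
          = (\<Sum>r<n. k $$ (i, r) * iv l $$ (r, j)) - (\<Sum>r<n. l $$ (i, r) * iv l $$ (r, j))"
        using ij mem iv_right_sum[of l i j]
        by (simp add: index_mat_mult_sum[of _ n] G_dim delta_def eq_commute del: index_mult_mat(1))
      also have "\<dots> = (\<Sum>r<n. (k $$ (i, r) - l $$ (i, r)) * iv l $$ (r, j))"
        by (simp add: sum_subtractf left_diff_distrib)
      finally have "nv ((k * iv l) $$ (i, j) - delta i j)
          = nv (\<Sum>r<n. (k $$ (i, r) - l $$ (i, r)) * iv l $$ (r, j))" by simp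
      also have "\<dots> \<le> real (card {..<n}) * (e * \<bar>R\<bar>)"
      proof (intro nv_sum_bound)
        fix r assume "r \<in> {..<n}"
        then have "nv (k $$ (i, r) - l $$ (i, r)) \<le> e" "nv (iv l $$ (r, j)) \<le> \<bar>R\<bar>"
          using l(2)[of i r] ij lK by (auto simp: bounded_SL_def intro: less_imp_le order_trans[OF _ abs_ge_self])
        then show "nv ((k $$ (i, r) - l $$ (i, r)) * iv l $$ (r, j)) \<le> e * \<bar>R\<bar>"
          using \<open>e > 0\<close> unfolding nv_mult by (intro mult_mono) auto
      qed
      also have "\<dots> = d * (\<bar>R\<bar> / (\<bar>R\<bar> + 1))"
        using n_pos by (simp add: e_def del: n_pos)
      also have "\<dots> < d * 1"
        using d(1) by (intro mult_strict_left_mono) auto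
      also have "\<dots> = d" by simp
      finally show "nv ((k * iv l) $$ (i, j) - delta i j) < d" .
    qed
    \<comment> \<open>Conjugation by \<open>k\<close> is conjugation by the net point
      \<open>l\<close>, controlled through \<open>U\<close>, followed by conjugation by
      \<open>k * iv l\<close>, which lies in \<open>W\<close>.\<close>
    have "(k * iv l) * (l * u * iv l) * iv (k * iv l) = k * u * iv k"
    proof -
      have "(k \<otimes>\<^bsub>G\<^esub> iv l) \<otimes>\<^bsub>G\<^esub> (l \<otimes>\<^bsub>G\<^esub> u \<otimes>\<^bsub>G\<^esub> iv l) \<otimes>\<^bsub>G\<^esub> iv (k \<otimes>\<^bsub>G\<^esub> iv l) = k \<otimes>\<^bsub>G\<^esub> u \<otimes>\<^bsub>G\<^esub> iv k"
        using mem by (simp only: G.inv_mult_group G.inv_inv G.inv_closed G.m_closed G.m_assoc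
            l_inv_cancel)
      then show ?thesis by simp
    qed
    then show ?thesis using W(2)[OF w U(2)[OF l(1) u]] by simp
  qed
  then show ?thesis using U(1) by blast
qed

text \<open>If \<open>b\<close> were \<open>T'\<close>-close to the identity, equicontinuity would
  make both conjugates close to it, and so their product. With \<open>k\<close> or \<open>k'\<close>
  the identity this covers commutators. It is essential that one \<open>R\<close> serves all
  \<open>b\<close>.\<close>

lemma away_step:
  assumes S': "away S'"
    and S: "\<And>b. b \<in> S \<Longrightarrow> b \<in> carrier G \<and>
      (\<exists>k\<in>bounded_SL R. \<exists>k'\<in>bounded_SL R. (k * b * iv k) * (k' * iv b * iv k') \<in> S')"
  shows "away S"
proof -
  obtain V where V: "nbhd V" "V \<inter> S' = {}"
    using S' by (auto simp: away_def)
  obtain W where W: "nbhd W" "\<And>x y. x \<in> W \<Longrightarrow> y \<in> W \<Longrightarrow> x * iv y \<in> V"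
    using nbhd_mult_iv[OF V(1)] by blast
  obtain U where U: "nbhd U" "\<And>k u. k \<in> bounded_SL R \<Longrightarrow> u \<in> U \<Longrightarrow> k * u * iv k \<in> W"
    using equicontinuous_conj[OF W(1), of R] by blast
  have "False" if b: "b \<in> S" "b \<in> U" for b
  proof -
    obtain k k' where k: "b \<in> carrier G" "k \<in> bounded_SL R" "k' \<in> bounded_SL R"
        "(k * b * iv k) * (k' * iv b * iv k') \<in> S'"
      using S[OF b(1)] by blast
    note mem = k(1) bounded_SL_G[OF k(2)] bounded_SL_G[OF k(3)]
    have "iv (k' \<otimes>\<^bsub>G\<^esub> b \<otimes>\<^bsub>G\<^esub> iv k') = k' \<otimes>\<^bsub>G\<^esub> iv b \<otimes>\<^bsub>G\<^esub> iv k'"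
      using mem by (simp only: G.inv_mult_group G.inv_inv G.inv_closed G.m_closed G.m_assoc)
    then have "(k * b * iv k) * (k' * iv b * iv k') \<in> V"
      using W(2)[OF U(2)[OF k(2) b(2)] U(2)[OF k(3) b(2)]] by simp
    then show False using V k by blast
  qed
  then show ?thesis
    using U(1) unfolding away_def by blast
qed

lemma away_conj:
  assumes S': "away S'"
    and S: "\<And>b. b \<in> S \<Longrightarrow> b \<in> carrier G \<and> (\<exists>k\<in>bounded_SL R. k * b * iv k \<in> S')"
  shows "away S"
proof -
  obtain V where V: "nbhd V" "V \<inter> S' = {}"
    using S' by (auto simp: away_def)
  obtain U where U: "nbhd U" "\<And>k u. k \<in> bounded_SL R \<Longrightarrow> u \<in> U \<Longrightarrow> k * u * iv k \<in> V"
    using equicontinuous_conj[OF V(1), of R] by blast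
  then have "U \<inter> S = {}"
    using V S by fastforce
  then show ?thesis
    using U(1) unfolding away_def by blast
qed

end

section \<open>Diagonal conjugation of elementary transvections\<close>

context valued_SL
begin

definition reciprocal_diag :: "nat \<Rightarrow> nat \<Rightarrow> 'a \<Rightarrow> nat \<Rightarrow> 'a" where
  "reciprocal_diag i j a = (\<lambda>r. if r = i then a else if r = j then inverse a else 1)"

lemma diagonal_reciprocal_in_G:
  assumes "i < n" "j < n" "i \<noteq> j" "a \<in> K" "a \<noteq> 0"
  shows "diagonal (reciprocal_diag i j a) \<in> carrier G" "iv (diagonal (reciprocal_diag i j a)) = diagonal (\<lambda>r. inverse (reciprocal_diag i j a r))"
proof -
  have "(\<Prod>r<n. reciprocal_diag i j a r) = (\<Prod>r<n. (if r = i then a else 1) * (if r = j then inverse a else 1))"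
    using assms by (intro prod.cong) (auto simp: reciprocal_diag_def)
  also have "\<dots> = 1"
    using assms by (simp add: prod.distrib)
  finally have *: "(\<Prod>r<n. reciprocal_diag i j a r) = 1" .
  have "reciprocal_diag i j a r \<in> K" for r
    using assms by (auto simp: reciprocal_diag_def)
  then show "diagonal (reciprocal_diag i j a) \<in> carrier G" "iv (diagonal (reciprocal_diag i j a)) = diagonal (\<lambda>r. inverse (reciprocal_diag i j a r))"
    using diagonal_in_G[of "reciprocal_diag i j a"] * by auto
qed

lemma diagonal_reciprocal_bounded:
  assumes "i < n" "j < n" "i \<noteq> j" "a \<in> K" "a \<noteq> 0" "1 \<le> R" "nv a \<le> R" "nv (inverse a) \<le> R"
  shows "diagonal (reciprocal_diag i j a) \<in> bounded_SL R"
proof -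
  have "nv (reciprocal_diag i j a r * delta r s) \<le> R \<and> nv (inverse (reciprocal_diag i j a r) * delta r s) \<le> R" for r s
    using assms by (auto simp: reciprocal_diag_def delta_def)
  then show ?thesis
    using diagonal_reciprocal_in_G[OF assms(1-5)] by (simp add: bounded_SL_def diagonal_index)
qed

lemma conj_reciprocal_transvection:
  assumes "i < n" "j < n" "i \<noteq> j" "a \<in> K" "a \<noteq> 0"
  shows "diagonal (reciprocal_diag i j a) * transvection (delta i) (\<lambda>s. t * delta j s) * iv (diagonal (reciprocal_diag i j a))
    = transvection (delta i) (\<lambda>s. t * a\<^sup>2 * delta j s)"
proof -
  have "(\<Sum>k<n. diagonal (reciprocal_diag i j a) $$ (r, k) * delta i k) * (\<Sum>k<n. t * delta j k * iv (diagonal (reciprocal_diag i j a)) $$ (k, s))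
      = delta i r * (t * a\<^sup>2 * delta j s)" if rs: "r < n" "s < n" for r s
  proof -
    have "(\<Sum>k<n. diagonal (reciprocal_diag i j a) $$ (r, k) * delta i k) = reciprocal_diag i j a r * delta r i"
      using rs assms by (simp add: diagonal_index)
    also have "\<dots> = a * delta i r"
      by (simp add: reciprocal_diag_def delta_def)
    finally have 1: "(\<Sum>k<n. diagonal (reciprocal_diag i j a) $$ (r, k) * delta i k) = a * delta i r" .
    have "(\<Sum>k<n. t * delta j k * iv (diagonal (reciprocal_diag i j a)) $$ (k, s))
        = (\<Sum>k<n. delta j k * (t * (inverse (reciprocal_diag i j a k) * delta k s)))"
      unfolding diagonal_reciprocal_in_G(2)[OF assms] by (intro sum.cong) (simp_all add: diagonal_index rs)
    also have "\<dots> = t * (inverse (reciprocal_diag i j a j) * delta j s)"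
      using assms by simp
    also have "\<dots> = t * a * delta j s"
      using assms by (simp add: reciprocal_diag_def)
    finally show ?thesis
      unfolding 1 by (simp add: power2_eq_square)
  qed
  then show ?thesis
    unfolding conj_transvection[OF diagonal_reciprocal_in_G(1)[OF assms]] by (intro transvection_cong)
qed

lemma transvection_elem:
  assumes "i < n" "j < n" "i \<noteq> j" "t \<in> K"
  shows "transvection (delta i) (\<lambda>s. t * delta j s) \<in> carrier G"
    "iv (transvection (delta i) (\<lambda>s. t * delta j s)) = transvection (delta i) (\<lambda>s. - t * delta j s)"
  using transvection_delta_left[of i "\<lambda>s. t * delta j s"] assms by (simp_all add: delta_def)

end

context coarser_SL
begin

lemma large_element: "\<exists>x\<in>K. nv x > C"
proof -
  obtain x where x: "x \<in> K" "nv x > 1" using nontrivial by blast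
  obtain m where "C < nv x ^ m" using real_arch_pow[OF x(2)] by blast
  then show ?thesis
    using x by (intro bexI[of _ "x ^ m"]) (simp_all add: nv_power)
qed

text \<open>Diagonal conjugation multiplies the parameter by squares, and every element of a field of
  characteristic \<open>0\<close> is a difference of two squares.\<close>

lemma away_elementary:
  assumes ij: "i < n" "j < n" "i \<noteq> j" and c: "c > 0"
  shows "away {transvection (delta i) (\<lambda>s. t * delta j s) | t. t \<in> K \<and> nv t \<ge> c}"
proof -
  \<comment> \<open>The aim is \<open>t * a\<^sup>2 - t * a'\<^sup>2 = 1\<close>. Half the sum and
    half the difference of \<open>\<rho>\<close> and \<open>s\<close> have squares differing by
    \<open>\<rho> * s\<close>, whence \<open>s = inverse (t * \<rho>)\<close>. The size of
    \<open>\<rho>\<close> puts \<open>s\<close> into the unit ball and keeps both halves away from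
    0, so that \<open>R\<close> depends on \<open>\<rho>\<close> but not on
    \<open>t\<close>.\<close>
  obtain \<rho> where \<rho>: "\<rho> \<in> K" "nv \<rho> > 1 + 1 / c"
    using large_element by blast
  define R where "R = max 1 (max ((nv \<rho> + 1) / nv 2) (nv 2 / (nv \<rho> - 1)))"
  have "1 / c > 0" using c by simp
  then have \<rho>1: "nv \<rho> > 1" using \<rho> by linarith
  have away1: "away {transvection (delta i) (delta j)}"
  proof (rule away_singleton)
    show "transvection (delta i) (delta j) \<in> carrier G"
      using transvection_elem(1)[OF ij K_1] by simp
    have "transvection (delta i) (delta j) $$ (i, j) \<noteq> 1\<^sub>m n $$ (i, j)"
      using ij by (simp add: delta_def)
    then show "transvection (delta i) (delta j) \<noteq> 1\<^sub>m n" by metis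
  qed
  show ?thesis
  proof (rule away_step[OF away1, of _ R])
    fix b assume "b \<in> {transvection (delta i) (\<lambda>s. t * delta j s) | t. t \<in> K \<and> nv t \<ge> c}"
    then obtain t where t: "b = transvection (delta i) (\<lambda>s. t * delta j s)" "t \<in> K" "nv t \<ge> c" by blast
    have t0: "t \<noteq> 0" using t c by auto
    have \<rho>0: "\<rho> \<noteq> 0" using \<rho>1 by auto
    define s where "s = inverse (t * \<rho>)"
    have s: "s \<in> K" using t \<rho> by (simp add: s_def)
    have "nv s \<le> 1"
    proof -
      have "1 \<le> c * nv \<rho>" using \<rho>(2) c by (simp add: field_simps)
      also have "\<dots> \<le> nv t * nv \<rho>" using t by (intro mult_right_mono) auto
      finally have "inverse (nv t * nv \<rho>) \<le> 1"
        unfolding inverse_le_1_iff by simp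
      then show ?thesis
        by (simp only: s_def nv_inverse nv_mult)
    qed
    have bound: "nv ((\<rho> + x) / 2) \<le> R" "nv (inverse ((\<rho> + x) / 2)) \<le> R" "(\<rho> + x) / 2 \<noteq> 0"
      if "nv x \<le> 1" for x
    proof -
      have n2: "nv 2 > 0" by simp
      have up: "nv (\<rho> + x) \<le> nv \<rho> + 1" using nv_triangle[of \<rho> x] that by linarith
      have lo: "nv (\<rho> + x) \<ge> nv \<rho> - 1"
        using nv_triangle_sub[of \<rho> "\<rho> + x"] that by simp
      show "nv ((\<rho> + x) / 2) \<le> R"
        using up n2 unfolding R_def nv_divide by (intro max.coboundedI2 max.coboundedI1 divide_right_mono) auto
      have "nv 2 / nv (\<rho> + x) \<le> nv 2 / (nv \<rho> - 1)"
        using lo \<rho>1 by (intro divide_left_mono mult_pos_pos) auto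
      then show "nv (inverse ((\<rho> + x) / 2)) \<le> R"
        by (simp add: nv_divide R_def)
      show "(\<rho> + x) / 2 \<noteq> 0"
        using lo \<rho>1 by auto
    qed
    define a where "a = (\<rho> + s) / 2"
    define a' where "a' = (\<rho> + (- s)) / 2"
    have aK: "a \<in> K" "a' \<in> K" using s \<rho> by (auto simp: a_def a'_def)
    have R1: "1 \<le> R" by (simp add: R_def)
    have "nv (- s) \<le> 1" using \<open>nv s \<le> 1\<close> by simp
    note ba = bound[OF \<open>nv s \<le> 1\<close>, folded a_def] and ba' = bound[OF this, folded a'_def]
    have bounded_SL: "diagonal (reciprocal_diag i j a) \<in> bounded_SL R" "diagonal (reciprocal_diag i j a') \<in> bounded_SL R"
      by (intro diagonal_reciprocal_bounded ij aK R1 ba ba')+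
    note a0 = ba(3) ba'(3)
    have "a\<^sup>2 - a'\<^sup>2 = \<rho> * s"
      by (simp add: a_def a'_def power2_eq_square field_simps)
    moreover have "t * a\<^sup>2 + - t * a'\<^sup>2 = t * (a\<^sup>2 - a'\<^sup>2)"
      by (simp add: right_diff_distrib)
    moreover have "t * (\<rho> * s) = 1"
      using t0 \<rho>0 by (simp add: s_def field_simps)
    ultimately have iterated_square: "t * a\<^sup>2 + - t * a'\<^sup>2 = 1" by simp
    have ivb: "iv b = transvection (delta i) (\<lambda>s. - t * delta j s)" and bG: "b \<in> carrier G"
      using transvection_elem[OF ij t(2)] t(1) by simp_all
    have "diagonal (reciprocal_diag i j a) * b * iv (diagonal (reciprocal_diag i j a)) * (diagonal (reciprocal_diag i j a') * iv b * iv (diagonal (reciprocal_diag i j a')))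
       = transvection (delta i) (\<lambda>s. t * a\<^sup>2 * delta j s) * transvection (delta i) (\<lambda>s. - t * a'\<^sup>2 * delta j s)"
      unfolding ivb unfolding t(1) conj_reciprocal_transvection[OF ij aK(1) a0(1)] conj_reciprocal_transvection[OF ij aK(2) a0(2)] ..
    also have "\<dots> = transvection (delta i) (\<lambda>s. t * a\<^sup>2 * delta j s + - t * a'\<^sup>2 * delta j s)"
      by (rule transvection_mult_same) (use ij in \<open>simp add: delta_other\<close>)
    also have "(\<lambda>s. t * a\<^sup>2 * delta j s + - t * a'\<^sup>2 * delta j s) = delta j"
      using iterated_square by (simp only: flip: distrib_right) simp
    finally show "b \<in> carrier G \<and> (\<exists>k\<in>bounded_SL R. \<exists>k'\<in>bounded_SL R. k * b * iv k * (k' * iv b * iv k') \<in> {transvection (delta i) (delta j)})"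
      using bounded_SL bG by blast
  qed
qed

text \<open>The entry \<open>g j\<close> serves as a pivot: conjugation by
  \<open>transvection (delta j) w\<close> subtracts \<open>g j * w\<close> from the row
  \<open>g\<close> and leaves only its \<open>j\<close>-th entry. The lower bound \<open>c\<close>
  on the pivot bounds \<open>w\<close>.\<close>

lemma away_row_transvection_aux:
  assumes ij: "i < n" "j < n" and c: "c > 0"
  shows "away {transvection (delta i) g | g. g i = 0 \<and> (\<forall>s<n. g s \<in> K \<and> nv (g s) \<le> C) \<and> nv (g j) \<ge> c}" (is "away ?S")
proof (cases "i = j")
  case True
  then have "?S = {}" using c by auto
  then show ?thesis by (simp only: away_empty)
next
  case False
  show ?thesis
  proof (rule away_conj[OF away_elementary[OF ij False c], of _ "1 + \<bar>C\<bar> / c"])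
    fix b assume "b \<in> ?S"
    then obtain g where b: "b = transvection (delta i) g" and gi: "g i = 0" and K: "\<And>s. s < n \<Longrightarrow> g s \<in> K"
      and C: "\<And>s. s < n \<Longrightarrow> nv (g s) \<le> C" and gj: "nv (g j) \<ge> c"
      by blast
    have gj0: "g j \<noteq> 0" using gj c by auto
    define w where "w s = (if s = i \<or> s = j then 0 else g s / g j)" for s
    have w: "w i = 0" "w j = 0" by (simp_all add: w_def)
    have wK: "w s \<in> K" if "s < n" for s
      using K that ij by (auto simp: w_def)
    have "nv (w s) \<le> \<bar>C\<bar> / c" if "s < n" for s
      using C[OF that] gj c by (auto simp: w_def nv_divide intro!: frac_le)
    then have bounded_SL: "transvection (delta j) w \<in> bounded_SL (1 + \<bar>C\<bar> / c)"
      using transvection_delta_left_bounded[of j w] w wK ij by simp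
    note h = transvection_delta_left[of j w, OF ij(2) w(2) wK, simplified]
    have "transvection (delta j) w * b * iv (transvection (delta j) w) = transvection (delta i) (\<lambda>s. g j * delta j s)"
      unfolding b conj_transvection[OF h(1)]
    proof (rule transvection_cong)
      fix r s assume rs: "r < n" "s < n"
      have "(\<Sum>k<n. transvection (delta j) w $$ (r, k) * delta i k) = delta i r"
        using rs ij w by (simp add: delta_commute)
      moreover have "(\<Sum>k<n. g k * iv (transvection (delta j) w) $$ (k, s)) = g j * delta j s"
      proof -
        have "(\<Sum>k<n. g k * iv (transvection (delta j) w) $$ (k, s)) = (\<Sum>k<n. g k * delta k s) - (\<Sum>k<n. g k * delta j k) * w s"
          unfolding h(2) sum_distrib_right sum_subtractf[symmetric]
          using rs by (intro sum.cong) (simp_all add: algebra_simps)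
        also have "\<dots> = g s - g j * w s"
          using rs ij by simp
        also have "\<dots> = g j * delta j s"
          using gi gj0 False by (auto simp: w_def delta_def)
        finally show ?thesis .
      qed
      ultimately show "(\<Sum>k<n. transvection (delta j) w $$ (r, k) * delta i k) * (\<Sum>k<n. g k * iv (transvection (delta j) w) $$ (k, s))
        = delta i r * (g j * delta j s)" by simp
    qed
    moreover have "b \<in> carrier G"
      unfolding b using transvection_delta_left(1)[of i g] ij gi K by simp
    ultimately show "b \<in> carrier G \<and> (\<exists>k\<in>bounded_SL (1 + \<bar>C\<bar> / c). k * b * iv k \<in> {transvection (delta i) (\<lambda>s. t * delta j s) | t. t \<in> K \<and> nv t \<ge> c})"
      using bounded_SL K[OF ij(2)] gj by blast
  qed
qed

lemma away_row_transvection: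
  assumes i: "i < n" and c: "c > 0"
  shows "away {transvection (delta i) g | g. g i = 0 \<and> (\<forall>s<n. g s \<in> K \<and> nv (g s) \<le> C) \<and> (\<exists>j<n. nv (g j) \<ge> c)}"
proof -
  have "away (\<Union>j\<in>{..<n}. {transvection (delta i) g | g. g i = 0 \<and> (\<forall>s<n. g s \<in> K \<and> nv (g s) \<le> C) \<and> nv (g j) \<ge> c})"
    by (intro away_UN away_row_transvection_aux i c) auto
  then show ?thesis
    by (rule away_subset) blast
qed

end

section \<open>Matrices with one prescribed column\<close>

context valued_SL
begin

text \<open>Apply the inverse to the equation B e_i = t e_j.\<close>

lemma iv_column:
  assumes B: "B \<in> carrier G" and col: "\<And>r. r < n \<Longrightarrow> B $$ (r, i) = t * delta j r"
    and ij: "i < n" "j < n" "m < n"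
  shows "iv B $$ (m, j) * t = delta m i"
proof -
  have "delta m i = (\<Sum>k<n. iv B $$ (m, k) * B $$ (k, i))"
    using iv_left_sum[OF B ij(3,1)] by (simp add: delta_def eq_commute)
  also have "\<dots> = (\<Sum>k<n. (iv B $$ (m, k) * t) * delta j k)"
    using col by (intro sum.cong) auto
  also have "\<dots> = iv B $$ (m, j) * t"
    using ij by simp
  finally show ?thesis ..
qed

text \<open>If all these entries were small, the determinant \<open>1\<close> of \<open>iv B\<close> would be close to
  \<open>4 ^ n\<close>.\<close>

lemma quarter_eigenvector_not_scalar:
  assumes i: "i < n"
  shows "\<exists>c>0. \<forall>B\<in>bounded_SL R. (\<forall>r<n. B $$ (r, i) = 1/4 * delta i r) \<longrightarrow>
    (\<exists>m<n. m \<noteq> i \<and> (\<exists>s<n. nv (1/4 * iv B $$ (m, s) - delta m s) \<ge> c))"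
proof (rule ccontr)
  assume "\<not> ?thesis"
  then have "\<exists>B\<in>bounded_SL R. (\<forall>r<n. B $$ (r, i) = 1/4 * delta i r) \<and>
    (\<forall>m<n. m \<noteq> i \<longrightarrow> (\<forall>s<n. nv (1/4 * iv B $$ (m, s) - delta m s) < c))" if "c > 0" for c
    using that by (meson not_le)
  then have "\<exists>B\<in>bounded_SL R. (\<forall>r<n. B $$ (r, i) = 1/4 * delta i r) \<and>
    (\<forall>m<n. m \<noteq> i \<longrightarrow> (\<forall>s<n. nv (1/4 * iv B $$ (m, s) - delta m s) < inverse (real (Suc k))))" for k
    by simp
  then obtain B where B: "\<And>k. B k \<in> bounded_SL R" "\<And>k r. r < n \<Longrightarrow> B k $$ (r, i) = 1/4 * delta i r"
    "\<And>k m s. m < n \<Longrightarrow> m \<noteq> i \<Longrightarrow> s < n \<Longrightarrow> nv (1/4 * iv (B k) $$ (m, s) - delta m s) < inverse (real (Suc k))"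
    by metis
  \<comment> \<open>The other rows are replaced by those of 4 times the identity, to which they
    converge. Row \<open>i\<close> need not converge, but its diagonal entry is exactly 4 by
    \<open>iv_column\<close>, so \<open>Z k\<close> is 4 times a transvection and has determinant
    \<open>4 ^ n\<close>.\<close>
  define Z where "Z k = mat n n (\<lambda>(r, s). if r = i then iv (B k) $$ (r, s) else 4 * delta r s)" for k
  note BG = bounded_SL_G[OF B(1)]
  have "close_along sequentially (\<lambda>k. det (iv (B k))) (\<lambda>k. det (Z k))"
  proof (rule close_along_det)
    show "iv (B k) \<in> carrier_mat n n" "Z k \<in> carrier_mat n n" for k
      using G_dim[OF iv_in_G[OF BG]] by (simp_all add: Z_def)
    fix r s assume rs: "r < n" "s < n"
    show "close_along sequentially (\<lambda>k. iv (B k) $$ (r, s)) (\<lambda>k. Z k $$ (r, s))"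
    proof (rule close_alongI)
      show "(\<lambda>k. nv 4 * inverse (real (Suc k))) \<longlonglongrightarrow> 0"
        by (intro tendsto_mult_right_zero LIMSEQ_inverse_real_of_nat)
      show "\<forall>\<^sub>F k in sequentially. nv (iv (B k) $$ (r, s) - Z k $$ (r, s)) \<le> nv 4 * inverse (real (Suc k))"
      proof (intro always_eventually allI)
        fix k
        show "nv (iv (B k) $$ (r, s) - Z k $$ (r, s)) \<le> nv 4 * inverse (real (Suc k))"
        proof (cases "r = i")
          case False
          have "nv (iv (B k) $$ (r, s) - Z k $$ (r, s)) = nv (4 * (1/4 * iv (B k) $$ (r, s) - delta r s))"
            using rs False by (simp add: Z_def algebra_simps)
          also have "\<dots> \<le> nv 4 * inverse (real (Suc k))"
            unfolding nv_mult[of 4] using B(3)[OF rs(1) False rs(2), of k]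
            by (intro mult_left_mono less_imp_le) auto
          finally show ?thesis .
        qed (use rs in \<open>simp add: Z_def\<close>)
      qed
    qed
    show "bounded_along sequentially (\<lambda>k. Z k $$ (r, s))"
    proof (cases "r = i")
      case True
      have "nv (iv (B k) $$ (i, s)) \<le> R" for k
        using B(1)[of k] rs i by (auto simp: bounded_SL_def)
      then show ?thesis
        using rs True by (auto simp: Z_def bounded_along_def intro!: exI[of _ R])
    qed (use rs in \<open>simp add: Z_def\<close>)
  qed
  moreover have "det (iv (B k)) = 1" for k
    using G_det[OF iv_in_G[OF BG]] .
  moreover have "det (Z k) = 4 ^ n" for k
  proof -
    define w where "w s = 1/4 * iv (B k) $$ (i, s) - delta i s" for s
    have "w i = 0"
      using iv_column[OF BG B(2) i i i] by (simp add: w_def mult.commute)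
    have "Z k = 4 \<cdot>\<^sub>m transvection (delta i) w"
      by (rule eq_matI) (auto simp: Z_def w_def transvection_def delta_def)
    then show ?thesis
      using det_transvection_delta[OF i, of w] \<open>w i = 0\<close> by (simp add: transvection_def)
  qed
  ultimately have "(1 :: 'a) = 4 ^ n"
    using close_along_const_imp_eq[of sequentially "1 :: 'a" "4 ^ n"] by simp
  \<comment> \<open>Characteristic 0 carries the equation over to the natural numbers.\<close>
  then have "of_nat 1 = (of_nat (4 ^ n) :: 'a)" by simp
  then have "1 = (4 :: nat) ^ n" by (simp only: of_nat_eq_iff)
  then show False using one_less_power[of "4 :: nat" n] by simp
qed

end

context coarser_SL
begin

text \<open>The commutator of \<open>b\<close> with 1 + e_i e_m is again a row transvection in row
  \<open>i\<close>, because \<open>b\<close> only scales e_i. Its row is \<open>g\<close>, a quarter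
  of row \<open>m\<close> of the inverse minus e_m, and
  \<open>quarter_eigenvector_not_scalar\<close> supplies an \<open>m\<close> for which
  \<open>g\<close> is not small.\<close>

lemma away_quarter_eigenvector:
  assumes i: "i < n"
  shows "away {B \<in> bounded_SL R. \<forall>r<n. B $$ (r, i) = 1/4 * delta i r}" (is "away ?S")
proof -
  obtain c where c: "c > 0" "\<And>B. B \<in> bounded_SL R \<Longrightarrow> (\<And>r. r < n \<Longrightarrow> B $$ (r, i) = 1/4 * delta i r) \<Longrightarrow>
    \<exists>m<n. m \<noteq> i \<and> (\<exists>s<n. nv (1/4 * iv B $$ (m, s) - delta m s) \<ge> c)"
    using quarter_eigenvector_not_scalar[OF i] by meson
  let ?C = "nv (1/4) * R + 1"
  let ?S' = "{transvection (delta i) g | g. g i = 0 \<and> (\<forall>s<n. g s \<in> K \<and> nv (g s) \<le> ?C)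
    \<and> (\<exists>j<n. nv (g j) \<ge> c)}"
  show ?thesis
  proof (rule away_step[OF away_row_transvection[OF i c(1), of ?C], of _ "2"])
    fix b assume "b \<in> ?S"
    then have b: "b \<in> bounded_SL R" "\<And>r. r < n \<Longrightarrow> b $$ (r, i) = 1/4 * delta i r" by auto
    note bG = bounded_SL_G[OF b(1)]
    obtain m where m: "m < n" "m \<noteq> i" "\<exists>s<n. nv (1/4 * iv b $$ (m, s) - delta m s) \<ge> c"
      using c(2)[OF b] by blast
    define \<tau> where "\<tau> = transvection (delta i) (delta m)"
    define g where "g s = 1/4 * iv b $$ (m, s) - delta m s" for s
    have \<tau>G: "\<tau> \<in> carrier G" and iv\<tau>: "iv \<tau> = transvection (delta i) (\<lambda>s. - delta m s)"
      using transvection_delta_left[of i "delta m"] i m by (simp_all add: \<tau>_def delta_other)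
    have \<tau>bounded_SL: "\<tau> \<in> bounded_SL 2"
      using transvection_delta_left_bounded[of i "delta m" 1] i m by (simp add: \<tau>_def delta_def)
    have Y: "iv b $$ (m, i) = 0"
      using iv_column[OF bG b(2) i i m(1)] m by (simp add: delta_def)
    have "b * \<tau> * iv b = transvection (delta i) (\<lambda>s. 1/4 * iv b $$ (m, s))"
      unfolding \<tau>_def conj_transvection[OF bG] using i m b(2) by (intro transvection_cong) simp
    moreover have "b * (\<tau> * iv b * iv \<tau>) = (b * \<tau> * iv b) * iv \<tau>"
    proof -
      have "b \<otimes>\<^bsub>G\<^esub> (\<tau> \<otimes>\<^bsub>G\<^esub> iv b \<otimes>\<^bsub>G\<^esub> iv \<tau>) = b \<otimes>\<^bsub>G\<^esub> \<tau> \<otimes>\<^bsub>G\<^esub> iv b \<otimes>\<^bsub>G\<^esub> iv \<tau>"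
        using bG \<tau>G by (simp only: G.inv_closed G.m_closed G.m_assoc)
      then show ?thesis by simp
    qed
    moreover have "transvection (delta i) (\<lambda>s. 1/4 * iv b $$ (m, s)) * iv \<tau> = transvection (delta i) g"
      unfolding iv\<tau> g_def by (subst transvection_mult_same) (use i Y in \<open>simp_all flip: sum_divide_distrib\<close>)
    ultimately have *: "b * (\<tau> * iv b * iv \<tau>) = transvection (delta i) g" by simp
    have one: "1\<^sub>m n * b * iv (1\<^sub>m n) = b"
      using G.inv_one G_dim[OF bG] by (simp add: left_mult_one_mat[OF G_dim[OF bG]] right_mult_one_mat[OF G_dim[OF bG]])
    have "nv (g s) \<le> ?C" "g s \<in> K" if "s < n" for s
    proof -
      have "nv (iv b $$ (m, s)) \<le> R" using b(1) that m by (auto simp: bounded_SL_def)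
      then have "nv (1/4 * iv b $$ (m, s)) \<le> nv (1/4) * R"
        unfolding nv_mult by (intro mult_left_mono) auto
      moreover have "nv (delta m s) \<le> 1" by (simp add: delta_def)
      ultimately show "nv (g s) \<le> ?C"
        unfolding g_def using nv_triangle_diff[of "1/4 * iv b $$ (m, s)" "delta m s"] by linarith
      show "g s \<in> K"
        using G_K[OF iv_in_G[OF bG] m(1) that] by (auto simp: g_def)
    qed
    moreover have "g i = 0" using Y m by (simp add: g_def delta_def)
    moreover have "\<exists>s<n. nv (g s) \<ge> c" using m(3) by (simp add: g_def)
    ultimately have "transvection (delta i) g \<in> ?S'"
      by blast
    then have "1\<^sub>m n * b * iv (1\<^sub>m n) * (\<tau> * iv b * iv \<tau>) \<in> ?S'"
      unfolding one * .
    then show "b \<in> carrier G \<and> (\<exists>k\<in>bounded_SL 2. \<exists>k'\<in>bounded_SL 2. k * b * iv k * (k' * iv b * iv k') \<in> ?S')"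
      using bG \<tau>bounded_SL one_in_bounded_SL[of 2] by fastforce
  qed
qed

text \<open>Follow e_j through the commutator of \<open>D\<close> with \<open>b\<close>: the inverse
  of \<open>b\<close> gives e_i / t, the inverse of \<open>D\<close> halves this, \<open>b\<close>
  turns it into e_j / 2, and \<open>D\<close> halves once more. This is the origin of the eigenvalue
  1/4.\<close>

lemma away_column_multiple:
  assumes ij: "i < n" "j < n" "i \<noteq> j"
  shows "away {B \<in> bounded_SL R. \<exists>t. \<forall>r<n. B $$ (r, i) = t * delta j r}" (is "away ?S")
proof -
  define Q where "Q = max 1 (max (nv 2) (nv (inverse 2)))"
  define R' where "R' = real n * (real n * (real n * (Q * R) * Q) * R)"
  show ?thesis
  proof (rule away_step[OF away_quarter_eigenvector[OF ij(2), of R'], of _ Q])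
    fix b assume "b \<in> ?S"
    then obtain t where b: "b \<in> bounded_SL R" "\<And>r. r < n \<Longrightarrow> b $$ (r, i) = t * delta j r" by auto
    note bG = bounded_SL_G[OF b(1)]
    define D where "D = diagonal (reciprocal_diag i j 2)"
    have DQ: "D \<in> bounded_SL Q"
      unfolding D_def Q_def using ij by (intro diagonal_reciprocal_bounded) auto
    have D: "D \<in> carrier G" "iv D = diagonal (\<lambda>r. inverse (reciprocal_diag i j 2 r))"
      using diagonal_reciprocal_in_G[OF ij, of 2] by (simp_all add: D_def)
    note Db = mult_in_G[OF mult_in_G[OF D(1) bG] iv_in_G[OF D(1)]]
    define C where "C = D * b * iv D * iv b"
    have "C \<in> bounded_SL R'"
      unfolding C_def R'_def by (rule bounded_SL_mult[OF bounded_SL_conj[OF DQ b(1)] bounded_SL_inv[OF b(1)]])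
    have t: "iv b $$ (k, j) * t = delta k i" if "k < n" for k
      by (rule iv_column[OF bG b(2) ij(1,2) that])
    then have t0: "t \<noteq> 0" using ij(1) by force
    have ivb: "iv b $$ (k, j) = delta i k / t" if "k < n" for k
      using t[OF that] t0 by (simp add: field_simps delta_commute)
    have "C $$ (r, j) = 1/4 * delta j r" if r: "r < n" for r
    proof -
      have "C $$ (r, j) = (\<Sum>k<n. (D * b * iv D) $$ (r, k) * iv b $$ (k, j))"
        unfolding C_def using r ij by (intro index_mat_mult_sum G_dim Db iv_in_G bG)
      also have "\<dots> = (\<Sum>k<n. (D * b * iv D) $$ (r, k) / t * delta i k)"
        using ivb by (intro sum.cong) auto
      also have "\<dots> = (D * b * iv D) $$ (r, i) / t"
        using ij by (simp flip: sum_divide_distrib)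
      also have "\<dots> = reciprocal_diag i j 2 r * b $$ (r, i) * inverse (reciprocal_diag i j 2 i) / t"
        using conj_diagonal_index[of "reciprocal_diag i j 2" b r i] D bG r ij by (simp add: D_def)
      also have "\<dots> = 1/4 * delta j r"
        using b(2)[OF r] t0 ij by (auto simp: reciprocal_diag_def delta_def)
      finally show ?thesis .
    qed
    then have "C \<in> {B \<in> bounded_SL R'. \<forall>r<n. B $$ (r, j) = 1/4 * delta j r}"
      using \<open>C \<in> bounded_SL R'\<close> by simp
    moreover have "1\<^sub>m n * iv b * iv (1\<^sub>m n) = iv b"
      using G.inv_one by (simp add: left_mult_one_mat[OF G_dim[OF iv_in_G[OF bG]]] right_mult_one_mat[OF G_dim[OF iv_in_G[OF bG]]])
    moreover have "1\<^sub>m n \<in> bounded_SL Q"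
      by (intro one_in_bounded_SL) (simp add: Q_def)
    ultimately show "b \<in> carrier G \<and> (\<exists>k\<in>bounded_SL Q. \<exists>k'\<in>bounded_SL Q. k * b * iv k * (k' * iv b * iv k') \<in> {B \<in> bounded_SL R'. \<forall>r<n. B $$ (r, j) = 1/4 * delta j r})"
      using bG DQ unfolding C_def by (intro conjI bexI[of _ D] bexI[of _ "1\<^sub>m n"]) simp_all
  qed
qed

text \<open>Row operations with pivot \<open>b $$ (j, i)\<close> clear the rest of column
  \<open>i\<close>. The inverse factor on the right changes column \<open>j\<close> only, so the
  cleared column survives the conjugation.\<close>

lemma away_off_diagonal:
  assumes ij: "i < n" "j < n" "i \<noteq> j" and c: "c > 0"
  shows "away {B \<in> bounded_SL R. nv (B $$ (j, i)) \<ge> c}" (is "away ?S")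
proof -
  define Q where "Q = 1 + \<bar>R\<bar> / c"
  define R' where "R' = real n * (real n * (Q * R) * Q)"
  show ?thesis
  proof (rule away_conj[OF away_column_multiple[OF ij, of R'], of _ Q])
    fix b assume "b \<in> ?S"
    then have b: "b \<in> bounded_SL R" "nv (b $$ (j, i)) \<ge> c" by auto
    note bG = bounded_SL_G[OF b(1)]
    have b0: "b $$ (j, i) \<noteq> 0" using b(2) c by auto
    define w where "w r = (if r = j then 0 else - (b $$ (r, i) / b $$ (j, i)))" for r
    have w: "w j = 0" by (simp add: w_def)
    have wK: "w r \<in> K" if "r < n" for r
      using that ij G_K[OF bG] by (auto simp: w_def)
    have "nv (w r) \<le> \<bar>R\<bar> / c" if "r < n" for r
    proof -
      have "nv (b $$ (r, i)) \<le> \<bar>R\<bar>" using b(1) that ij by (auto simp: bounded_SL_def intro: order_trans[OF _ abs_ge_self])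
      then show ?thesis
        using b(2) c by (auto simp: w_def nv_divide intro!: frac_le)
    qed
    then have bounded_SL: "transvection w (delta j) \<in> bounded_SL Q"
      using transvection_delta_right_bounded[of j w] w wK ij by (simp add: Q_def)
    note g = transvection_delta_right[of j w, OF ij(2) w wK, simplified]
    let ?g = "transvection w (delta j)"
    have "(?g * b * iv ?g) $$ (r, i) = b $$ (j, i) * delta j r" if r: "r < n" for r
    proof -
      have gb: "(?g * b) $$ (r, i) = b $$ (j, i) * delta j r"
      proof -
        have "(?g * b) $$ (r, i) = (\<Sum>k<n. (delta r k + w r * delta j k) * b $$ (k, i))"
          using r ij G_dim[OF bG] by (simp add: index_mat_mult_sum[of _ n] del: index_mult_mat(1))
        also have "\<dots> = (\<Sum>k<n. delta r k * b $$ (k, i)) + w r * (\<Sum>k<n. delta j k * b $$ (k, i))"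
          unfolding sum_distrib_left sum.distrib[symmetric] by (simp add: algebra_simps)
        also have "\<dots> = b $$ (r, i) + w r * b $$ (j, i)"
          using r ij by simp
        also have "\<dots> = b $$ (j, i) * delta j r"
          using b0 by (auto simp: w_def delta_def)
        finally show ?thesis .
      qed
      have "(?g * b * iv ?g) $$ (r, i) = (\<Sum>k<n. (?g * b) $$ (r, k) * iv ?g $$ (k, i))"
        using r ij by (intro index_mat_mult_sum G_dim mult_in_G iv_in_G bG g(1))
      also have "\<dots> = (\<Sum>k<n. (?g * b) $$ (r, k) * delta k i)"
        unfolding g(2) using ij by (intro sum.cong) (simp_all add: delta_other)
      also have "\<dots> = b $$ (j, i) * delta j r"
        using gb ij by simp
      finally show ?thesis .
    qed
    moreover have "?g * b * iv ?g \<in> bounded_SL R'"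
      unfolding R'_def by (rule bounded_SL_conj[OF bounded_SL b(1)])
    ultimately show "b \<in> carrier G \<and> (\<exists>k\<in>bounded_SL Q. k * b * iv k \<in> {B \<in> bounded_SL R'. \<exists>t. \<forall>r<n. B $$ (r, i) = t * delta j r})"
      using bG bounded_SL by blast
  qed
qed

text \<open>Unless an off-diagonal entry at these positions already has value \<open>c / 4\<close>,
  conjugation by 1 + e_i e_j moves the diagonal difference to position \<open>(i, j)\<close>, up to
  sign and an error below \<open>c / 2\<close>.\<close>

lemma away_diagonal:
  assumes ij: "i < n" "j < n" "i \<noteq> j" and c: "c > 0"
  shows "away {B \<in> bounded_SL R. nv (B $$ (i, i) - B $$ (j, j)) \<ge> c}" (is "away ?S")
proof -
  define R' where "R' = real n * (real n * (2 * R) * 2)"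
  let ?S1 = "{B \<in> bounded_SL R. nv (B $$ (i, j)) \<ge> c / 4}"
  let ?S2 = "{B \<in> bounded_SL R. nv (B $$ (j, i)) \<ge> c / 4}"
  let ?S3 = "?S - (?S1 \<union> ?S2)"
  have "away ?S3"
  proof (rule away_conj[OF away_off_diagonal[OF ij(2,1) ij(3)[symmetric], of "c / 4" R'], of _ 2])
    fix b assume "b \<in> ?S3"
    then have b: "b \<in> bounded_SL R" "nv (b $$ (i, i) - b $$ (j, j)) \<ge> c" "nv (b $$ (i, j)) < c / 4" "nv (b $$ (j, i)) < c / 4"
      by auto
    note bG = bounded_SL_G[OF b(1)]
    let ?g = "transvection (delta i) (delta j)"
    have g: "?g \<in> carrier G" "iv ?g = transvection (delta i) (\<lambda>s. - delta j s)"
      using transvection_delta_left[of i "delta j"] ij by (simp_all add: delta_other)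
    have gKR: "?g \<in> bounded_SL 2"
      using transvection_delta_left_bounded[of i "delta j" 1] ij by (simp add: delta_def)
    have gb: "(?g * b) $$ (i, k) = b $$ (i, k) + b $$ (j, k)" if "k < n" for k
    proof -
      have "(?g * b) $$ (i, k) = (\<Sum>l<n. (delta i l + delta j l) * b $$ (l, k))"
        using that ij G_dim[OF bG] by (simp add: index_mat_mult_sum[of _ n] del: index_mult_mat(1))
      then show ?thesis
        using ij by (simp add: distrib_right sum.distrib)
    qed
    have "(?g * b * iv ?g) $$ (i, j) = (\<Sum>k<n. (?g * b) $$ (i, k) * iv ?g $$ (k, j))"
      using ij by (intro index_mat_mult_sum G_dim mult_in_G iv_in_G bG g(1))
    also have "\<dots> = (\<Sum>k<n. (?g * b) $$ (i, k) * delta k j - (?g * b) $$ (i, k) * delta i k)"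
      unfolding g(2) using ij by (intro sum.cong) (simp_all add: right_diff_distrib)
    also have "\<dots> = (b $$ (i, j) - b $$ (j, i)) - (b $$ (i, i) - b $$ (j, j))"
      using ij by (simp only: sum_subtractf sum_delta sum_delta' gb) simp
    finally have e: "(?g * b * iv ?g) $$ (i, j) = (b $$ (i, j) - b $$ (j, i)) - (b $$ (i, i) - b $$ (j, j))" .
    have "nv (b $$ (i, i) - b $$ (j, j)) \<le> nv (b $$ (i, j) - b $$ (j, i)) + nv ((?g * b * iv ?g) $$ (i, j))"
      using nv_triangle_sub[of "b $$ (i, i) - b $$ (j, j)" "b $$ (i, j) - b $$ (j, i)"]
      unfolding e nv_diff_commute[of "b $$ (i, j) - b $$ (j, i)"] .
    then have "nv ((?g * b * iv ?g) $$ (i, j)) \<ge> c / 4"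
      using b c nv_triangle_diff[of "b $$ (i, j)" "b $$ (j, i)"] by linarith
    moreover have "?g * b * iv ?g \<in> bounded_SL R'"
      unfolding R'_def by (rule bounded_SL_conj[OF gKR b(1)])
    ultimately show "b \<in> carrier G \<and> (\<exists>k\<in>bounded_SL 2. k * b * iv k \<in> {B \<in> bounded_SL R'. nv (B $$ (i, j)) \<ge> c / 4})"
      using bG gKR by blast
  qed (use c in simp)
  moreover have "away ?S1"
    by (rule away_off_diagonal) (use ij c in auto)
  moreover have "away ?S2"
    by (rule away_off_diagonal) (use ij c in auto)
  ultimately have "away (?S3 \<union> (?S1 \<union> ?S2))"
    by (intro away_Un)
  then show ?thesis
    by (rule away_subset) blast
qed

definition nonscalar :: "real \<Rightarrow> 'a mat \<Rightarrow> bool" where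
  "nonscalar c B \<longleftrightarrow> (\<exists>i<n. \<exists>j<n. i \<noteq> j \<and> (nv (B $$ (j, i)) \<ge> c \<or> nv (B $$ (i, i) - B $$ (j, j)) \<ge> c))"

lemma away_nonscalar:
  assumes c: "c > 0"
  shows "away {B \<in> bounded_SL R. nonscalar c B}"
proof -
  have "away (\<Union>(i, j)\<in>{(i, j) \<in> {..<n} \<times> {..<n}. i \<noteq> j}.
     {B \<in> bounded_SL R. nv (B $$ (j, i)) \<ge> c} \<union> {B \<in> bounded_SL R. nv (B $$ (i, i) - B $$ (j, j)) \<ge> c})"
    by (rule away_UN) (auto intro!: away_Un away_off_diagonal away_diagonal c
        intro: finite_subset[of _ "{..<n} \<times> {..<n}"])
  then show ?thesis
    by (rule away_subset) (auto simp: nonscalar_def)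
qed

end

section \<open>Neighbourhoods of the identity are bounded\<close>

lemma ex_max_lessThan:
  fixes f :: "nat \<Rightarrow> real"
  assumes "0 < n"
  obtains i where "i < n" "\<And>k. k < n \<Longrightarrow> f k \<le> f i"
proof -
  have "Max (f ` {..<n}) \<in> f ` {..<n}"
    using assms by (intro Max_in) auto
  then obtain i where "i < n" "f i = Max (f ` {..<n})" by auto
  then show ?thesis
    by (intro that[of i]) auto
qed

context valued_SL
begin

text \<open>Otherwise each of the \<open>fact n\<close> Leibniz terms has value at most
  \<open>1 / (2 * fact n)\<close>, and the determinant has value at most 1/2.\<close>

lemma det_one_entry_bound:
  assumes B: "B \<in> carrier G"
  shows "\<exists>i<n. \<exists>j<n. nv (B $$ (i, j)) \<ge> 1 / (2 * fact n)"
proof (rule ccontr)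
  let ?c = "1 / (2 * fact n) :: real"
  assume "\<not> ?thesis"
  then have small: "nv (B $$ (i, j)) \<le> ?c" if "i < n" "j < n" for i j
    using that by force
  have f: "(fact n :: real) \<ge> 1" by (rule fact_ge_1)
  have c: "0 \<le> ?c" by simp
  have c1: "?c \<le> 1"
    using f by (subst divide_le_eq_1_pos) linarith+
  have "nv (signof \<pi> * (\<Prod>i = 0..<n. B $$ (i, \<pi> i))) \<le> ?c"
    if "\<pi> \<in> {\<pi>. \<pi> permutes {0..<n}}" for \<pi>
  proof -
    have "nv (signof \<pi> * (\<Prod>i = 0..<n. B $$ (i, \<pi> i))) = (\<Prod>i = 0..<n. nv (B $$ (i, \<pi> i)))"
      by (simp add: nv_mult nv_prod sign_def)
    also have "\<dots> \<le> (\<Prod>i = 0..<n. ?c)"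
      using that small by (intro prod_mono) (auto dest: permutes_in_image)
    also have "\<dots> = ?c ^ n" by simp
    also have "\<dots> \<le> ?c ^ 1"
      using c c1 n_pos by (intro power_decreasing) (auto simp del: n_pos)
    finally show ?thesis by simp
  qed
  then have "nv (det B) \<le> real (card {\<pi>. \<pi> permutes {0..<n}}) * ?c"
    unfolding det_def'[OF G_dim[OF B]] by (rule nv_sum_bound)
  also have "\<dots> = 1 / 2"
    by (subst card_permutations[of _ n]) auto
  finally show False
    using G_det[OF B] by simp
qed

end

context coarser_SL
begin

text \<open>What conjugation of a transvection controls is a column of \<open>A\<close> times a row
  of its inverse, hence a bound on products. For \<open>j = l\<close> the matrix 1 + s e_j e_l would
  not have determinant 1; \<open>bounded_nbhd\<close> recovers that case.\<close>

lemma entries_product_bound: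
  "\<exists>V d. nbhd V \<and> d > 0 \<and> (\<forall>A\<in>V. \<forall>i<n. \<forall>j<n. \<forall>l<n. \<forall>m<n. j \<noteq> l \<longrightarrow>
    nv (A $$ (i, j)) * nv (iv A $$ (l, m)) \<le> 1 / d)"
proof -
  \<comment> \<open>The matrix \<open>P\<close> below has trace 0. If every \<open>1 - P r r\<close>
    had value below \<open>c\<close>, their sum \<open>n\<close> would have value at most
    \<open>n * c\<close>, so at most half of \<open>nv (of_nat n)\<close>. The minimum with 1 serves
    the case of an off-diagonal entry 1.\<close>
  define c where "c = min 1 (nv (of_nat n) / (2 * n))"
  have n0: "nv (of_nat n) > 0" using n_pos by (simp del: n_pos)
  then have c: "c > 0" by (simp add: c_def)
  obtain V where V: "nbhd V" "V \<inter> {B \<in> bounded_SL 2. nonscalar c B} = {}"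
    using away_nonscalar[OF c] by (auto simp: away_def)
  obtain W where W: "nbhd W" "\<And>x y. x \<in> W \<Longrightarrow> y \<in> W \<Longrightarrow> x * y * iv x \<in> V"
    using nbhd_conj[OF V(1)] by blast
  obtain d where d: "d > 0"
      "\<And>B. B \<in> carrier G \<Longrightarrow> (\<And>i j. i < n \<Longrightarrow> j < n \<Longrightarrow> nv (B $$ (i, j) - delta i j) < d) \<Longrightarrow> B \<in> W"
    using nbhd_small[OF W(1)] by blast
  have "nv (A $$ (i, j)) * nv (iv A $$ (l, m)) \<le> 1 / d"
    if A: "A \<in> W" and ij: "i < n" "j < n" "l < n" "m < n" "j \<noteq> l" for A i j l m
  proof -
    have AG: "A \<in> carrier G" using A nbhd_G[OF W(1)] by blast
    obtain i0 where i0: "i0 < n" "\<And>k. k < n \<Longrightarrow> nv (A $$ (k, j)) \<le> nv (A $$ (i0, j))"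
      using ex_max_lessThan[OF n_pos, of "\<lambda>k. nv (A $$ (k, j))"] by blast
    obtain m0 where m0: "m0 < n" "\<And>k. k < n \<Longrightarrow> nv (iv A $$ (l, k)) \<le> nv (iv A $$ (l, m0))"
      using ex_max_lessThan[OF n_pos, of "\<lambda>k. nv (iv A $$ (l, k))"] by blast
    let ?p = "A $$ (i0, j) * iv A $$ (l, m0)"
    have "nv ?p \<le> 1 / d"
    proof (rule ccontr)
      assume "\<not> nv ?p \<le> 1 / d"
      then have p: "1 / d < nv ?p" by simp
      moreover have "1 / d > 0" using d by simp
      ultimately have "nv ?p > 0" by linarith
      then have p0: "?p \<noteq> 0" by auto
      \<comment> \<open>Scaling by the inverse of the largest product makes the largest entry of
        \<open>P\<close> equal to 1, at position \<open>(i0, m0)\<close>, while \<open>s\<close> has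
        value below \<open>d\<close>, so the elementary transvection lies in
        \<open>W\<close>.\<close>
      define s where "s = inverse ?p"
      have sd: "nv s < d"
        using p d(1) \<open>nv ?p > 0\<close> unfolding s_def nv_inverse by (simp add: field_simps)
      have sK: "s \<in> K"
        unfolding s_def using G_K[OF AG i0(1) ij(2)] G_K[OF iv_in_G[OF AG] ij(3) m0(1)] by simp
      define P where "P r q = A $$ (r, j) * (s * iv A $$ (l, q))" for r q
      have P0: "P i0 m0 = 1"
        using p0 by (simp add: P_def s_def field_simps)
      have P1: "nv (P r q) \<le> 1" if "r < n" "q < n" for r q
      proof -
        have "nv (P r q) = nv (A $$ (r, j)) * nv (iv A $$ (l, q)) * nv s"
          by (simp add: P_def nv_mult)
        also have "\<dots> \<le> nv (A $$ (i0, j)) * nv (iv A $$ (l, m0)) * nv s"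
          using i0 m0 that by (intro mult_right_mono mult_mono) auto
        also have "\<dots> = nv (P i0 m0)"
          by (simp add: P_def nv_mult)
        finally show ?thesis by (simp add: P0)
      qed
      let ?x = "transvection (delta j) (\<lambda>q. s * delta l q)"
      note xG = transvection_elem[OF ij(2,3,5) sK]
      have "?x \<in> W"
      proof (rule d(2)[OF xG(1)])
        fix r q assume "r < n" "q < n"
        then show "nv (?x $$ (r, q) - delta r q) < d"
          using sd d(1) by (simp add: delta_def)
      qed
      define E where "E = A * ?x * iv A"
      have "E \<in> V" unfolding E_def by (rule W(2)) fact+
      have E: "E = transvection (\<lambda>r. A $$ (r, j)) (\<lambda>q. s * iv A $$ (l, q))"
        unfolding E_def conj_transvection[OF AG] by (rule transvection_cong) (use ij in \<open>simp add: mult.assoc flip: sum_distrib_left\<close>)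
      have "E \<in> carrier G" using \<open>E \<in> V\<close> nbhd_G[OF V(1)] by blast
      have "iv E = A \<otimes>\<^bsub>G\<^esub> iv ?x \<otimes>\<^bsub>G\<^esub> iv A"
        unfolding E_def G_mult[symmetric] using AG xG(1)
        by (simp only: G.inv_mult_group G.inv_inv G.inv_closed G.m_closed G.m_assoc)
      then have ivE: "iv E = transvection (\<lambda>r. A $$ (r, j)) (\<lambda>q. - s * iv A $$ (l, q))"
        unfolding G_mult xG(2) conj_transvection[OF AG]
        by (simp only:) (rule transvection_cong, use ij in \<open>simp add: mult.assoc sum_negf flip: sum_distrib_left\<close>)
      have EP: "E $$ (r, q) = delta r q + P r q" and ivEP: "iv E $$ (r, q) = delta r q - P r q"
        if "r < n" "q < n" for r q
        using that unfolding ivE by (simp_all add: E P_def)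
      have "nv (delta r q + P r q) \<le> 2 \<and> nv (delta r q - P r q) \<le> 2" if "r < n" "q < n" for r q
      proof -
        have "nv (delta r q) \<le> 1" by (simp add: delta_def)
        then show ?thesis
          using P1[OF that] nv_triangle[of "delta r q" "P r q"] nv_triangle_diff[of "delta r q" "P r q"]
          by linarith
      qed
      then have EKR: "E \<in> bounded_SL 2"
        using \<open>E \<in> carrier G\<close> by (simp add: bounded_SL_def EP ivEP)
      \<comment> \<open>An off-diagonal entry 1 of \<open>P\<close> is an entry of \<open>E\<close>.
        If the entry 1 is on the diagonal, trace 0 forbids the whole diagonal of \<open>P\<close> to
        be near 1, so two diagonal entries of \<open>E\<close> differ.\<close>
      have "nonscalar c E"
      proof (cases "i0 = m0")
        case False
        have "E $$ (i0, m0) = 1" using EP i0(1) m0(1) P0 False by (simp add: delta_def)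
        then have "nv (E $$ (i0, m0)) \<ge> c" by (simp add: c_def)
        then show ?thesis
          unfolding nonscalar_def using i0(1) m0(1) False by blast
      next
        case True
        have trace: "(\<Sum>r<n. P r r) = 0"
        proof -
          have "(\<Sum>r<n. P r r) = s * (\<Sum>r<n. iv A $$ (l, r) * A $$ (r, j))"
            by (simp add: P_def sum_distrib_left mult_ac)
          then show ?thesis
            using iv_left_sum[OF AG ij(3,2)] ij(5) by simp
        qed
        have "\<exists>r<n. nv (1 - P r r) \<ge> c"
        proof (rule ccontr)
          assume "\<not> (\<exists>r<n. nv (1 - P r r) \<ge> c)"
          then have "nv (\<Sum>r<n. 1 - P r r) \<le> real (card {..<n}) * c"
            by (intro nv_sum_bound) force
          then have "nv (of_nat n) \<le> n * c"
            by (simp add: sum_subtractf trace)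
          also have "n * c \<le> n * (nv (of_nat n) / (2 * n))"
            unfolding c_def by (intro mult_left_mono) auto
          also have "\<dots> = nv (of_nat n) / 2"
            using n_pos by (simp del: n_pos)
          finally show False using n0 by simp
        qed
        then obtain r where r: "r < n" "nv (1 - P r r) \<ge> c" by blast
        have "r \<noteq> i0" using r(2) P0 True c by auto
        moreover have "E $$ (i0, i0) - E $$ (r, r) = 1 - P r r"
          using EP i0(1) r(1) P0 True by simp
        ultimately show ?thesis
          unfolding nonscalar_def using i0(1) r by metis
      qed
      then show False using V(2) EKR \<open>E \<in> V\<close> by blast
    qed
    moreover have "nv (A $$ (i, j)) * nv (iv A $$ (l, m)) \<le> nv (A $$ (i0, j)) * nv (iv A $$ (l, m0))"
      using i0(2)[OF ij(1)] m0(2)[OF ij(4)] by (intro mult_mono) auto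
    ultimately show ?thesis by (simp add: nv_mult)
  qed
  then show ?thesis using W(1) d(1) by blast
qed

text \<open>For \<open>j = l\<close> pick \<open>k\<close> different from \<open>j\<close>, possible
  as \<open>n\<close> is at least 2. Some term of the \<open>(k, k)\<close> entry of
  \<open>iv A * A\<close> has value at least \<open>1 / (2 * n)\<close>; multiplied by it, the
  product regroups into two products with distinct inner indices. A bound on all products then
  bounds each factor, because both matrices have an entry that is not small.\<close>

lemma bounded_nbhd: "\<exists>V R. nbhd V \<and> V \<subseteq> bounded_SL R"
proof -
  obtain V d where V: "nbhd V" and d: "d > 0" and *: "\<And>A i j l m. A \<in> V \<Longrightarrow> i < n \<Longrightarrow> j < n \<Longrightarrow> l < n \<Longrightarrow> m < n \<Longrightarrow> j \<noteq> l \<Longrightarrow>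
    nv (A $$ (i, j)) * nv (iv A $$ (l, m)) \<le> 1 / d"
    using entries_product_bound by blast
  define C where "C = max (1 / d) (2 * real n * (1 / d * (1 / d)))"
  define R where "R = C * (2 * fact n)"
  have "A \<in> bounded_SL R" if A: "A \<in> V" for A
  proof -
    have AG: "A \<in> carrier G" using A nbhd_G[OF V] by blast
    have prod: "nv (A $$ (i, j)) * nv (iv A $$ (l, m)) \<le> C" if ij: "i < n" "j < n" "l < n" "m < n" for i j l m
    proof (cases "j = l")
      case False
      then show ?thesis using *[OF A ij False] by (simp add: C_def)
    next
      case True
      obtain k where k: "k < n" "k \<noteq> j"
        using n_ge_2 that[of 0] by (cases "j = 0") (auto intro: that[of 1])
      have "\<exists>r<n. nv (iv A $$ (k, r) * A $$ (r, k)) \<ge> 1 / (2 * real n)"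
      proof (rule ccontr)
        assume "\<not> ?thesis"
        then have "nv (\<Sum>r<n. iv A $$ (k, r) * A $$ (r, k)) \<le> real (card {..<n}) * (1 / (2 * real n))"
          by (intro nv_sum_bound) force
        then show False
          using iv_left_sum[OF AG k(1) k(1)] n_pos by (simp del: n_pos)
      qed
      then obtain r where r: "r < n" "nv (iv A $$ (k, r)) * nv (A $$ (r, k)) \<ge> 1 / (2 * real n)"
        by (auto simp: nv_mult)
      let ?a = "nv (A $$ (i, j))" and ?b = "nv (iv A $$ (j, m))"
      have "?a * ?b * (1 / (2 * real n)) \<le> ?a * ?b * (nv (iv A $$ (k, r)) * nv (A $$ (r, k)))"
        using r by (intro mult_left_mono) auto
      also have "\<dots> = (?a * nv (iv A $$ (k, r))) * (nv (A $$ (r, k)) * ?b)"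
        by (simp add: mult_ac)
      also have "\<dots> \<le> (1 / d) * (1 / d)"
        using *[OF A ij(1,2) k(1) r(1)] *[OF A r(1) k(1) ij(2,4)] k(2) d by (intro mult_mono) auto
      finally have "?a * ?b \<le> 2 * real n * (1 / d * (1 / d))"
        using n_pos by (simp add: field_simps del: n_pos)
      then show ?thesis
        using True by (simp add: C_def)
    qed
    have "nv (A $$ (i, j)) \<le> R" if ij: "i < n" "j < n" for i j
    proof -
      obtain l m where lm: "l < n" "m < n" "nv (iv A $$ (l, m)) \<ge> 1 / (2 * fact n)"
        using det_one_entry_bound[OF iv_in_G[OF AG]] by blast
      have "nv (A $$ (i, j)) * (1 / (2 * fact n)) \<le> nv (A $$ (i, j)) * nv (iv A $$ (l, m))"
        using lm by (intro mult_left_mono) auto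
      also have "\<dots> \<le> C" by (rule prod[OF ij lm(1,2)])
      finally show ?thesis by (simp add: R_def field_simps)
    qed
    moreover have "nv (iv A $$ (l, m)) \<le> R" if lm: "l < n" "m < n" for l m
    proof -
      obtain i j where ij: "i < n" "j < n" "nv (A $$ (i, j)) \<ge> 1 / (2 * fact n)"
        using det_one_entry_bound[OF AG] by blast
      have "(1 / (2 * fact n)) * nv (iv A $$ (l, m)) \<le> nv (A $$ (i, j)) * nv (iv A $$ (l, m))"
        using ij by (intro mult_right_mono) auto
      also have "\<dots> \<le> C" by (rule prod[OF ij(1,2) lm])
      finally show ?thesis by (simp add: R_def field_simps)
    qed
    ultimately show ?thesis using AG by (simp add: bounded_SL_def)
  qed
  then show ?thesis using V by blast
qed

end

section \<open>Minimality when n is a power of 2\<close>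

text \<open>Pulling the topology of the codomain back along \<open>f\<close> turns a continuous
  isomorphism into a coarser group topology on \<open>G\<close> itself.\<close>

lemma minimal_topological_groupI:
  assumes top: "topological_group G T"
    and coarser: "\<And>T'. topological_group G T' \<Longrightarrow> (\<And>U. openin T' U \<Longrightarrow> openin T U) \<Longrightarrow> T' = T"
  shows "minimal_topological_group G T"
  unfolding minimal_topological_group_def
proof (intro conjI allI impI top)
  fix H :: "'a monoid" and S f
  assume "topological_group H S \<and> f \<in> iso G H \<and> continuous_map T S f"
  then have H: "topological_group H S" and f: "f \<in> iso G H" and cont: "continuous_map T S f" by auto
  have G: "Group.group G" and tT: "topspace T = carrier G" and tS: "topspace S = carrier H"
    using top H by (auto simp: topological_group_def)
  have bij: "bij_betw f (carrier G) (carrier H)"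
    using f by (auto simp: iso_def)
  have "pullback_topology (carrier G) f S = T"
    by (rule coarser[OF topological_group_pullback[OF G H f]])
       (use cont in \<open>auto simp: openin_pullback_topology continuous_map_alt tT\<close>)
  then have opn: "openin T U \<longleftrightarrow> (\<exists>V. openin S V \<and> U = f -` V \<inter> carrier G)" for U
    by (metis openin_pullback_topology)
  have "open_map T S f"
    unfolding open_map_def
  proof safe
    fix U assume "openin T U"
    then obtain V where V: "openin S V" "U = f -` V \<inter> carrier G" using opn by blast
    moreover have "V \<subseteq> f ` carrier G"
      using openin_subset[OF V(1)] bij by (simp add: tS bij_betw_def)
    ultimately have "f ` U = V" by blast
    then show "openin S (f ` U)" using V by simp
  qed
  then show "homeomorphic_map T S f"
    using cont bij tS tT bijective_open_imp_homeomorphic_map[of T S f]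
    by (simp add: bij_betw_def)
qed

context valued_subfield
begin

lemma close_along_cong_left:
  assumes "\<forall>\<^sub>F x in F. f x = f' x"
  shows "close_along F f g \<longleftrightarrow> close_along F f' g"
  unfolding close_along_def
  by (rule tendsto_cong) (use assms in eventually_elim, simp)

end

section \<open>Convergence along the neighbourhoods of the identity in the coarser topology\<close>

context coarser_SL
begin

abbreviation nhds_1 where "nhds_1 \<equiv> nhdsin T' (1\<^sub>m n)"

lemma eventually_nhds_1: "eventually P nhds_1 \<longleftrightarrow> (\<exists>V. nbhd V \<and> (\<forall>x\<in>V. P x))"
  using one_in_G by (auto simp: eventually_nhdsin nbhd_def)

lemma eventually_nhds_1_nbhd: "nbhd V \<Longrightarrow> \<forall>\<^sub>F B in nhds_1. B \<in> V"
  by (auto simp: eventually_nhds_1)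

lemma eventually_nhds_1_G: "\<forall>\<^sub>F B in nhds_1. B \<in> carrier G"
  using nbhd_carrier by (auto simp: eventually_nhds_1)

text \<open>Needed for matrices that merely approach \<open>A\<close>, where
  \<open>away_singleton\<close> says nothing: the \<open>T'\<close>-open set separating
  \<open>A\<close> from the identity is open in the finer topology too and so contains an entrywise
  ball.\<close>

lemma away_ball:
  assumes "A \<in> carrier G" "A \<noteq> 1\<^sub>m n"
  shows "\<exists>d>0. away {B \<in> carrier G. \<forall>i<n. \<forall>j<n. nv (B $$ (i, j) - A $$ (i, j)) < d}"
proof -
  have "Hausdorff_space T'"
    using T'_group by (simp add: topological_group_def)
  then obtain U V where UV: "openin T' U" "openin T' V" "1\<^sub>m n \<in> U" "A \<in> V" "disjnt U V"
    using assms one_in_G unfolding Hausdorff_space_def by (metis topspace_T')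
  obtain d where d: "d > 0"
      "\<And>B. B \<in> carrier G \<Longrightarrow> (\<forall>i<n. \<forall>j<n. nv (B $$ (i, j) - A $$ (i, j)) < d) \<Longrightarrow> B \<in> V"
    using openin_TG_imp[OF T'_coarser[OF UV(2)] UV(4)] by blast
  have "away {B \<in> carrier G. \<forall>i<n. \<forall>j<n. nv (B $$ (i, j) - A $$ (i, j)) < d}"
    unfolding away_def nbhd_def using UV d(2) by (intro exI[of _ U]) (auto simp: disjnt_iff)
  then show ?thesis using d(1) by blast
qed

lemma entry_bounded: "i < n \<Longrightarrow> j < n \<Longrightarrow> bounded_along nhds_1 (\<lambda>B. B $$ (i, j))"
proof -
  assume ij: "i < n" "j < n"
  obtain V R where VR: "nbhd V" "V \<subseteq> bounded_SL R" using bounded_nbhd by blast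
  then have "\<forall>\<^sub>F B in nhds_1. nv (B $$ (i, j)) \<le> R"
    unfolding eventually_nhds_1 using ij by (auto simp: bounded_SL_def)
  then show ?thesis by (auto simp: bounded_along_def)
qed

lemma eventually_scalar:
  assumes "e > 0"
  shows "\<forall>\<^sub>F B in nhds_1. \<not> nonscalar e B"
proof -
  obtain V R where VR: "nbhd V" "V \<subseteq> bounded_SL R" using bounded_nbhd by blast
  obtain W where W: "nbhd W" "W \<inter> {B \<in> bounded_SL R. nonscalar e B} = {}"
    using away_nonscalar[OF assms] by (auto simp: away_def)
  show ?thesis
    unfolding eventually_nhds_1 using nbhd_Int[OF VR(1) W(1)] VR(2) W(2) by blast
qed

text \<open>Stands for the scalar of a nearly scalar matrix; the diagonal entries are close to each
  other, so one of them represents it.\<close>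

abbreviation corner where "corner \<equiv> (\<lambda>B :: 'a mat. B $$ (0, 0))"

lemma close_along_corner:
  assumes ij: "i < n" "j < n"
  shows "close_along nhds_1 (\<lambda>B. B $$ (i, j)) (\<lambda>B. corner B * delta i j)"
  unfolding close_along_iff
proof (intro allI impI)
  fix e :: real assume e: "e > 0"
  from eventually_scalar[OF e]
  show "\<forall>\<^sub>F B in nhds_1. nv (B $$ (i, j) - corner B * delta i j) < e"
  proof eventually_elim
    case (elim B)
    show ?case
    proof (cases "i = j")
      case False
      then show ?thesis
        using elim ij unfolding nonscalar_def by (auto simp: delta_other not_le)
    next
      case True
      show ?thesis
      proof (cases "i = 0")
        case False
        then have "\<not> nv (B $$ (i, i) - B $$ (0, 0)) \<ge> e"
          using elim ij n_pos unfolding nonscalar_def by blast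
        then show ?thesis using True by simp
      qed (use True e in simp)
    qed
  qed
qed

text \<open>This is \<open>B\<close> to the power \<open>2 ^ m\<close>. Squaring is
  \<open>T'\<close>-continuous, so these powers are \<open>T'\<close>-close to the identity when
  \<open>B\<close> is; this is what excludes powers of \<open>corner B\<close> near
  \<open>- 1\<close>.\<close>

primrec iterated_square :: "nat \<Rightarrow> 'a mat \<Rightarrow> 'a mat" where
  "iterated_square 0 B = B"
| "iterated_square (Suc m) B = iterated_square m B * iterated_square m B"

lemma iterated_square_in_G: "B \<in> carrier G \<Longrightarrow> iterated_square m B \<in> carrier G"
  by (induction m) (auto simp: mult_in_G)

lemma iterated_square_one: "iterated_square m (1\<^sub>m n) = 1\<^sub>m n"
  by (induction m) auto

lemma continuous_map_iterated_square: "continuous_map T' T' (iterated_square m)"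
proof (induction m)
  case 0
  have "iterated_square 0 = id" by auto
  then show ?case by simp
next
  case (Suc m)
  have "iterated_square (Suc m) = (\<lambda>B. iterated_square m B * iterated_square m B)" by auto
  then show ?case using continuous_map_T'_mult[OF Suc Suc] by simp
qed

lemma close_along_iterated_square:
  assumes "i < n" "j < n"
  shows "close_along nhds_1 (\<lambda>B. iterated_square m B $$ (i, j)) (\<lambda>B. corner B ^ (2 ^ m) * delta i j)"
  using assms
proof (induction m arbitrary: i j)
  case 0
  then show ?case using close_along_corner by simp
next
  case (Suc m)
  have bounded_along: "bounded_along nhds_1 (\<lambda>B. corner B ^ (2 ^ m) * delta i j)" for i j
    by (intro bounded_along_mult bounded_along_power entry_bounded n_pos bounded_along_const)
  have "close_along nhds_1 (\<lambda>B. \<Sum>k<n. iterated_square m B $$ (i, k) * iterated_square m B $$ (k, j))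
     (\<lambda>B. \<Sum>k<n. (corner B ^ (2 ^ m) * delta i k) * (corner B ^ (2 ^ m) * delta k j))"
    by (intro close_along_sum close_along_mult Suc.IH bounded_along) (use Suc.prems in auto)
  also have "(\<lambda>B. \<Sum>k<n. (corner B ^ (2 ^ m) * delta i k) * (corner B ^ (2 ^ m) * delta k j))
      = (\<lambda>B. corner B ^ (2 ^ Suc m) * delta i j)"
  proof
    fix B
    have "(\<Sum>k<n. (corner B ^ (2 ^ m) * delta i k) * (corner B ^ (2 ^ m) * delta k j))
        = (\<Sum>k<n. (corner B ^ (2 ^ m) * corner B ^ (2 ^ m) * delta k j) * delta i k)"
      by (simp add: mult_ac)
    then show "(\<Sum>k<n. (corner B ^ (2 ^ m) * delta i k) * (corner B ^ (2 ^ m) * delta k j)) = corner B ^ (2 ^ Suc m) * delta i j"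
      using Suc.prems by (simp add: mult_2 power_add)
  qed
  finally have *: "close_along nhds_1 (\<lambda>B. \<Sum>k<n. iterated_square m B $$ (i, k) * iterated_square m B $$ (k, j)) (\<lambda>B. corner B ^ (2 ^ Suc m) * delta i j)" .
  have "\<forall>\<^sub>F B in nhds_1. (\<Sum>k<n. iterated_square m B $$ (i, k) * iterated_square m B $$ (k, j)) = iterated_square (Suc m) B $$ (i, j)"
    using eventually_nhds_1_G
  proof eventually_elim
    case (elim B)
    show ?case
      using index_mat_mult_sum[OF G_dim[OF iterated_square_in_G[OF elim]] G_dim[OF iterated_square_in_G[OF elim]] Suc.prems, of m m]
      by simp
  qed
  then show ?case
    using * by (simp only: close_along_cong_left)
qed

lemma corner_power_dim: "close_along nhds_1 (\<lambda>B. corner B ^ n) (\<lambda>_. 1)"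
proof -
  \<comment> \<open>\<open>close_along_det\<close> wants an \<open>n\<close> by \<open>n\<close>
    matrix for every argument, not just eventually; rebuilding \<open>B\<close> from its entries
    ensures this.\<close>
  let ?A = "\<lambda>B. mat n n (\<lambda>(i, j). B $$ (i, j))"
  have "close_along nhds_1 (\<lambda>B. det (?A B)) (\<lambda>B. det (corner B \<cdot>\<^sub>m 1\<^sub>m n))"
  proof (rule close_along_det)
    fix i j assume ij: "i < n" "j < n"
    have e: "?A B $$ (i, j) = B $$ (i, j)" "(corner B \<cdot>\<^sub>m 1\<^sub>m n) $$ (i, j) = corner B * delta i j" for B
      using ij by (simp_all add: delta_def)
    show "close_along nhds_1 (\<lambda>B. ?A B $$ (i, j)) (\<lambda>B. (corner B \<cdot>\<^sub>m 1\<^sub>m n) $$ (i, j))"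
      unfolding e by (rule close_along_corner[OF ij])
    show "bounded_along nhds_1 (\<lambda>B. (corner B \<cdot>\<^sub>m 1\<^sub>m n) $$ (i, j))"
      unfolding e by (intro bounded_along_mult entry_bounded n_pos bounded_along_const)
  qed auto
  moreover have "\<forall>\<^sub>F B in nhds_1. det (?A B) = 1"
    using eventually_nhds_1_G
  proof eventually_elim
    case (elim B)
    then have "?A B = B" by (intro eq_matI) (auto simp: G_iff)
    then show ?case using G_det[OF elim] by simp
  qed
  ultimately have "close_along nhds_1 (\<lambda>_. 1) (\<lambda>B. corner B ^ n)"
    using close_along_cong_left[of "\<lambda>B. det (?A B)" "\<lambda>_. 1" nhds_1 "\<lambda>B. det (corner B \<cdot>\<^sub>m 1\<^sub>m n)"]
    by simp
  then show ?thesis by (rule close_along_sym)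
qed

text \<open>If \<open>x\<^sup>2\<close> tends to \<open>1\<close> then \<open>x\<close> is close to \<open>1\<close> or to \<open>- 1\<close>; the latter
  is impossible because the scalar matrix \<open>- 1\<close> has a neighbourhood that is away from the identity.\<close>

lemma corner_descent:
  assumes even: "even n" and IH: "close_along nhds_1 (\<lambda>B. corner B ^ (2 ^ Suc m)) (\<lambda>_. 1)"
  shows "close_along nhds_1 (\<lambda>B. corner B ^ (2 ^ m)) (\<lambda>_. 1)"
  unfolding close_along_iff
proof (intro allI impI)
  fix e :: real assume e: "e > 0"
  define N where "N = diagonal (\<lambda>_. - 1)"
  have NG: "N \<in> carrier G"
    unfolding N_def by (rule diagonal_in_G(1)) (use even in auto)
  have "N $$ (0, 0) \<noteq> 1\<^sub>m n $$ (0, 0)"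
    by (simp add: N_def diagonal_index)
  then have "N \<noteq> 1\<^sub>m n" by metis
  then obtain d U where d: "d > 0" and U: "nbhd U"
    "U \<inter> {B \<in> carrier G. \<forall>i<n. \<forall>j<n. nv (B $$ (i, j) - N $$ (i, j)) < d} = {}"
    using away_ball[OF NG] by (auto simp: away_def)
  \<comment> \<open>A product below \<open>h * h\<close> has a factor below \<open>h\<close>. If it
    is \<open>nv (x - 1)\<close>, the bound \<open>e\<close> finishes; if it is
    \<open>nv (x + 1)\<close>, the bound \<open>d / 2\<close> puts the iterated square within
    \<open>d\<close> of \<open>N\<close>.\<close>
  define h where "h = min e (d / 2)"
  have h: "h > 0" using e d by (simp add: h_def)
  have 1: "\<forall>\<^sub>F B in nhds_1. iterated_square m B \<in> U"
    using eventually_nhds_1_nbhd[OF nbhd_preimage[OF continuous_map_iterated_square iterated_square_one U(1)]]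
    by eventually_elim auto
  have 2: "\<forall>\<^sub>F B in nhds_1. \<forall>i\<in>{..<n}. \<forall>j\<in>{..<n}. nv (iterated_square m B $$ (i, j) - corner B ^ (2 ^ m) * delta i j) < d / 2"
    by (intro eventually_ball_finite ballI finite_lessThan close_along_iterated_square[unfolded close_along_iff, rule_format])
       (use d in auto)
  have 3: "\<forall>\<^sub>F B in nhds_1. nv (corner B ^ (2 ^ Suc m) - 1) < h * h"
    using IH h unfolding close_along_iff by simp
  from 1 2 3 eventually_nhds_1_G
  show "\<forall>\<^sub>F B in nhds_1. nv (corner B ^ (2 ^ m) - 1) < e"
  proof eventually_elim
    case (elim B)
    define x where "x = corner B ^ (2 ^ m)"
    have "corner B ^ (2 ^ Suc m) = x * x"
      by (simp add: x_def mult_2 power_add)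
    then have "corner B ^ (2 ^ Suc m) - 1 = (x - 1) * (x + 1)"
      by (simp only:) (simp add: algebra_simps)
    then have prod: "nv (x - 1) * nv (x + 1) < h * h"
      using elim(3) by (simp add: nv_mult)
    have "nv (x - 1) < h"
    proof (rule ccontr)
      assume "\<not> nv (x - 1) < h"
      then have x1: "nv (x + 1) < h"
        using prod h mult_mono[of h "nv (x - 1)" h "nv (x + 1)"] by (cases "nv (x + 1) < h") auto
      have "nv (iterated_square m B $$ (i, j) - N $$ (i, j)) < d" if ij: "i < n" "j < n" for i j
      proof -
        have e: "iterated_square m B $$ (i, j) - N $$ (i, j) = (iterated_square m B $$ (i, j) - x * delta i j) + (x + 1) * delta i j"
          using ij by (simp add: N_def diagonal_index algebra_simps)
        have "nv (iterated_square m B $$ (i, j) - x * delta i j) < d / 2"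
          using elim(2) ij by (simp add: x_def)
        moreover have "nv ((x + 1) * delta i j) < d / 2"
          using x1 d by (simp add: h_def delta_def)
        ultimately show ?thesis
          unfolding e using nv_triangle[of "iterated_square m B $$ (i, j) - x * delta i j" "(x + 1) * delta i j"] by linarith
      qed
      then have "iterated_square m B \<in> {B \<in> carrier G. \<forall>i<n. \<forall>j<n. nv (B $$ (i, j) - N $$ (i, j)) < d}"
        using iterated_square_in_G[OF elim(4)] by simp
      then show False
        using U(2) elim(1) by blast
    qed
    then show ?case by (simp add: x_def h_def)
  qed
qed

lemma corner_tendsto_1:
  assumes n: "n = 2 ^ k"
  shows "close_along nhds_1 corner (\<lambda>_. 1)"
proof -
  have even: "even n"
    using n n_ge_2 by (cases k) auto
  have "close_along nhds_1 (\<lambda>B. corner B ^ (2 ^ m)) (\<lambda>_. 1)" if "m \<le> k" for m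
    using that
  proof (induction m rule: inc_induct)
    case base
    then show ?case using corner_power_dim by (simp add: n)
  next
    case (step m)
    show ?case by (rule corner_descent[OF even step.IH])
  qed
  from this[of 0] show ?thesis by simp
qed

lemma entry_tendsto:
  assumes n: "n = 2 ^ k" and ij: "i < n" "j < n"
  shows "close_along nhds_1 (\<lambda>B. B $$ (i, j)) (\<lambda>_. delta i j)"
proof -
  have "close_along nhds_1 (\<lambda>B. corner B * delta i j) (\<lambda>_. 1 * delta i j)"
    by (intro close_along_mult corner_tendsto_1[OF n] close_along_refl bounded_along_const)
  then show ?thesis
    using close_along_trans[OF close_along_corner[OF ij]] by simp
qed

lemma T'_eq_TG:
  assumes n: "n = 2 ^ k"
  shows "T' = TG"
proof -
  have "openin T' U" if U: "openin TG U" for U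
  proof (subst openin_subopen, safe)
    fix A assume A: "A \<in> U"
    then have AG: "A \<in> carrier G" using openin_subset[OF U] by auto
    obtain e where e: "e > 0" "\<And>B. B \<in> carrier G \<Longrightarrow> (\<forall>i<n. \<forall>j<n. nv (B $$ (i, j) - A $$ (i, j)) < e) \<Longrightarrow> B \<in> U"
      using openin_TG_imp[OF U A] by blast
    have "close_along nhds_1 (\<lambda>B. \<Sum>k<n. A $$ (i, k) * B $$ (k, j)) (\<lambda>B. \<Sum>k<n. A $$ (i, k) * delta k j)"
      if "i < n" "j < n" for i j
      by (intro close_along_sum close_along_mult close_along_refl entry_tendsto[OF n] bounded_along_const) (use that in auto)
    then have "close_along nhds_1 (\<lambda>B. \<Sum>k<n. A $$ (i, k) * B $$ (k, j)) (\<lambda>B. A $$ (i, j))" if "i < n" "j < n" for i j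
      using that by simp
    then have "\<forall>\<^sub>F B in nhds_1. \<forall>i\<in>{..<n}. \<forall>j\<in>{..<n}. nv ((\<Sum>k<n. A $$ (i, k) * B $$ (k, j)) - A $$ (i, j)) < e"
      using e(1) unfolding close_along_iff by (intro eventually_ball_finite ballI finite_lessThan) auto
    with eventually_nhds_1_G have "\<forall>\<^sub>F B in nhds_1. A * B \<in> U"
    proof eventually_elim
      case (elim B)
      show ?case
      proof (rule e(2)[OF mult_in_G[OF AG elim(1)]], intro allI impI)
        fix i j assume "i < n" "j < n"
        then show "nv ((A * B) $$ (i, j) - A $$ (i, j)) < e"
          using elim(2) index_mat_mult_sum[OF G_dim[OF AG] G_dim[OF elim(1)]] by simp
      qed
    qed
    then obtain V where V: "nbhd V" "\<And>B. B \<in> V \<Longrightarrow> A * B \<in> U"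
      by (auto simp: eventually_nhds_1)
    \<comment> \<open>The translate of \<open>V\<close> by \<open>A\<close>, written as a preimage:
      it carries the estimate from the identity to the point \<open>A\<close>.\<close>
    let ?W = "{B \<in> topspace T'. iv A * B \<in> V}"
    have "continuous_map T' T' (\<lambda>B. iv A * B)"
      using AG by (intro continuous_map_T'_mult) auto
    then have "openin T' ?W"
      using V(1) unfolding nbhd_def continuous_map_def by blast
    moreover have "A \<in> ?W"
      using AG V(1) iv_left[OF AG] by (simp add: nbhd_def)
    moreover have "B \<in> U" if "B \<in> ?W" for B
    proof -
      have B: "B \<in> carrier G" "iv A * B \<in> V" using that by auto
      have "A \<otimes>\<^bsub>G\<^esub> (iv A \<otimes>\<^bsub>G\<^esub> B) = B"
        using AG B(1) by (simp only: G.m_assoc[symmetric] G.inv_closed G.r_inv G.l_one)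
      then show ?thesis using V(2)[OF B(2)] by simp
    qed
    ultimately show "\<exists>W. openin T' W \<and> A \<in> W \<and> W \<subseteq> U" by blast
  qed
  then show ?thesis
    using T'_coarser by (auto simp: topology_eq)
qed

end

lemma (in valued_SL) minimal_power_of_2:
  assumes "n = 2 ^ k"
    and "\<And>R e. e > 0 \<Longrightarrow> \<exists>S. finite S \<and> (\<forall>x\<in>K. nv x \<le> R \<longrightarrow> (\<exists>s\<in>S. nv (x - s) < e))"
    and "\<exists>x\<in>K. nv x > 1"
  shows "minimal_topological_group G TG"
proof (rule minimal_topological_groupI[OF topological_group_TG])
  fix T' assume T': "topological_group G T'" "\<And>U. openin T' U \<Longrightarrow> openin TG U"
  interpret coarser_SL K nv n T'
    by unfold_locales (use assms(2,3) T' in auto)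
  show "T' = TG" by (rule T'_eq_TG[OF assms(1)])
qed

section \<open>The topology induced by tensor powers\<close>

text \<open>The distributive law behind the multiplicativity of Kronecker powers.\<close>

lemma sum_prod_distrib_PiE:
  fixes f g :: "nat \<Rightarrow> nat \<Rightarrow> 'a::comm_ring_1"
  shows "(\<Prod>k<q. \<Sum>l<n. f k l * g l k) =
    (\<Sum>l\<in>{..<q} \<rightarrow>\<^sub>E {..<n}. (\<Prod>k<q. f k (l k)) * (\<Prod>k<q. g (l k) k))"
  by (subst prod_sum_PiE) (simp_all add: prod.distrib)

locale tensor_power_SL = valued_SL +
  fixes q :: nat
  assumes q_pos: "0 < q" and no_roots: "x \<in> K \<Longrightarrow> x ^ q = 1 \<Longrightarrow> x = 1"
begin

text \<open>An entry of the \<open>q\<close>-fold Kronecker power of \<open>A\<close>, with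
  multi-indices for row and column.\<close>

definition tensor_entry :: "(nat \<Rightarrow> nat) \<Rightarrow> (nat \<Rightarrow> nat) \<Rightarrow> 'a mat \<Rightarrow> 'a" where
  "tensor_entry i j A = (\<Prod>k<q. A $$ (i k, j k))"

abbreviation multi_index where "multi_index \<equiv> {..<q} \<rightarrow>\<^sub>E {..<n}"

abbreviation coord_index :: "(bool \<times> (nat \<Rightarrow> nat) \<times> (nat \<Rightarrow> nat)) set" where "coord_index \<equiv> UNIV \<times> multi_index \<times> multi_index"

text \<open>The flag selects \<open>A\<close> or its inverse, so inversion of matrices just flips
  the flag, and its continuity is immediate.\<close>

definition coord :: "bool \<times> (nat \<Rightarrow> nat) \<times> (nat \<Rightarrow> nat) \<Rightarrow> 'a mat \<Rightarrow> 'a" where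
  "coord = (\<lambda>(b, i, j) A. tensor_entry i j (if b then A else iv A))"

definition coords :: "'a mat \<Rightarrow> bool \<times> (nat \<Rightarrow> nat) \<times> (nat \<Rightarrow> nat) \<Rightarrow> 'a" where
  "coords A = (\<lambda>x\<in>coord_index. coord x A)"

definition tensor_topology :: "'a mat topology" where
  "tensor_topology = pullback_topology (carrier G) coords (product_topology (\<lambda>_. T) coord_index)"

lemma multi_index_less: "i \<in> multi_index \<Longrightarrow> k < q \<Longrightarrow> i k < n"
  by (auto simp: PiE_iff)

lemma finite_coord_index: "finite coord_index"
  by (auto intro!: finite_PiE)

lemma tensor_entry_mult:
  assumes "A \<in> carrier G" "B \<in> carrier G" "i \<in> multi_index" "j \<in> multi_index"
  shows "tensor_entry i j (A * B) = (\<Sum>l\<in>multi_index. tensor_entry i l A * tensor_entry l j B)"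
proof -
  have "tensor_entry i j (A * B) = (\<Prod>k<q. \<Sum>l<n. A $$ (i k, l) * B $$ (l, j k))"
    unfolding tensor_entry_def using assms
    by (intro prod.cong index_mat_mult_sum G_dim) (auto simp: multi_index_less)
  also have "\<dots> = (\<Sum>l\<in>multi_index. tensor_entry i l A * tensor_entry l j B)"
    unfolding tensor_entry_def by (rule sum_prod_distrib_PiE)
  finally show ?thesis .
qed

lemma tensor_entry_K: "A \<in> carrier G \<Longrightarrow> i \<in> multi_index \<Longrightarrow> j \<in> multi_index \<Longrightarrow> tensor_entry i j A \<in> K"
  unfolding tensor_entry_def by (intro K_prod G_K) (auto simp: multi_index_less)

lemma coord_K:
  assumes "A \<in> carrier G" "x \<in> coord_index"
  shows "coord x A \<in> K"
proof -
  obtain b i j where x: "x = (b, i, j)" "i \<in> multi_index" "j \<in> multi_index"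
    using assms(2) by (elim SigmaE) blast
  show ?thesis
    using tensor_entry_K[OF assms(1) x(2,3)] tensor_entry_K[OF iv_in_G[OF assms(1)] x(2,3)] by (simp add: x(1) coord_def)
qed

lemma topspace_tensor: "topspace tensor_topology = carrier G"
proof -
  have "coords A \<in> coord_index \<rightarrow>\<^sub>E K" if "A \<in> carrier G" for A
    unfolding coords_def restrict_PiE_iff using coord_K[OF that] by blast
  then show ?thesis
    unfolding tensor_topology_def topspace_pullback_topology by auto
qed

lemma continuous_map_coords: "continuous_map tensor_topology (product_topology (\<lambda>_. T) coord_index) coords"
  using continuous_map_pullback[OF continuous_map_id, where A = "carrier G" and f = coords]
  by (simp add: tensor_topology_def)

lemma continuous_map_coord:
  assumes "x \<in> coord_index"
  shows "continuous_map tensor_topology T (coord x)"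
proof -
  have "continuous_map tensor_topology T ((\<lambda>f. f x) \<circ> coords)"
    by (rule continuous_map_compose[OF continuous_map_coords])
       (rule continuous_map_product_projection[OF assms])
  then show ?thesis
    by (rule continuous_map_eq) (use assms in \<open>simp add: coords_def del: mem_Sigma_iff\<close>)
qed

lemma continuous_map_tensorI:
  assumes "\<And>x. x \<in> topspace X \<Longrightarrow> f x \<in> carrier G"
    and "\<And>y. y \<in> coord_index \<Longrightarrow> continuous_map X T (\<lambda>x. coord y (f x))"
  shows "continuous_map X tensor_topology f"
  unfolding tensor_topology_def
proof (rule continuous_map_pullback')
  show "continuous_map X (product_topology (\<lambda>_. T) coord_index) (coords \<circ> f)"
    unfolding continuous_map_componentwise
    using assms(2) by (auto simp: coords_def o_def simp del: mem_Sigma_iff)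
qed (use assms(1) in auto)

text \<open>Fix a nonzero entry of \<open>A\<close> at \<open>(r, s)\<close>. Tensor entries with
  one factor at \<open>(u, v)\<close> and the others at \<open>(r, s)\<close> show first that
  \<open>A\<close> and \<open>B\<close> have the same \<open>q\<close>-th power at
  \<open>(r, s)\<close>, so the same entry there by \<open>no_roots\<close>; cancelling it gives
  equality at every \<open>(u, v)\<close>.\<close>

lemma coords_inj: "inj_on coords (carrier G)"
proof (rule inj_onI)
  fix A B assume AB: "A \<in> carrier G" "B \<in> carrier G" "coords A = coords B"
  have eq: "tensor_entry i j A = tensor_entry i j B" if "i \<in> multi_index" "j \<in> multi_index" for i j
    using fun_cong[OF AB(3), of "(True, i, j)"] that by (simp add: coords_def coord_def)
  obtain r s where rs: "r < n" "s < n" "A $$ (r, s) \<noteq> 0"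
  proof (rule ccontr)
    assume "\<not> thesis"
    then have "A $$ (r, s) = 0" if "r < n" "s < n" for r s
      using that \<open>\<And>s r. r < n \<Longrightarrow> s < n \<Longrightarrow> A $$ (r, s) \<noteq> 0 \<Longrightarrow> thesis\<close> by blast
    then have "A = 0\<^sub>m n n"
      using G_dim[OF AB(1)] by (intro eq_matI) auto
    then show False using G_det[OF AB(1)] by simp
  qed
  obtain q' where q': "q = Suc q'" using q_pos by (cases q) auto
  have *: "A $$ (u, v) * A $$ (r, s) ^ q' = B $$ (u, v) * B $$ (r, s) ^ q'" if uv: "u < n" "v < n" for u v
  proof -
    let ?i = "\<lambda>k\<in>{..<q}. if k = 0 then u else r" and ?j = "\<lambda>k\<in>{..<q}. if k = 0 then v else s"
    have "tensor_entry ?i ?j C = C $$ (u, v) * C $$ (r, s) ^ q'" for C :: "'a mat"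
    proof -
      have "tensor_entry ?i ?j C = (\<Prod>k<q. if k = 0 then C $$ (u, v) else C $$ (r, s))"
        unfolding tensor_entry_def by (rule prod.cong) auto
      then show ?thesis
        unfolding q' prod.lessThan_Suc_shift by simp
    qed
    moreover have "?i \<in> multi_index" "?j \<in> multi_index" using uv rs by auto
    ultimately show ?thesis using eq[of ?i ?j] by simp
  qed
  have rq: "A $$ (r, s) ^ q = B $$ (r, s) ^ q"
    using *[OF rs(1,2)] by (simp add: q')
  then have "B $$ (r, s) \<noteq> 0" using rs(3) q_pos by (auto simp: power_0_left)
  then have "(A $$ (r, s) / B $$ (r, s)) ^ q = 1"
    using rq by (simp add: power_divide)
  moreover have "A $$ (r, s) / B $$ (r, s) \<in> K"
    using G_K AB rs by auto
  ultimately have "A $$ (r, s) / B $$ (r, s) = 1"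
    by (rule no_roots[rotated])
  then have rs': "A $$ (r, s) = B $$ (r, s)" by simp
  have "A $$ (u, v) = B $$ (u, v)" if "u < n" "v < n" for u v
    using *[OF that] rs(3) unfolding rs' by simp
  then show "A = B"
    using G_dim[OF AB(1)] G_dim[OF AB(2)] by (intro eq_matI) auto
qed

lemma topological_group_tensor: "topological_group G tensor_topology"
  unfolding topological_group_def
proof (intro conjI)
  show "Hausdorff_space tensor_topology"
    by (rule Hausdorff_space_injective_preimage[OF _ continuous_map_coords])
       (use coords_inj in \<open>simp_all add: topspace_tensor Hausdorff_space_product_topology Hausdorff_T\<close>)
  have mem: "continuous_map (prod_topology tensor_topology tensor_topology) T (\<lambda>z. coord x (fst z))"
     "continuous_map (prod_topology tensor_topology tensor_topology) T (\<lambda>z. coord x (snd z))" if "x \<in> coord_index" for x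
    using continuous_map_compose[OF _ continuous_map_coord[OF that], of "prod_topology tensor_topology tensor_topology" fst]
      continuous_map_compose[OF _ continuous_map_coord[OF that], of "prod_topology tensor_topology tensor_topology" snd]
    by (simp_all add: o_def continuous_map_fst continuous_map_snd)
  show "continuous_map (prod_topology tensor_topology tensor_topology) tensor_topology (\<lambda>(x, y). x \<otimes>\<^bsub>G\<^esub> y)"
  proof (rule continuous_map_tensorI)
    fix x :: "bool \<times> (nat \<Rightarrow> nat) \<times> (nat \<Rightarrow> nat)" assume "x \<in> coord_index"
    then obtain b i j where x: "x = (b, i, j)" "i \<in> multi_index" "j \<in> multi_index" by auto
    show "continuous_map (prod_topology tensor_topology tensor_topology) T (\<lambda>z. coord x (case z of (x, y) \<Rightarrow> x \<otimes>\<^bsub>G\<^esub> y))"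
    proof (cases b)
      case True
      have "continuous_map (prod_topology tensor_topology tensor_topology) T
          (\<lambda>z. \<Sum>l\<in>multi_index. coord (True, i, l) (fst z) * coord (True, l, j) (snd z))"
        by (intro continuous_map_T_sum continuous_map_T_mult mem) (use x in auto)
      then show ?thesis
      proof (rule continuous_map_eq)
        fix z assume "z \<in> topspace (prod_topology tensor_topology tensor_topology)"
        then obtain A B where z: "z = (A, B)" "A \<in> carrier G" "B \<in> carrier G"
          by (auto simp: topspace_tensor)
        show "(\<Sum>l\<in>multi_index. coord (True, i, l) (fst z) * coord (True, l, j) (snd z)) =
            coord x (case z of (x, y) \<Rightarrow> x \<otimes>\<^bsub>G\<^esub> y)"
          using tensor_entry_mult[OF z(2,3) x(2,3)] by (simp add: z(1) x(1) True coord_def)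
      qed
    next
      case False
      have iv: "iv (A * B) = iv B * iv A" if "A \<in> carrier G" "B \<in> carrier G" for A B
        using G.inv_mult_group[OF that] by simp
      have "continuous_map (prod_topology tensor_topology tensor_topology) T
          (\<lambda>z. \<Sum>l\<in>multi_index. coord (False, i, l) (snd z) * coord (False, l, j) (fst z))"
        by (intro continuous_map_T_sum continuous_map_T_mult mem) (use x in auto)
      then show ?thesis
      proof (rule continuous_map_eq)
        fix z assume "z \<in> topspace (prod_topology tensor_topology tensor_topology)"
        then obtain A B where z: "z = (A, B)" "A \<in> carrier G" "B \<in> carrier G"
          by (auto simp: topspace_tensor)
        show "(\<Sum>l\<in>multi_index. coord (False, i, l) (snd z) * coord (False, l, j) (fst z)) =
            coord x (case z of (x, y) \<Rightarrow> x \<otimes>\<^bsub>G\<^esub> y)"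
          using tensor_entry_mult[OF iv_in_G[OF z(3)] iv_in_G[OF z(2)] x(2,3)]
          by (simp add: z(1) x(1) False coord_def iv[OF z(2,3)])
      qed
    qed
  qed (auto simp: topspace_tensor mult_in_G)
  show "continuous_map tensor_topology tensor_topology (m_inv G)"
  proof (rule continuous_map_tensorI)
    fix x :: "bool \<times> (nat \<Rightarrow> nat) \<times> (nat \<Rightarrow> nat)" assume "x \<in> coord_index"
    then obtain b i j where x: "x = (b, i, j)" "i \<in> multi_index" "j \<in> multi_index" by auto
    then have "(\<not> b, i, j) \<in> coord_index" by auto
    from continuous_map_coord[OF this]
    show "continuous_map tensor_topology T (\<lambda>A. coord x (iv A))"
      by (rule continuous_map_eq) (auto simp: topspace_tensor coord_def x)
  qed (auto simp: topspace_tensor)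
qed (simp_all add: group_G topspace_tensor)

lemma tensor_topology_coarser:
  assumes "openin tensor_topology U"
  shows "openin TG U"
proof -
  have "continuous_map TG tensor_topology (\<lambda>A. A)"
  proof (rule continuous_map_tensorI)
    fix x :: "bool \<times> (nat \<Rightarrow> nat) \<times> (nat \<Rightarrow> nat)" assume "x \<in> coord_index"
    then obtain b i j where x: "x = (b, i, j)" "i \<in> multi_index" "j \<in> multi_index" by auto
    have "continuous_map TG TG (m_inv G)"
      using topological_group_TG by (simp add: topological_group_def)
    then have "continuous_map TG T (\<lambda>A. (if b then A else iv A) $$ (i k, j k))" if "k < q" for k
      using x that continuous_map_entry[of "i k" "j k"] multi_index_less
      by (cases b) (auto simp: continuous_map_TG_iff)
    then show "continuous_map TG T (coord x)"
      unfolding x coord_def tensor_entry_def by (auto intro!: continuous_map_T_prod)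
  qed auto
  then have "openin TG {A \<in> topspace TG. A \<in> U}"
    using assms unfolding continuous_map_def by blast
  moreover have "{A \<in> topspace TG. A \<in> U} = U"
    using openin_subset[OF assms] by (auto simp: topspace_tensor)
  ultimately show ?thesis by simp
qed

lemma eventually_in_tensor_nbhd:
  assumes U: "openin tensor_topology U" "1\<^sub>m n \<in> U"
    and A: "\<forall>\<^sub>F k in F. A k \<in> carrier G"
    and lim: "\<And>x. x \<in> coord_index \<Longrightarrow> close_along F (\<lambda>k. coord x (A k)) (\<lambda>_. coord x (1\<^sub>m n))"
  shows "\<forall>\<^sub>F k in F. A k \<in> U"
proof -
  obtain V where V: "openin (product_topology (\<lambda>_. T) coord_index) V" "U = coords -` V \<inter> carrier G"
    using U by (auto simp: tensor_topology_def openin_pullback_topology)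
  then have "coords (1\<^sub>m n) \<in> V" using U by auto
  have "\<exists>W. finite {i \<in> coord_index. W i \<noteq> topspace T} \<and> (\<forall>i\<in>coord_index. openin T (W i)) \<and> coords (1\<^sub>m n) \<in> Pi\<^sub>E coord_index W \<and> Pi\<^sub>E coord_index W \<subseteq> V"
    by (rule V(1)[unfolded openin_product_topology_alt, rule_format]) fact
  then obtain W where W: "\<And>x. x \<in> coord_index \<Longrightarrow> openin T (W x)" "coords (1\<^sub>m n) \<in> Pi\<^sub>E coord_index W" "Pi\<^sub>E coord_index W \<subseteq> V"
    by (elim exE conjE) (rule that, auto)
  have "\<forall>\<^sub>F k in F. \<forall>x\<in>coord_index. coord x (A k) \<in> W x"
  proof (intro eventually_ball_finite finite_coord_index ballI)
    fix x assume x: "x \<in> coord_index"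
    have "coord x (1\<^sub>m n) \<in> W x"
      using PiE_mem[OF W(2) x] x by (simp add: coords_def del: mem_Sigma_iff)
    then obtain e where e: "e > 0" "\<And>y. y \<in> K \<Longrightarrow> nv (y - coord x (1\<^sub>m n)) < e \<Longrightarrow> y \<in> W x"
      using openin_T_imp[OF W(1)[OF x]] by metis
    have "\<forall>\<^sub>F k in F. nv (coord x (A k) - coord x (1\<^sub>m n)) < e"
      using lim[OF x] e(1) unfolding close_along_iff by blast
    with A show "\<forall>\<^sub>F k in F. coord x (A k) \<in> W x"
      by eventually_elim (use e(2) coord_K x in blast)
  qed
  with A show ?thesis
  proof eventually_elim
    case (elim k)
    have "coords (A k) \<in> Pi\<^sub>E coord_index W"
    proof (rule PiE_I)
      fix x assume x: "x \<in> coord_index"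
      then have "coords (A k) x = coord x (A k)"
        by (simp add: coords_def del: mem_Sigma_iff)
      then show "coords (A k) x \<in> W x"
        using bspec[OF elim(2) x] by simp
    qed (simp add: coords_def del: mem_Sigma_iff)
    then have "coords (A k) \<in> V" using W(3) by blast
    then show ?case using V(2) elim(1) by simp
  qed
qed

lemma not_minimal:
  assumes q: "q dvd n"
    and c: "\<And>k. c k \<in> K" "close_along sequentially (\<lambda>k. c k ^ q) (\<lambda>_. 1)"
    and d: "d > 0" "\<And>k. nv (c k - 1) \<ge> d"
  shows "\<not> minimal_topological_group G TG"
proof
  assume "minimal_topological_group G TG"
  then have eq: "tensor_topology = TG"
    by (rule minimal_topological_group_coarser) (fact topological_group_tensor, fact tensor_topology_coarser)
  obtain m where m: "n = q * m" using q by auto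
  \<comment> \<open>Splits the diagonal matrix into the scalar \<open>c k\<close> and a correction
    of the last entry that restores determinant 1. As \<open>q\<close> divides \<open>n\<close>, the
    correction involves only \<open>c k ^ q\<close> and tends to 1.\<close>
  define E where "E k r = (if r = n - 1 then inverse ((c k ^ q) ^ m) else 1)" for k r
  define D where "D k r = c k * E k r" for k r
  have Em: "close_along sequentially (\<lambda>k. (c k ^ q) ^ m) (\<lambda>_. 1)"
    using close_along_power[OF c(2), of m] by simp
  have E: "close_along sequentially (\<lambda>k. E k r) (\<lambda>_. 1)" for r
    using close_along_inverse_1[OF Em] by (cases "r = n - 1") (simp_all add: E_def)
  have nz: "\<forall>\<^sub>F k in sequentially. c k \<noteq> 0"
  proof -
    have "\<forall>\<^sub>F k in sequentially. nv (c k ^ q - 1) < 1"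
      using c(2) unfolding close_along_iff by simp
    then show ?thesis
      by eventually_elim (use q_pos in \<open>auto simp: power_0_left\<close>)
  qed
  have DG: "diagonal (D k) \<in> carrier G" "iv (diagonal (D k)) = diagonal (\<lambda>r. inverse (c k) * inverse (E k r))"
    if "c k \<noteq> 0" for k
  proof -
    have "(\<Prod>r<n. D k r) = c k ^ n * (\<Prod>r<n. E k r)"
      by (simp add: D_def prod.distrib)
    also have "(\<Prod>r<n. E k r) = inverse ((c k ^ q) ^ m)"
      unfolding E_def using n_pos by (subst prod.delta) auto
    also have "c k ^ n * inverse ((c k ^ q) ^ m) = 1"
      using that by (simp add: m flip: power_mult)
    finally have 1: "(\<Prod>r<n. D k r) = 1" .
    have 2: "D k r \<in> K" for r
      using c(1) by (auto simp: D_def E_def)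
    have "(\<lambda>r. inverse (D k r)) = (\<lambda>r. inverse (c k) * inverse (E k r))"
      by (simp add: D_def)
    then show "diagonal (D k) \<in> carrier G" "iv (diagonal (D k)) = diagonal (\<lambda>r. inverse (c k) * inverse (E k r))"
      using diagonal_in_G[OF 2 1] by simp_all
  qed
  have lim: "close_along sequentially (\<lambda>k. coord x (diagonal (D k))) (\<lambda>_. coord x (1\<^sub>m n))" if "x \<in> coord_index" for x
  proof -
    obtain b i j where x: "x = (b, i, j)" "i \<in> multi_index" "j \<in> multi_index" using \<open>x \<in> coord_index\<close> by auto
    note less = multi_index_less[OF x(2)] multi_index_less[OF x(3)]
    have "coord x (1\<^sub>m n) = (\<Prod>k<q. delta (i k) (j k))"
      using less G.inv_one by (auto simp: x coord_def tensor_entry_def delta_def intro!: prod.cong)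
    \<comment> \<open>Each coordinate is \<open>c k ^ q\<close> or its inverse times factors that
      tend to Kronecker deltas: the tensor power sees \<open>c k\<close> only through its
      \<open>q\<close>-th power.\<close>
    moreover have "\<exists>f g. close_along sequentially f (\<lambda>_. 1) \<and> (\<forall>r. close_along sequentially (\<lambda>k. g k r) (\<lambda>_. 1)) \<and>
      (\<forall>\<^sub>F k in sequentially. coord x (diagonal (D k)) = f k * (\<Prod>l<q. g k (i l) * delta (i l) (j l)))"
    proof (cases b)
      case True
      have "coord x (diagonal (D k)) = c k ^ q * (\<Prod>l<q. E k (i l) * delta (i l) (j l))" for k
        using less by (simp add: x True coord_def tensor_entry_def diagonal_index D_def prod.distrib mult_ac)
      then show ?thesis
        using c(2) E by (intro exI[of _ "\<lambda>k. c k ^ q"] exI[of _ E]) auto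
    next
      case False
      from nz have "\<forall>\<^sub>F k in sequentially. coord x (diagonal (D k)) =
        inverse (c k ^ q) * (\<Prod>l<q. inverse (E k (i l)) * delta (i l) (j l))"
      proof eventually_elim
        case (elim k)
        then show ?case
          using less by (simp add: x False coord_def tensor_entry_def diagonal_index DG prod.distrib mult_ac power_inverse)
      qed
      then show ?thesis
        using close_along_inverse_1[OF c(2)] close_along_inverse_1[OF E]
        by (intro exI[of _ "\<lambda>k. inverse (c k ^ q)"] exI[of _ "\<lambda>k r. inverse (E k r)"]) auto
    qed
    then obtain f g where fg: "close_along sequentially f (\<lambda>_. 1)" "\<And>r. close_along sequentially (\<lambda>k. g k r) (\<lambda>_. 1)"
      "\<forall>\<^sub>F k in sequentially. coord x (diagonal (D k)) = f k * (\<Prod>l<q. g k (i l) * delta (i l) (j l))"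
      by blast
    have "close_along sequentially (\<lambda>k. f k * (\<Prod>l<q. g k (i l) * delta (i l) (j l)))
       (\<lambda>_. 1 * (\<Prod>l<q. 1 * delta (i l) (j l)))"
      by (intro close_along_mult close_along_prod fg close_along_refl bounded_along_const)
    ultimately show ?thesis
      using close_along_cong_left[OF fg(3), of "\<lambda>_. coord x (1\<^sub>m n)"] by simp
  qed
  let ?U = "{B \<in> carrier G. \<forall>i<n. \<forall>j<n. nv (B $$ (i, j) - 1\<^sub>m n $$ (i, j)) < d}"
  have "openin tensor_topology ?U"
    unfolding eq by (rule openin_TG_ball[OF one_in_G])
  moreover have "1\<^sub>m n \<in> ?U"
    using d(1) one_in_G by simp
  moreover have "\<forall>\<^sub>F k in sequentially. diagonal (D k) \<in> carrier G"
    using nz by eventually_elim (rule DG)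
  ultimately have "\<forall>\<^sub>F k in sequentially. diagonal (D k) \<in> ?U"
    by (rule eventually_in_tensor_nbhd) (rule lim)
  then obtain k where "diagonal (D k) \<in> ?U"
    using eventually_happens'[OF sequentially_bot] by blast
  then have "\<forall>i<n. \<forall>j<n. nv (diagonal (D k) $$ (i, j) - 1\<^sub>m n $$ (i, j)) < d"
    by simp
  \<comment> \<open>Position 0 is not the corrected position \<open>n - 1\<close>, so this entry is
    \<open>c k\<close> itself, which stays at distance \<open>d\<close> from 1.\<close>
  then have "nv (diagonal (D k) $$ (0, 0) - 1\<^sub>m n $$ (0, 0)) < d"
    using n_pos by blast
  then show False
    using d(2)[of k] n_ge_2 by (simp add: diagonal_index D_def E_def)
qed

end

section \<open>Fermat primes\<close>

lemma nat_eq_power_2_mult_odd: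
  assumes "k > 0"
  obtains j d :: nat where "k = 2 ^ j * d" "odd d"
proof -
  obtain d where "k = 2 ^ multiplicity 2 k * d" "\<not> 2 dvd d"
    using multiplicity_decompose'[of k 2] assms by auto
  then show ?thesis by (rule that)
qed

lemma power_plus_1_dvd:
  fixes x d :: nat
  assumes "odd d"
  shows "x + 1 dvd x ^ d + 1"
proof -
  obtain d' where d': "d = Suc d'" using assms by (cases d) auto
  have "int x - (- 1) dvd int x ^ d - (- 1) ^ d"
    unfolding d' diff_power_eq_sum by simp
  then have "int (x + 1) dvd int (x ^ d + 1)"
    using assms by (simp add: add.commute)
  then show ?thesis by (simp only: int_dvd_int_iff)
qed

text \<open>Let \<open>d\<close> be the odd part of the exponent \<open>k\<close>: then
  \<open>2 ^ (2 ^ j) + 1\<close> divides \<open>2 ^ k + 1 = p\<close>, and primality makes them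
  equal.\<close>

lemma fermat_prime_iff_power_of_2:
  assumes p: "Factorial_Ring.prime p" and odd: "odd p"
  shows "fermat_prime p \<longleftrightarrow> (\<exists>k. p - 1 = 2 ^ k)"
proof
  assume "fermat_prime p"
  then show "\<exists>k. p - 1 = 2 ^ k" by (auto simp: fermat_prime_def)
next
  assume "\<exists>k. p - 1 = 2 ^ k"
  then obtain k where k: "p - 1 = 2 ^ k" by blast
  have "p > 1" using prime_gt_1_nat[OF p] .
  then have pk: "p = 2 ^ k + 1" using k by simp
  then have "k > 0" using odd by (cases k) auto
  then obtain j d where jd: "k = 2 ^ j * d" "odd d"
    by (rule nat_eq_power_2_mult_odd)
  have "2 ^ (2 ^ j) + 1 dvd p"
    using power_plus_1_dvd[OF jd(2), of "2 ^ (2 ^ j)"] by (simp add: pk jd(1) power_mult)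
  then have "2 ^ (2 ^ j) + 1 = p"
    using p by (auto simp: prime_nat_iff)
  then show "fermat_prime p"
    using p by (auto simp: fermat_prime_def intro!: exI[of _ j])
qed

lemma not_power_of_2_odd_prime_dvd:
  fixes n :: nat
  assumes "n > 0" "\<nexists>k. n = 2 ^ k"
  obtains q where "Factorial_Ring.prime q" "odd q" "q dvd n"
proof -
  obtain j d where jd: "n = 2 ^ j * d" "odd d"
    using assms(1) by (rule nat_eq_power_2_mult_odd)
  have "d \<noteq> 1" using assms(2) jd by auto
  then obtain q where q: "Factorial_Ring.prime q" "q dvd d"
    using prime_factor_nat by blast
  then have "odd q" using jd(2) by auto
  with q show ?thesis using that[of q] jd(1) by auto
qed

section \<open>The p-adic absolute value\<close>

context
  fixes p :: nat
  assumes p: "Factorial_Ring.prime p"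
begin

lemma padic_abs_0: "padic_abs p 0 = 0"
  by (simp add: padic_abs_def)

lemma real_p_gt_1: "real p > 1"
  using prime_gt_1_nat[OF p] by simp

lemma padic_abs_divide_int:
  assumes "a \<noteq> 0" "b \<noteq> 0"
  shows "padic_abs p (of_int a / of_int b) =
    real p powi (int (multiplicity (int p) b) - int (multiplicity (int p) a))"
  using padic_val_of_int_divide[OF p assms] assms by (simp add: padic_abs_def)

lemma rat_quotient_cases:
  fixes x :: rat
  obtains a b :: int where "x = of_int a / of_int b" "b \<noteq> 0" "coprime a b"
proof -
  obtain a b where q: "quotient_of x = (a, b)" by fastforce
  show ?thesis
    using that[of a b] quotient_of_div[OF q] quotient_of_denom_pos[OF q] quotient_of_coprime[OF q] by simp
qed

lemma padic_abs_mult: "padic_abs p (x * y) = padic_abs p x * padic_abs p y"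
proof (cases "x = 0 \<or> y = 0")
  case False
  obtain a b where ab: "x = of_int a / of_int b" "b \<noteq> 0" by (rule rat_quotient_cases)
  obtain c d where cd: "y = of_int c / of_int d" "d \<noteq> 0" by (rule rat_quotient_cases)
  have nz: "a \<noteq> 0" "c \<noteq> 0" using False ab cd by auto
  have pe: "prime_elem (int p)" using p by simp
  have "x * y = of_int (a * c) / of_int (b * d)"
    by (simp add: ab cd)
  then have "padic_abs p (x * y) = real p powi
      ((int (multiplicity (int p) b) - int (multiplicity (int p) a)) +
       (int (multiplicity (int p) d) - int (multiplicity (int p) c)))"
    using nz ab cd padic_abs_divide_int[of "a * c" "b * d"]
    by (simp add: prime_elem_multiplicity_mult_distrib[OF pe] algebra_simps)
  also have "\<dots> = padic_abs p x * padic_abs p y"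
    unfolding ab(1) cd(1) using nz ab cd real_p_gt_1
    by (simp add: padic_abs_divide_int power_int_add)
  finally show ?thesis .
qed (auto simp: padic_abs_0)

interpretation padic: valued_subfield UNIV "padic_abs p"
proof
  interpret Metric_space UNIV "\<lambda>x y. padic_abs p (x - y)"
    by (rule Metric_space_padic[OF p])
  show "padic_abs p x = 0 \<longleftrightarrow> x = 0" for x
    using zero[of x 0] by simp
  show "padic_abs p (x + y) \<le> padic_abs p x + padic_abs p y" for x y
    using triangle[of x 0 "- y"] by simp
qed (auto simp: padic_abs_nonneg padic_abs_mult)

lemma padic_T: "valued_subfield.T UNIV (padic_abs p) = padic_topology p"
  by (simp add: padic.T_def padic_topology_def)

lemma padic_abs_of_int_le_1: "padic_abs p (of_int a) \<le> 1"
proof (cases "a = 0")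
  case False
  then have "padic_abs p (of_int a) = real p powi (- int (multiplicity (int p) a))"
    using padic_abs_divide_int[of a 1] by simp
  also have "\<dots> = inverse (real p ^ multiplicity (int p) a)"
    by (simp add: power_int_minus)
  also have "\<dots> \<le> 1"
    using real_p_gt_1 by (simp add: inverse_le_1_iff)
  finally show ?thesis .
qed (simp add: padic_abs_0)

lemma padic_abs_of_int_eq_1:
  assumes "\<not> int p dvd a"
  shows "padic_abs p (of_int a) = 1"
proof -
  have "a \<noteq> 0" using assms by auto
  then show ?thesis
    using padic_abs_divide_int[of a 1] assms by (simp add: not_dvd_imp_multiplicity_0)
qed

lemma padic_abs_p: "padic_abs p (of_nat p) = inverse (real p)"
proof -
  have "multiplicity (int p) (int p) = 1"
    using p by simp
  then show ?thesis
    using padic_abs_divide_int[of "int p" 1] real_p_gt_1 by (simp add: power_int_minus)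
qed

lemma padic_abs_p_power: "padic_abs p (of_nat p ^ N) = inverse (real p ^ N)"
  by (simp add: padic.nv_power padic_abs_p power_inverse)

lemma padic_abs_dvd_le:
  assumes "int p ^ N dvd a"
  shows "padic_abs p (of_int a) \<le> inverse (real p ^ N)"
proof -
  obtain b where "a = int p ^ N * b" using assms by auto
  then have "padic_abs p (of_int a) = inverse (real p ^ N) * padic_abs p (of_int b)"
    by (simp add: padic_abs_mult padic_abs_p_power)
  also have "\<dots> \<le> inverse (real p ^ N) * 1"
    using padic_abs_of_int_le_1 real_p_gt_1 by (intro mult_left_mono) auto
  finally show ?thesis by simp
qed

text \<open>In lowest terms the denominator is prime to \<open>p\<close>, hence invertible modulo
  \<open>p ^ N\<close>; the numerator times that inverse, reduced, is the approximating
  integer.\<close>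

lemma padic_integer_approx:
  assumes "padic_abs p y \<le> 1"
  shows "\<exists>r\<in>{0..<int p ^ N}. padic_abs p (y - of_int r) \<le> inverse (real p ^ N)"
proof -
  have P: "int p ^ N > 0" using prime_gt_0_nat[OF p] by simp
  obtain a b where ab: "y = of_int a / of_int b" "b \<noteq> 0" "coprime a b"
    by (rule rat_quotient_cases)
  have pb: "\<not> int p dvd b"
  proof
    assume pb: "int p dvd b"
    have pu: "\<not> is_unit (int p)" using p by auto
    then have pa: "\<not> int p dvd a"
      using ab(3) pb by (meson coprime_common_divisor)
    then have "a \<noteq> 0" by auto
    have "multiplicity (int p) b > 0"
      using pb ab(2) p by (simp add: prime_multiplicity_gt_zero_iff)
    then have "real p powi (int (multiplicity (int p) b)) > 1"
      using real_p_gt_1 by (simp add: one_less_power)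
    then show False
      using assms ab padic_abs_divide_int[OF \<open>a \<noteq> 0\<close> ab(2)] pa
      by (simp add: not_dvd_imp_multiplicity_0)
  qed
  then have "coprime (int p) b"
    using p by (simp add: prime_imp_coprime)
  then have "coprime b (int p ^ N)"
    by (simp add: coprime_commute)
  then obtain x where x: "[b * x = 1] (mod int p ^ N)"
    using cong_solve_coprime_int by blast
  define r where "r = (a * x) mod int p ^ N"
  have "[b * r = b * (a * x)] (mod int p ^ N)"
    unfolding r_def by (intro cong_mult cong_refl) (simp add: cong_def)
  also have "b * (a * x) = a * (b * x)" by (simp add: mult_ac)
  also have "[a * (b * x) = a * 1] (mod int p ^ N)"
    by (intro cong_mult cong_refl x)
  finally have "[a = b * r] (mod int p ^ N)"
    by (simp add: cong_sym_eq)
  then have dvd: "int p ^ N dvd a - b * r"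
    by (simp add: cong_iff_dvd_diff)
  have "y - of_int r = of_int (a - b * r) / of_int b"
    using ab by (simp add: field_simps)
  then have "padic_abs p (y - of_int r) = padic_abs p (of_int (a - b * r))"
    using padic_abs_of_int_eq_1[OF pb] by (simp only: padic.nv_divide div_by_1)
  then have "padic_abs p (y - of_int r) \<le> inverse (real p ^ N)"
    using padic_abs_dvd_le[OF dvd] by simp
  moreover have "r \<in> {0..<int p ^ N}"
    using P by (simp add: r_def)
  ultimately show ?thesis by blast
qed

text \<open>Multiplication by \<open>p ^ m\<close> moves the ball of radius \<open>R\<close> into
  the unit ball, where residues modulo \<open>p ^ (m + k)\<close> approximate. Dividing again loses
  the factor \<open>p ^ m\<close> in precision, which leaves an error below
  \<open>e\<close>.\<close>

lemma padic_totally_bounded: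
  assumes "e > 0"
  shows "\<exists>S. finite S \<and> (\<forall>x\<in>UNIV. padic_abs p x \<le> R \<longrightarrow> (\<exists>s\<in>S. padic_abs p (x - s) < e))"
proof -
  obtain m where m: "R < real p ^ m" using real_arch_pow[OF real_p_gt_1] by blast
  obtain k where k: "inverse e < real p ^ k" using real_arch_pow[OF real_p_gt_1] by blast
  have pk: "inverse (real p ^ k) < e"
    using k assms real_p_gt_1 by (simp add: field_simps)
  let ?P = "of_nat p ^ m :: rat"
  have P0: "?P \<noteq> 0" using real_p_gt_1 by auto
  let ?S = "(\<lambda>r. of_int r / ?P) ` {0..<int p ^ (m + k)}"
  have "\<exists>s\<in>?S. padic_abs p (x - s) < e" if x: "padic_abs p x \<le> R" for x
  proof -
    have "padic_abs p (?P * x) = inverse (real p ^ m) * padic_abs p x"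
      by (simp add: padic_abs_mult padic_abs_p_power)
    also have "\<dots> \<le> inverse (real p ^ m) * real p ^ m"
      using x m real_p_gt_1 by (intro mult_left_mono) auto
    also have "\<dots> = 1" using real_p_gt_1 by simp
    finally obtain r where r: "r \<in> {0..<int p ^ (m + k)}"
      "padic_abs p (?P * x - of_int r) \<le> inverse (real p ^ (m + k))"
      using padic_integer_approx by blast
    have "x - of_int r / ?P = (?P * x - of_int r) / ?P"
      using P0 by (simp add: field_simps)
    then have "padic_abs p (x - of_int r / ?P) = padic_abs p (?P * x - of_int r) * real p ^ m"
      by (simp only: padic.nv_divide padic_abs_p_power) (simp add: divide_inverse)
    also have "\<dots> \<le> inverse (real p ^ (m + k)) * real p ^ m"
      using r(2) real_p_gt_1 by (intro mult_right_mono) auto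
    also have "\<dots> = inverse (real p ^ k)"
      using real_p_gt_1 by (simp add: power_add)
    also have "\<dots> < e" by (rule pk)
    finally show ?thesis using r(1) by blast
  qed
  then show ?thesis by (intro exI[of _ ?S]) auto
qed

lemma padic_nontrivial: "\<exists>x\<in>UNIV. padic_abs p x > 1"
  using padic.nv_inverse[of "of_nat p"] padic_abs_p real_p_gt_1 by (intro bexI[of _ "inverse (of_nat p)"]) auto

lemma padic_minimal:
  assumes "n \<ge> 2" "n = 2 ^ k"
  shows "minimal_topological_group (SL n (padic_topology p)) (SL_topology n (padic_topology p))"
proof -
  interpret valued_SL UNIV "padic_abs p" n
    by unfold_locales (rule assms(1))
  show ?thesis
    using minimal_power_of_2[OF assms(2) padic_totally_bounded padic_nontrivial]
    by (simp only: padic_T)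
qed

text \<open>Powers of a primitive root modulo \<open>p\<close> approximate a primitive \<open>q\<close>-th root of unity in
  the \<open>p\<close>-adic integers.\<close>

lemma padic_approximate_root:
  assumes q: "Factorial_Ring.prime q" "q dvd p - 1"
  shows "\<exists>c :: rat. padic_abs p (c ^ q - 1) \<le> inverse (real p ^ Suc k) \<and> padic_abs p (c - 1) = 1"
proof -
  have p1: "p > 1" using prime_gt_1_nat[OF p] .
  obtain a where a: "residue_primroot p a"
    using prime_primitive_root_exists[OF p1 p] by blast
  then have cop: "coprime a p" and ord: "ord p a = p - 1"
    using p by (auto simp: residue_primroot_def totient_prime coprime_commute)
  obtain t where t: "p - 1 = q * t" using q(2) by auto
  have t0: "t > 0" using t p1 by (cases t) auto
  \<comment> \<open>\<open>b ^ q\<close> is \<open>a\<close> to the totient of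
    \<open>p ^ Suc k\<close>, so Euler's theorem applies. Modulo \<open>p\<close>, however,
    \<open>b\<close> is not 1: the order \<open>q * t\<close> of \<open>a\<close> would divide
    \<open>p ^ k * t\<close>, which forces \<open>q = p\<close> although \<open>q\<close> divides
    \<open>p - 1\<close>.\<close>
  define b where "b = a ^ (p ^ k * t)"
  have "b ^ q = a ^ (p ^ k * (q * t))"
    by (simp add: b_def mult_ac flip: power_mult)
  also have "p ^ k * (q * t) = totient (p ^ Suc k)"
    by (simp only: totient_prime_power_Suc[OF p] t)
  finally have "b ^ q = a ^ totient (p ^ Suc k)" .
  moreover have "coprime a (p ^ Suc k)" using cop by simp
  ultimately have "[b ^ q = 1] (mod p ^ Suc k)"
    using euler_theorem by simp
  then have "[int (b ^ q) = int 1] (mod int (p ^ Suc k))"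
    by (simp only: cong_int_iff)
  then have dvd: "int p ^ Suc k dvd int b ^ q - 1"
    by (simp add: cong_iff_dvd_diff)
  have "\<not> [b = 1] (mod p)"
  proof
    assume "[b = 1] (mod p)"
    then have "p - 1 dvd p ^ k * t"
      unfolding b_def ord_divides ord .
    then have "q dvd p ^ k"
      using t t0 by simp
    then have "q dvd p"
      using q(1) prime_dvd_power by blast
    then have "q = p"
      using q(1) p by (simp add: primes_dvd_imp_eq)
    then show False
      using q(2) p1 by (auto dest: dvd_imp_le)
  qed
  then have "\<not> [int b = int 1] (mod int p)"
    unfolding cong_int_iff .
  then have ndvd: "\<not> int p dvd int b - 1"
    by (simp add: cong_iff_dvd_diff)
  show ?thesis
    using padic_abs_dvd_le[OF dvd] padic_abs_of_int_eq_1[OF ndvd]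
    by (intro exI[of _ "of_nat b"]) simp
qed

lemma padic_not_minimal:
  assumes "n \<ge> 2" "n = p - 1" and q: "Factorial_Ring.prime q" "odd q" "q dvd n"
  shows "\<not> minimal_topological_group (SL n (padic_topology p)) (SL_topology n (padic_topology p))"
proof -
  interpret tensor_power_SL UNIV "padic_abs p" n q
  proof
    show "0 < q" using prime_gt_0_nat[OF q(1)] .
    fix x :: rat assume "x ^ q = 1"
    \<comment> \<open>The order of the rationals decides: odd powers keep the sign, and nonnegative
      roots are unique.\<close>
    moreover have "x \<ge> 0"
    proof (rule ccontr)
      assume "\<not> x \<ge> 0"
      then have "x ^ q < 0" using q(2) by (simp add: power_less_zero_eq)
      then show False using \<open>x ^ q = 1\<close> by simp
    qed
    ultimately show "x = 1"
      using power_eq_imp_eq_base[of x q 1] prime_gt_0_nat[OF q(1)] by simp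
  qed (rule assms(1))
  have "\<exists>c :: rat. padic_abs p (c ^ q - 1) \<le> inverse (real p ^ Suc k) \<and> padic_abs p (c - 1) = 1" for k
    using padic_approximate_root[OF q(1)] q(3) assms(2) by simp
  then obtain c where c: "\<And>k. padic_abs p (c k ^ q - 1) \<le> inverse (real p ^ Suc k)"
    "\<And>k. padic_abs p (c k - 1) = 1" by metis
  have "padic.close_along sequentially (\<lambda>k. c k ^ q) (\<lambda>_. 1)"
  proof (rule padic.close_alongI)
    show "(\<lambda>k. inverse (real p ^ Suc k)) \<longlonglongrightarrow> 0"
      by (rule LIMSEQ_Suc, rule LIMSEQ_inverse_realpow_zero[OF real_p_gt_1])
  qed (use c(1) in auto)
  then show ?thesis
    using not_minimal[OF q(3), of c 1] c(2) by (simp add: padic_T)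
qed

end

section \<open>The Gaussian rationals\<close>

lemma complex_of_rat: "(of_rat a :: complex) = of_real (of_rat a)"
  by (cases a) (simp add: of_rat_rat)

lemma gauss_rat_iff: "z \<in> gauss_rat \<longleftrightarrow> Re z \<in> \<rat> \<and> Im z \<in> \<rat>"
proof
  assume "z \<in> gauss_rat"
  then obtain a b where "z = of_rat a + of_rat b * \<i>" by (auto simp: gauss_rat_def)
  moreover have "Re (of_rat a) = of_rat a" "Im (of_rat a) = 0" for a
    by (simp_all add: complex_of_rat)
  ultimately show "Re z \<in> \<rat> \<and> Im z \<in> \<rat>" by simp
next
  assume "Re z \<in> \<rat> \<and> Im z \<in> \<rat>"
  then obtain a b where ab: "Re z = of_rat a" "Im z = of_rat b" by (auto elim!: Rats_cases)
  have "z = of_real (of_rat a) + of_real (of_rat b) * \<i>"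
    using ab by (simp add: complex_eq_iff)
  then show "z \<in> gauss_rat"
    by (auto simp: gauss_rat_def complex_of_rat)
qed

interpretation gauss: valued_subfield gauss_rat "norm :: complex \<Rightarrow> real"
proof
  show "inverse x \<in> gauss_rat" if "x \<in> gauss_rat" for x
    using that by (simp add: gauss_rat_iff)
qed (auto simp: norm_mult norm_triangle_ineq gauss_rat_iff)

lemma gauss_T: "valued_subfield.T gauss_rat norm = gauss_rat_topology"
proof -
  have "(\<lambda>x y :: complex. norm (x - y)) = dist"
    by (simp add: dist_norm fun_eq_iff)
  then show ?thesis
    by (simp add: gauss.T_def gauss_rat_topology_def)
qed

lemma gauss_minimal:
  assumes "n \<ge> 2" "n = 2 ^ k"
  shows "minimal_topological_group (SL n gauss_rat_topology) (SL_topology n gauss_rat_topology)"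
proof -
  interpret valued_SL gauss_rat norm n
    by unfold_locales (rule assms(1))
  have "\<exists>S. finite S \<and> (\<forall>x\<in>gauss_rat. norm x \<le> R \<longrightarrow> (\<exists>s\<in>S. norm (x - s) < e))" if "e > 0" for R e :: real
  proof -
    \<comment> \<open>The centres range over all complex numbers, so compactness of the closed disc
      gives the net directly.\<close>
    have "cball 0 R \<subseteq> (\<Union>s\<in>UNIV. ball s e :: complex set)"
      using that by (auto intro: centre_in_ball[THEN iffD2])
    then obtain S where S: "finite S" "cball 0 R \<subseteq> (\<Union>s\<in>S. ball s e :: complex set)"
      using compactE_image[OF compact_cball, of UNIV "\<lambda>s. ball s e" "0 :: complex" R] by auto
    have "\<exists>s\<in>S. norm (x - s) < e" if "norm x \<le> R" for x
    proof -
      have "x \<in> cball 0 R" using that by simp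
      then have "x \<in> (\<Union>s\<in>S. ball s e)" using S(2) by (rule subsetD[rotated])
      then show ?thesis by (auto simp: dist_norm norm_minus_commute)
    qed
    then show ?thesis using S(1) by blast
  qed
  moreover have "\<exists>x\<in>gauss_rat. norm x > 1"
    by (intro bexI[of _ 2]) (auto simp: gauss_rat_iff)
  ultimately show ?thesis
    using minimal_power_of_2[OF assms(2)] by (simp only: gauss_T)
qed

text \<open>Twice the real part of a root of unity \<open>x\<close> is an algebraic integer: the numbers
  \<open>v ^ k * (x ^ k + inverse x ^ k)\<close> below satisfy a recursion over the integers.\<close>

lemma rational_root_of_unity_trace:
  fixes x :: complex
  assumes x: "x ^ q = 1" and q: "q > 0" and u: "2 * Re x = of_int u / of_int v" "coprime u v" "v > 0"
  shows "v = 1"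
proof -
  have x0: "x \<noteq> 0" using x q by (auto simp: power_0_left)
  have "norm x ^ q = 1" using x by (simp flip: norm_power)
  then have nx: "norm x = 1"
    using power_eq_imp_eq_base[of "norm x" q 1] q by simp
  have "x + inverse x = of_real (2 * Re x)"
    using nx x0 by (simp add: complex_eq_iff cmod_def)
  then have tr: "of_int v * (x + inverse x) = of_int u"
    using u(1,3) by simp
  \<comment> \<open>Two consecutive terms are carried because the recursion has order 2. The
    congruence concerns the later one only: the term for 0 is 2, not \<open>u ^ 0\<close>.\<close>
  have "\<exists>s t :: int. of_int v ^ k * (x ^ k + inverse x ^ k) = (of_int s :: complex) \<and>
      of_int v ^ Suc k * (x ^ Suc k + inverse x ^ Suc k) = (of_int t :: complex) \<and>
      [t = u ^ Suc k] (mod v)" for k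
  proof (induction k)
    case 0
    show ?case
      using tr by (intro exI[of _ 2] exI[of _ u]) simp
  next
    case (Suc k)
    then obtain s t where st: "of_int v ^ k * (x ^ k + inverse x ^ k) = (of_int s :: complex)"
      "of_int v ^ Suc k * (x ^ Suc k + inverse x ^ Suc k) = (of_int t :: complex)" "[t = u ^ Suc k] (mod v)"
      by blast
    have "x ^ Suc (Suc k) + inverse x ^ Suc (Suc k)
        = (x + inverse x) * (x ^ Suc k + inverse x ^ Suc k) - (x ^ k + inverse x ^ k)"
    proof -
      define y where "y = inverse x"
      have c: "x * (y * z) = z" for z using x0 by (simp add: y_def)
      show ?thesis
        unfolding y_def[symmetric] by (simp add: algebra_simps c)
    qed
    then have "of_int v ^ Suc (Suc k) * (x ^ Suc (Suc k) + inverse x ^ Suc (Suc k))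
        = (of_int v * (x + inverse x)) * (of_int v ^ Suc k * (x ^ Suc k + inverse x ^ Suc k))
          - of_int v * of_int v * (of_int v ^ k * (x ^ k + inverse x ^ k))"
      by (simp add: algebra_simps)
    also have "\<dots> = of_int (u * t - v * v * s)"
      unfolding tr st by simp
    finally have "of_int v ^ Suc (Suc k) * (x ^ Suc (Suc k) + inverse x ^ Suc (Suc k)) = of_int (u * t - v * v * s)" .
    moreover have "[u * t - v * v * s = u * u ^ Suc k - 0] (mod v)"
      by (intro cong_diff cong_mult cong_refl st(3)) (simp add: cong_0_iff)
    ultimately show ?case
      using st(2) by (intro exI[of _ t] exI[of _ "u * t - v * v * s"]) simp
  qed
  \<comment> \<open>As \<open>x ^ q = 1\<close>, the term of index \<open>q\<close> is
    \<open>2 * v ^ q\<close>, divisible by \<open>v\<close>; it is also congruent to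
    \<open>u ^ q\<close>, which is coprime to \<open>v\<close>.\<close>
  from this[of "q - 1"] obtain t where t: "of_int v ^ q * (x ^ q + inverse x ^ q) = (of_int t :: complex)" "[t = u ^ q] (mod v)"
    using q by auto
  have "inverse x ^ q = 1" using x by (simp add: power_inverse)
  then have "(of_int (v ^ q * 2) :: complex) = of_int t"
    using t(1) x by simp
  then have "t = v ^ q * 2" by (simp only: of_int_eq_iff)
  then have "[t = 0] (mod v)"
    using q by (simp add: cong_0_iff dvd_power)
  then have "v dvd u ^ q"
    using t(2) by (metis cong_0_iff cong_sym cong_trans)
  moreover have "coprime v (u ^ q)"
    using u(2) by (simp add: coprime_commute)
  ultimately have "is_unit v"
    by (meson coprime_common_divisor dvd_refl)
  then show ?thesis using u(3) by simp
qed

text \<open>Twice the real part is an integer between -2 and 2. For 1 and -1 the imaginary part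
  would be half a square root of 3, which is irrational; 0 and -2 make the square of
  \<open>x\<close> or \<open>x\<close> itself equal to -1, incompatible with an odd
  exponent.\<close>

lemma gauss_odd_root_of_unity:
  assumes x: "x \<in> gauss_rat" "x ^ q = 1" and q: "odd q"
  shows "x = 1"
proof -
  have q0: "q > 0" using q by (auto intro: Nat.gr0I)
  have "norm x ^ q = 1" using x by (simp flip: norm_power)
  then have "norm x = 1"
    using power_eq_imp_eq_base[of "norm x" q 1] q0 by simp
  then have iterated_square: "(Re x)\<^sup>2 + (Im x)\<^sup>2 = 1"
    by (metis cmod_power2 one_power2)
  have "2 * Re x \<in> \<rat>" using x by (simp add: gauss_rat_iff)
  then obtain u v where uv: "2 * Re x = of_int u / of_int v" "coprime u v" "v > (0 :: int)"
    by (metis Rats_cases')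
  have "v = 1" by (rule rational_root_of_unity_trace[OF x(2) q0 uv])
  then have u: "2 * Re x = of_int u" using uv by simp
  have "(2 * Re x)\<^sup>2 = 4 * (Re x)\<^sup>2"
    by (simp add: power_mult_distrib)
  then have "(2 * Re x)\<^sup>2 \<le> 4"
    using iterated_square zero_le_power2[of "Im x"] by linarith
  then have "of_int (u\<^sup>2) \<le> (of_int 4 :: real)" by (simp add: u)
  then have "u\<^sup>2 \<le> 4" by (simp only: of_int_le_iff)
  then have "\<bar>u\<bar> \<le> \<bar>2\<bar>" unfolding abs_le_square_iff by simp
  then have "\<bar>u\<bar> \<le> 2" by simp
  then consider "u = 2" | "u = - 2" | "\<bar>u\<bar> = 1" | "u = 0" by linarith
  then show ?thesis
  proof cases
    case 1
    then have "Re x = 1" using u by simp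
    then show ?thesis using iterated_square by (simp add: complex_eq_iff)
  next
    case 2
    then have "Re x = - 1" using u by simp
    then have "x = - 1" using iterated_square by (simp add: complex_eq_iff)
    then show ?thesis using x(2) q by simp
  next
    case 3
    then have "(2 * Re x)\<^sup>2 = 1" unfolding u by (metis of_int_1 of_int_abs power2_abs one_power2)
    then have im: "(2 * Im x)\<^sup>2 = 3" using iterated_square by (simp add: power_mult_distrib)
    have "2 * Im x \<in> \<rat>" using x by (simp add: gauss_rat_iff)
    then obtain s t where st: "2 * Im x = of_int s / of_int t" "coprime s t" "t > (0 :: int)"
      by (metis Rats_cases')
    have "of_int (s\<^sup>2) = (of_int (3 * t\<^sup>2) :: real)"
      using im st(3) unfolding st(1) by (simp add: field_simps)
    then have e: "s\<^sup>2 = 3 * t\<^sup>2" by (simp only: of_int_eq_iff)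
    have p3: "Factorial_Ring.prime (3 :: int)" by simp
    have "3 dvd s\<^sup>2" unfolding e by simp
    then have s3: "3 dvd s" using p3 prime_dvd_power by blast
    then obtain s' where "s = 3 * s'" by auto
    then have "t\<^sup>2 = 3 * s'\<^sup>2" using e by (simp add: power_mult_distrib)
    then have "3 dvd t\<^sup>2" by simp
    then have "3 dvd t" using p3 prime_dvd_power by blast
    then have "is_unit (3 :: int)" using s3 st(2) coprime_common_divisor by blast
    then show ?thesis by simp
  next
    case 4
    then have re: "Re x = 0" using u by simp
    then have im: "(Im x)\<^sup>2 = 1" using iterated_square by simp
    have "x\<^sup>2 = - 1" using re im by (simp add: complex_eq_iff power2_eq_square)
    then have "(- 1 :: complex) ^ q = 1"
      using x(2) by (metis mult.commute power_mult power_one)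
    then show ?thesis using q by simp
  qed
qed

lemma gauss_rat_dense:
  assumes "e > 0"
  shows "\<exists>c\<in>gauss_rat. norm (c - z) < e"
proof -
  have "\<exists>r\<in>\<rat>. \<bar>r - y\<bar> < e / 2" for y :: real
  proof -
    have "y - e / 2 < y + e / 2" using assms by simp
    then obtain r where "r \<in> \<rat>" "y - e / 2 < r" "r < y + e / 2"
      using Rats_dense_in_real by blast
    then show ?thesis
      by (intro bexI[of _ r]) (unfold abs_less_iff, linarith+)
  qed
  then obtain a b where ab: "a \<in> \<rat>" "b \<in> \<rat>" "\<bar>a - Re z\<bar> < e / 2" "\<bar>b - Im z\<bar> < e / 2"
    by metis
  have "norm (Complex a b - z) \<le> \<bar>Re (Complex a b - z)\<bar> + \<bar>Im (Complex a b - z)\<bar>"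
    by (rule cmod_le)
  also have "\<dots> < e" using ab by simp
  finally show ?thesis
    using ab by (intro bexI[of _ "Complex a b"]) (simp_all add: gauss_rat_iff)
qed

lemma gauss_not_minimal:
  assumes "n \<ge> 2" and q: "Factorial_Ring.prime q" "odd q" "q dvd n"
  shows "\<not> minimal_topological_group (SL n gauss_rat_topology) (SL_topology n gauss_rat_topology)"
proof -
  have q0: "q > 0" and q1: "q > 1" using prime_gt_1_nat[OF q(1)] by auto
  interpret tensor_power_SL gauss_rat norm n q
    by unfold_locales (use assms(1) q0 gauss_odd_root_of_unity[OF _ _ q(2)] in auto)
  define w where "w = cis (2 * pi / q)"
  have wq: "w ^ q = 1"
    using q0 by (simp add: w_def DeMoivre)
  have w1: "w \<noteq> 1"
  proof
    assume "w = 1"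
    then have "cos (2 * pi / q) = 1" by (simp add: w_def complex_eq_iff)
    then obtain m :: int where "2 * pi / q = real_of_int m * 2 * pi" unfolding cos_one_2pi_int by blast
    then have "real_of_int (m * int q) = 1" using q0 by (simp add: field_simps)
    then have "m * int q = 1" by linarith
    then show False using q1 by (simp add: zmult_eq_1_iff)
  qed
  \<comment> \<open>Half the distance from \<open>w\<close> to 1: approximations within
    \<open>d\<close> of \<open>w\<close> then stay at distance at least \<open>d\<close> from
    1.\<close>
  define d where "d = norm (w - 1) / 2"
  have d: "d > 0" using w1 by (simp add: d_def)
  have "\<exists>c\<in>gauss_rat. norm (c - w) < min d (inverse (real (Suc k)))" for k
    using d by (intro gauss_rat_dense) simp
  then obtain c where c: "\<And>k. c k \<in> gauss_rat" "\<And>k. norm (c k - w) < min d (inverse (real (Suc k)))"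
    by metis
  have "gauss.close_along sequentially c (\<lambda>_. w)"
    by (rule gauss.close_alongI[OF LIMSEQ_inverse_real_of_nat]) (use c(2) in \<open>auto intro!: always_eventually less_imp_le\<close>)
  from gauss.close_along_power[OF this gauss.bounded_along_const, of q]
  have "gauss.close_along sequentially (\<lambda>k. c k ^ q) (\<lambda>_. 1)" by (simp add: wq)
  moreover have "norm (c k - 1) \<ge> d" for k
    using norm_triangle_ineq[of "w - c k" "c k - 1"] c(2)[of k]
    by (simp add: d_def norm_minus_commute)
  ultimately show ?thesis
    using not_minimal[OF q(3) c(1) _ d] by (simp add: gauss_T)
qed

theorem theorem1p2:
  fixes p :: nat
  assumes "Factorial_Ring.prime p" and "odd p"
  shows "(fermat_prime p \<longleftrightarrow>
            minimal_topological_group (SL (p - 1) (padic_topology p))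
              (SL_topology (p - 1) (padic_topology p))) \<and>
         (minimal_topological_group (SL (p - 1) (padic_topology p))
              (SL_topology (p - 1) (padic_topology p)) \<longleftrightarrow>
            minimal_topological_group (SL (p - 1) gauss_rat_topology)
              (SL_topology (p - 1) gauss_rat_topology))"
proof -
  have "p \<ge> 2" "p \<noteq> 2" using prime_ge_2_nat[OF assms(1)] assms(2) by auto
  then have n2: "p - 1 \<ge> 2" by simp
  show ?thesis
  \<comment> \<open>Whether \<open>p - 1\<close> is a power of 2 decides both minimality statements
    at once, so in each case all three conditions have the same known truth value.\<close>
  proof (cases "fermat_prime p")
    case True
    then obtain k where "p - 1 = 2 ^ k"
      using fermat_prime_iff_power_of_2[OF assms] by blast
    then show ?thesis
      using True padic_minimal[OF assms(1) n2] gauss_minimal[OF n2] by blast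
  next
    case False
    then have "\<nexists>k. p - 1 = 2 ^ k"
      using fermat_prime_iff_power_of_2[OF assms] by blast
    moreover have "p - 1 > 0" using n2 by simp
    ultimately obtain q where "Factorial_Ring.prime q" "odd q" "q dvd p - 1"
      using not_power_of_2_odd_prime_dvd by metis
    then show ?thesis
      using False padic_not_minimal[OF assms(1) n2 refl] gauss_not_minimal[OF n2] by blast
  qed
qed

end
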